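(* Consider the Newtonian 4-body problem in $\mathbb{R}^3$ with masses $m_1,\dots,m_4>0$. For every $T>0$ and every spatial configuration $q_0$, there exists at least one total collision solution $q(t)$, $t\in[0,T)$, with $q(0)=q_0$, which approaches total collision in the shape of a regular tetrahedron as $t\to T^-$. Moreover, for every $t\in(0,T)$ the configuration $q(t)$ is spatial with the same orientation as $q_0$, and the limiting regular tetrahedron at total collision also has the same orientation as $q_0$.
   Context: Setting. A configuration is $q=(q_1,\dots,q_4)$ with $q_a\in\mathbb{R}^3$ and center of mass at the origin, $\sum_a m_aq_a=0$; the space of these is $\mathbb{E}_0$, with mass inner product $\langle q,y\rangle=\sum_a m_a\,q_a\cdot y_a$ and norm $\|q\|=\sqrt{\langle q,q\rangle}$. Let $U(q)=\sum_{a<b}\frac{m_am_b}{|q_a-q_b|}$ (the negative of the usual potential). Newton's equations are $\ddot q=\nabla U(q)$, the gradient being taken with respect to the mass inner product, i.e. $m_a\ddot q_a=\partial U/\partial q_a$. A solution is a collision-free solution in $\mathbb{E}_0$. A configuration is spatial if the linear span of $q_1,\dots,q_4$ is 3-dimensional (equivalently, since the center of mass is at the origin, the four points are the vertices of a nondegenerate tetrahedron). The orientation of a spatial configuration is the sign of $\det(q_2-q_1,\,q_3-q_1,\,q_4-q_1)$. A total collision solution on $[0,T)$ is a solution with $q(t)\to0$ as $t\to T^-$. It approaches total collision in the shape of a regular tetrahedron if there is a configuration $s_0\in\mathbb{E}_0$ with $\|s_0\|=1$ whose four points are the vertices of a regular tetrahedron (all six mutual distances equal) such that the distance from $q(t)/\|q(t)\|$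 to the orbit $\{(gs_{01},\dots,gs_{04}):g\in SO(3)\}$ tends to $0$ as $t\to T^-$; the orientation of the limiting tetrahedron is the orientation of $s_0$. *)

theory Defs
  imports "HOL-Analysis.Analysis"
begin

text \<open>The bodies are indexed by the numeral type \<open>4\<close>; its four elements are \<open>1, 2, 3, 4\<close>, with
  \<open>4 = 0\<close> (so in the order of the type the fourth body comes first, which is immaterial for sums
  over unordered pairs).\<close>

type_synonym config = "real ^ 3 ^ 4"

definition centered :: "(4 \<Rightarrow> real) \<Rightarrow> config set" where
  "centered m = {q. (\<Sum>a\<in>UNIV. m a *\<^sub>R (q $ a)) = 0}"

definition mass_inner :: "(4 \<Rightarrow> real) \<Rightarrow> config \<Rightarrow> config \<Rightarrow> real" where
  "mass_inner m q y = (\<Sum>a\<in>UNIV. m a * (q $ a \<bullet> y $ a))"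

definition mass_norm :: "(4 \<Rightarrow> real) \<Rightarrow> config \<Rightarrow> real" where
  "mass_norm m q = sqrt (mass_inner m q q)"

definition potential :: "(4 \<Rightarrow> real) \<Rightarrow> config \<Rightarrow> real" where
  "potential m q = (\<Sum>(a, b) | a < b. m a * m b / norm (q $ a - q $ b))"

text \<open>The gradient is that of a function on the full space \<open>(\<real>\<^sup>3)\<^sup>4\<close> with respect to the mass
  inner product; its components are \<open>(1 / m a) \<partial>f/\<partial>q\<^sub>a\<close>.\<close>

definition has_mass_gradient ::
    "(4 \<Rightarrow> real) \<Rightarrow> (config \<Rightarrow> real) \<Rightarrow> config \<Rightarrow> config \<Rightarrow> bool" where
  "has_mass_gradient m f G x \<longleftrightarrow> (f has_derivative (\<lambda>h. mass_inner m G h)) (at x)"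

definition collision_free :: "config \<Rightarrow> bool" where
  "collision_free q \<longleftrightarrow> (\<forall>a b. a \<noteq> b \<longrightarrow> q $ a \<noteq> q $ b)"

text \<open>Derivatives are taken within \<open>[0,T)\<close>, hence one-sided at \<open>0\<close>.\<close>

definition newton_solution :: "(4 \<Rightarrow> real) \<Rightarrow> real \<Rightarrow> (real \<Rightarrow> config) \<Rightarrow> bool" where
  "newton_solution m T q \<longleftrightarrow>
     (\<forall>t\<in>{0..<T}. q t \<in> centered m \<and> collision_free (q t)) \<and>
     (\<exists>v w. \<forall>t\<in>{0..<T}.
        (q has_vector_derivative v t) (at t within {0..<T}) \<and>
        (v has_vector_derivative w t) (at t within {0..<T}) \<and>
        has_mass_gradient m (potential m) (w t) (q t))"

definition total_collision_solution :: "(4 \<Rightarrow> real) \<Rightarrow> real \<Rightarrow> (real \<Rightarrow> config) \<Rightarrow> bool" where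
  "total_collision_solution m T q \<longleftrightarrow> newton_solution m T q \<and> (q \<longlongrightarrow> 0) (at_left T)"

definition spatial :: "config \<Rightarrow> bool" where
  "spatial q \<longleftrightarrow> dim (span (range (\<lambda>a. q $ a))) = 3"

definition orientation :: "config \<Rightarrow> real" where
  "orientation q = sgn (det (vector [q $ 2 - q $ 1, q $ 3 - q $ 1, q $ 4 - q $ 1] :: real ^ 3 ^ 3))"

definition regular_tetrahedron :: "config \<Rightarrow> bool" where
  "regular_tetrahedron s \<longleftrightarrow> (\<exists>d>0. \<forall>a b. a \<noteq> b \<longrightarrow> dist (s $ a) (s $ b) = d)"

definition rotation_orbit :: "config \<Rightarrow> config set" where
  "rotation_orbit s = {(\<chi> a. g *v (s $ a)) |g :: real ^ 3 ^ 3. rotation_matrix g}"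

definition mass_dist_to :: "(4 \<Rightarrow> real) \<Rightarrow> config \<Rightarrow> config set \<Rightarrow> real" where
  "mass_dist_to m x S = (INF y\<in>S. mass_norm m (x - y))"

definition limiting_tetrahedron ::
    "(4 \<Rightarrow> real) \<Rightarrow> real \<Rightarrow> (real \<Rightarrow> config) \<Rightarrow> config \<Rightarrow> bool" where
  "limiting_tetrahedron m T q s \<longleftrightarrow>
     s \<in> centered m \<and> mass_norm m s = 1 \<and> regular_tetrahedron s \<and>
     ((\<lambda>t. mass_dist_to m ((1 / mass_norm m (q t)) *\<^sub>R q t) (rotation_orbit s)) \<longlongrightarrow> 0) (at_left T)"

end

theory Submission
  imports Defs
begin

text \<open>
  In normalized Jacobi coordinates a centered configuration is a \<open>3 \<times> 3\<close> matrix \<open>X\<close>, the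
  potential is \<open>U(X) = \<Sum> w\<^sub>p / |X e\<^sub>p|\<close>, and Newton's equation is \<open>X'' = - X B(X)\<close> with the symmetric
  positive semidefinite matrix \<open>B(X) = \<Sum> w\<^sub>p |X e\<^sub>p|\<^sup>-\<^sup>3 e\<^sub>p e\<^sub>p\<^sup>T\<close>. On motions with zero angular momentum
  \<open>X' = X S\<close> with \<open>S\<close> symmetric and \<open>S' = - S\<^sup>2 - B \<le> - S\<^sup>2\<close>; hence a motion that stays spatial on
  \<open>[0, T)\<close> satisfies \<open>S \<ge> - 1 / (T - t)\<close>, which bounds its distance from the degenerate matrices from below.

  Such a motion is a limit of minimizers of a discretized action for paths from \<open>X\<^sub>0\<close> to \<open>0\<close>. A minimizer has
  zero angular momentum because it ends at \<open>0\<close>, it cannot degenerate because its tail could be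
  reflected, and it satisfies a discrete Riccati inequality, so that the bounds are uniform in the step
  size. The total collision at time \<open>T\<close> is a boundary condition of the minimization.

  In the variables \<open>\<xi> = (T - t)\<^sup>-\<^sup>2\<^sup>/\<^sup>3 X\<close>, \<open>\<tau> = - ln (T - t)\<close> the equation becomes
  \<open>\<xi>'' = \<xi>' / 3 + 2 \<xi> / 9 - \<xi> B(\<xi>)\<close>, whose energy is nondecreasing; as \<open>\<xi>\<close> stays bounded, it
  approaches the set of central configurations, where \<open>\<xi> B(\<xi>) = 2 \<xi> / 9\<close>. At planar and collinear
  central configurations \<open>tr B > 2 / 3\<close>, by the convexity of \<open>U\<close> as a function of \<open>X\<^sup>T X\<close> and by a
  Perron-Frobenius argument respectively. The Riccati equation then forbids the volume \<open>|det \<xi>|\<close> to decrease near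
  them, so every limit point is spatial, hence has \<open>B(\<xi>) = 2 / 9\<close>, which makes all mutual
  distances equal.
\<close>

section \<open>Matrices\<close>

text \<open>With the continuous action, collisions of a minimizer at inner times would have to be
  excluded by a separate theory. On a grid a minimizer exists by compactness and satisfies its
  Euler-Lagrange equation at every inner node. Collisions are then controlled through degeneracy
  alone: two bodies are at distance \<open>norm (X *v e p)\<close>, which is at least the smallest
  singular value of \<open>X\<close> times \<open>norm (e p)\<close>. So the limit rests on a lower
  bound for that singular value that does not depend on the step. Everything is phrased with rows:
  \<open>u v* X\<close> is the transpose of \<open>X\<close> applied to \<open>u\<close>; it
  vanishes for some nonzero \<open>u\<close> exactly when \<open>X\<close> is degenerate, and zero
  angular momentum means that \<open>(u v* V) \<bullet> (z v* X)\<close> is symmetric in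
  \<open>u\<close> and \<open>z\<close> for the velocity \<open>V\<close>. The action bound gives
  only |x|^2 = O(T - t), while the power law needs the exponent 4/3; the monotone energy and the
  bounded one together close this gap. The constants come from the homothetic motion (T - t)^(2/3)
  X: 2/9 is 2/3 times 1/3, the bound -1/3 is 2/3 - 1, and the critical trace 2/3 is three times
  2/9.\<close>

definition outer :: "real ^ 'm \<Rightarrow> real ^ 'n \<Rightarrow> real ^ 'n ^ 'm" where
  "outer a b = (\<chi> i. (a $ i) *\<^sub>R b)"

lemma inner_outer: "outer a b \<bullet> H = a \<bullet> (H *v b)"
  by (simp add: inner_vec_def outer_def matrix_vector_mult_def sum_distrib_left mult_ac)

lemma outer_vec: "outer a b *v c = (b \<bullet> c) *\<^sub>R a"
  by (simp add: vec_eq_iff inner_vec_def outer_def matrix_vector_mult_def sum_distrib_left mult_ac)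

lemma vec_outer: "u v* outer a b = (u \<bullet> a) *\<^sub>R b"
  by (simp add: vec_eq_iff inner_vec_def outer_def vector_matrix_mult_def sum_distrib_left mult_ac)

lemma matrix_mult_outer: "A ** outer a b = outer (A *v a) b"
  by (simp add: vec_eq_iff outer_def matrix_matrix_mult_def matrix_vector_mult_def sum_distrib_left mult_ac)

lemma inner_outer_outer: "outer a b \<bullet> outer c d = (a \<bullet> c) * (b \<bullet> d)"
  by (simp add: inner_outer outer_vec inner_commute)

lemma outer_zero [simp]: "outer 0 b = 0" "outer a 0 = 0"
  by (simp_all add: outer_def vec_eq_iff)

lemma norm_outer: "norm (outer a b) = norm a * norm b"
  by (simp add: norm_eq_sqrt_inner inner_outer_outer real_sqrt_mult)

lemma bounded_bilinear_mv: "bounded_bilinear ((*v) :: real ^ 'n ^ 'm \<Rightarrow> real ^ 'n \<Rightarrow> real ^ 'm)"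
  unfolding bilinear_conv_bounded_bilinear[symmetric] bilinear_def
  by (auto intro!: linearI simp: algebra_simps scaleR_matrix_vector_assoc[symmetric])

lemma bounded_bilinear_vm: "bounded_bilinear ((v*) :: real ^ 'm \<Rightarrow> real ^ 'n ^ 'm \<Rightarrow> real ^ 'n)"
  unfolding bilinear_conv_bounded_bilinear[symmetric] bilinear_def
  by (auto intro!: linearI simp: algebra_simps scaleR_vector_matrix_assoc vector_scaleR_matrix_ac)

lemma bounded_bilinear_outer:
  "bounded_bilinear (outer :: real ^ 'm \<Rightarrow> real ^ 'n \<Rightarrow> real ^ 'n ^ 'm)"
  unfolding bilinear_conv_bounded_bilinear[symmetric] bilinear_def
  by (auto intro!: linearI simp: outer_def vec_eq_iff algebra_simps)

lemma bounded_bilinear_mm: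
  "bounded_bilinear ((**) :: real ^ 'n ^ 'm \<Rightarrow> real ^ 'k ^ 'n \<Rightarrow> real ^ 'k ^ 'm)"
  unfolding bilinear_conv_bounded_bilinear[symmetric] bilinear_def
  by (auto intro!: linearI simp: vec_eq_iff matrix_matrix_mult_def algebra_simps sum.distrib sum_distrib_left)

lemma surj_vm_iff: "(\<forall>u. u v* A = 0 \<longrightarrow> u = 0) \<longleftrightarrow> (\<forall>y. \<exists>u. u v* A = y)" for A :: "real ^ 'n ^ 'n"
proof -
  have lin: "linear (\<lambda>u. u v* A)"
    using bounded_bilinear.bounded_linear_left[OF bounded_bilinear_vm, of A]
    by (rule bounded_linear.linear)
  have "(\<forall>u. u v* A = 0 \<longrightarrow> u = 0) \<longleftrightarrow> inj (\<lambda>u. u v* A)"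
    using linear_injective_0[OF lin] by simp
  also have "\<dots> \<longleftrightarrow> surj (\<lambda>u. u v* A)"
    using linear_injective_imp_surjective[OF lin] linear_surjective_imp_injective[OF lin] by blast
  also have "\<dots> \<longleftrightarrow> (\<forall>y. \<exists>u. u v* A = y)" unfolding surj_def by metis
  finally show ?thesis .
qed

text \<open>\<open>A\<close> and its transpose have the same smallest singular value: solve
  \<open>u v* A = v\<close> and apply Cauchy-Schwarz to \<open>u \<bullet> (A *v v)\<close>. This
  turns row bounds into lower bounds for mutual distances.\<close>

lemma norm_mv_ge:
  fixes A :: "real ^ 'n ^ 'n"
  assumes s: "s > 0" and le: "\<And>u. s * norm u \<le> norm (u v* A)"
  shows "s * norm v \<le> norm (A *v v)"
proof -
  have "\<forall>u. u v* A = 0 \<longrightarrow> u = 0"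
  proof (intro allI impI)
    fix u assume "u v* A = 0"
    with le[of u] s show "u = 0" by (simp add: mult_le_0_iff)
  qed
  then obtain u where u: "u v* A = v" using surj_vm_iff by blast
  have "norm v * norm v = u \<bullet> (A *v v)"
    by (metis u dot_lmul_matrix power2_norm_eq_inner power2_eq_square)
  also have "\<dots> \<le> norm u * norm (A *v v)" by (rule norm_cauchy_schwarz)
  finally have 1: "norm v * norm v \<le> norm u * norm (A *v v)" .
  have "s * norm v * norm v \<le> s * (norm u * norm (A *v v))"
    using 1 s by (simp add: mult.assoc mult_left_mono)
  also have "\<dots> \<le> norm v * norm (A *v v)"
    using le[of u] u by (simp add: mult.assoc[symmetric] mult_right_mono)
  finally have "norm v * (s * norm v) \<le> norm v * norm (A *v v)" by (simp add: mult_ac)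
  then show ?thesis by (cases "norm v = 0") (auto simp: mult_le_cancel_left)
qed

section \<open>Reflections in a hyperplane\<close>

lemma norm_diff_scaleR_power2:
  "(norm (a - c *\<^sub>R b))\<^sup>2 = (norm a)\<^sup>2 - 2 * c * (b \<bullet> a) + c * c * (b \<bullet> b)"
  for a b :: "'a::real_inner"
  by (simp add: power2_norm_eq_inner inner_diff_left inner_diff_right inner_commute algebra_simps)

text \<open>The Householder reflection in the hyperplane orthogonal to \<open>u\<close>, acting on
  the space in which the bodies move, hence preserving every \<open>norm (A *v z)\<close>. For
  \<open>u = 0\<close> the quotient is 0 and the map is the identity.\<close>

definition reflect :: "real ^ 'm \<Rightarrow> real ^ 'n ^ 'm \<Rightarrow> real ^ 'n ^ 'm" where
  "reflect u A = A - (2 / (u \<bullet> u)) *\<^sub>R outer u (u v* A)"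

lemma reflect_diff: "reflect u A - reflect u B = reflect u (A - B)"
  by (simp add: reflect_def vector_matrix_mult_diff_rdistrib
      bounded_bilinear.diff_right[OF bounded_bilinear_outer] algebra_simps)

lemma reflect_zero [simp]: "reflect u 0 = 0"
  by (simp add: reflect_def)

lemma vm_reflect: "u \<noteq> 0 \<Longrightarrow> u v* reflect u A = - (u v* A)"
  by (simp add: reflect_def vector_matrix_mult_diff_rdistrib vector_scaleR_matrix_ac vec_outer
      scaleR_2)

text \<open>For neighbouring nodes \<open>A\<close> and \<open>B\<close> of a path this is the price
  of mirroring everything beyond one link; its sign is that of
  \<open>(u v* A) \<bullet> (u v* B)\<close>.\<close>

lemma norm_reflect_diff:
  assumes "u \<noteq> 0"
  shows "(norm (reflect u A - B))\<^sup>2 = (norm (A - B))\<^sup>2 + 4 / (u \<bullet> u) * ((u v* A) \<bullet> (u v* B))"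
proof -
  define c where "c = 2 / (u \<bullet> u)"
  define y where "y = u v* A"
  have c: "c * c * (u \<bullet> u) = 2 * c" using assms by (simp add: c_def)
  have "reflect u A - B = (A - B) - c *\<^sub>R outer u y"
    by (simp add: reflect_def c_def y_def)
  have "(norm (reflect u A - B))\<^sup>2
      = (norm (A - B))\<^sup>2 - 2 * c * (outer u y \<bullet> (A - B)) + c * c * (u \<bullet> u) * (y \<bullet> y)"
    unfolding \<open>reflect u A - B = _\<close> norm_diff_scaleR_power2 inner_outer_outer by simp
  also have "outer u y \<bullet> (A - B) = y \<bullet> y - (u v* A) \<bullet> (u v* B)"
    by (simp add: inner_diff_right inner_outer dot_lmul_matrix[symmetric] y_def[symmetric])
       (simp add: inner_commute)
  finally show ?thesis unfolding c by (simp add: c_def algebra_simps)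
qed

lemma norm_reflect [simp]: "norm (reflect u A) = norm A"
proof (cases "u = 0")
  case True
  then show ?thesis by (simp add: reflect_def)
next
  case False
  from norm_reflect_diff[OF this, of A 0] show ?thesis by simp
qed

lemma norm_reflect_mv [simp]: "norm (reflect u A *v z) = norm (A *v z)"
proof (cases "u = 0")
  case True
  then show ?thesis by (simp add: reflect_def)
next
  case False
  have *: "reflect u A *v z = A *v z - (2 * (u \<bullet> (A *v z)) / (u \<bullet> u)) *\<^sub>R u"
    by (simp add: reflect_def matrix_vector_mult_diff_rdistrib scaleR_matrix_vector_assoc[symmetric]
        outer_vec dot_lmul_matrix)
  have "(norm (reflect u A *v z))\<^sup>2 = (norm (A *v z))\<^sup>2"
    unfolding * norm_diff_scaleR_power2 using False by (simp add: field_simps)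
  then show ?thesis by (rule power2_eq_imp_eq) auto
qed

lemma psd_cauchy_schwarz:
  fixes A B :: "real ^ 'n ^ 'n"
  assumes sym: "\<And>u v. (u v* A) \<bullet> (v v* B) = (v v* A) \<bullet> (u v* B)"
    and psd: "\<And>u. 0 \<le> (u v* A) \<bullet> (u v* B)"
  shows "((u v* A) \<bullet> (v v* B))\<^sup>2 \<le> ((u v* A) \<bullet> (u v* B)) * ((v v* A) \<bullet> (v v* B))"
proof -
  define a b c where "a = (u v* A) \<bullet> (u v* B)" "b = (u v* A) \<bullet> (v v* B)" "c = (v v* A) \<bullet> (v v* B)"
  have q: "0 \<le> a * s * s + 2 * b * s * t + c * t * t" for s t
  proof -
    have "((s *\<^sub>R u + t *\<^sub>R v) v* A) \<bullet> ((s *\<^sub>R u + t *\<^sub>R v) v* B)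
       = a * s * s + 2 * b * s * t + c * t * t"
      by (simp add: a_b_c_def vector_matrix_left_distrib scaleR_vector_matrix_assoc
          inner_add_left inner_add_right sym[of v u] algebra_simps)
    with psd[of "s *\<^sub>R u + t *\<^sub>R v"] show ?thesis by simp
  qed
  have "b\<^sup>2 \<le> a * c"
  proof (cases "a = 0")
    case True
    have "b = 0"
    proof (rule ccontr)
      assume "b \<noteq> 0"
      \<comment> \<open>With \<open>a = 0\<close> the quadratic expression takes the value -1 at
        this argument.\<close>
      with q[of "- (c + 1) / (2 * b)" 1] True show False by simp
    qed
    with True show ?thesis by simp
  next
    case False
    with psd[of u] have "a > 0" by (simp add: a_b_c_def)
    with q[of "- b / a" 1] show ?thesis
      by (simp add: field_simps power2_eq_square)
  qed
  then show ?thesis by (simp add: a_b_c_def)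
qed

section \<open>The potential\<close>

text \<open>\<open>X *v e p\<close> stands for the difference of the positions in the pair
  \<open>p\<close>, and \<open>w p\<close> for the product of its masses. The variational part needs
  nothing else and works for square matrices of any size.\<close>

locale pair_potential =
  fixes P :: "'i set" and e :: "'i \<Rightarrow> real ^ 'n" and w :: "'i \<Rightarrow> real"
  assumes finite_P: "finite P"
    and w_pos: "p \<in> P \<Longrightarrow> w p > 0"
    and e_nz: "p \<in> P \<Longrightarrow> e p \<noteq> 0"
begin

definition collisionless :: "real ^ 'n ^ 'n \<Rightarrow> bool" where
  "collisionless X \<longleftrightarrow> (\<forall>p\<in>P. X *v e p \<noteq> 0)"

definition pot :: "real ^ 'n ^ 'n \<Rightarrow> real" where
  "pot X = (\<Sum>p\<in>P. w p / norm (X *v e p))"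

text \<open>The gradient of \<open>pot\<close> for the Frobenius inner product. Both are total
  functions, because division by zero gives 0 at a collision; hence the hypothesis
  \<open>collisionless\<close> wherever they are differentiated.\<close>

definition force :: "real ^ 'n ^ 'n \<Rightarrow> real ^ 'n ^ 'n" where
  "force X = - (\<Sum>p\<in>P. (w p / norm (X *v e p) ^ 3) *\<^sub>R outer (X *v e p) (e p))"

lemma w_nonneg: "p \<in> P \<Longrightarrow> w p \<ge> 0"
  using w_pos[of p] by simp

lemma force_inner: "force X \<bullet> H = - (\<Sum>p\<in>P. w p / norm (X *v e p) ^ 3 * ((X *v e p) \<bullet> (H *v e p)))"
  by (simp add: force_def inner_sum_left inner_outer)

lemma vm_force: "u v* force X = - (\<Sum>p\<in>P. (w p / norm (X *v e p) ^ 3 * (u \<bullet> (X *v e p))) *\<^sub>R e p)"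
proof -
  interpret bl: bounded_linear "\<lambda>A::real^'n^'n. u v* A"
    by (rule bounded_bilinear.bounded_linear_right[OF bounded_bilinear_vm])
  show ?thesis by (simp add: force_def bl.neg bl.sum bl.scaleR vec_outer)
qed

lemma vm_force_inner:
  "(u v* force X) \<bullet> (v v* X) = - (\<Sum>p\<in>P. w p / norm (X *v e p) ^ 3 * (u \<bullet> (X *v e p)) * (v \<bullet> (X *v e p)))"
  by (simp add: vm_force inner_sum_left dot_lmul_matrix inner_commute[of "e _"])

text \<open>The vanishing of the total torque.\<close>

lemma vm_force_inner_sym: "(u v* force X) \<bullet> (v v* X) = (v v* force X) \<bullet> (u v* X)"
  by (simp add: vm_force_inner mult_ac)

text \<open>The force is attractive; this sign drives the Riccati comparison.\<close>

lemma vm_force_inner_nonpos: "(u v* force X) \<bullet> (u v* X) \<le> 0"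
  unfolding vm_force_inner
  by (auto intro!: sum_nonneg simp: mult.assoc w_nonneg)

lemma vm_force_zero: "u v* X = 0 \<Longrightarrow> u v* force X = 0"
  by (simp add: vm_force dot_lmul_matrix[symmetric])

lemma pot_nonneg: "pot X \<ge> 0"
  by (auto simp: pot_def intro!: sum_nonneg divide_nonneg_nonneg w_nonneg)

lemma pot_ge: "p \<in> P \<Longrightarrow> w p / norm (X *v e p) \<le> pot X"
  unfolding pot_def
  by (rule member_le_sum) (auto simp: finite_P intro!: divide_nonneg_nonneg w_nonneg)

lemma pot_has_derivative:
  assumes "collisionless X"
  shows "(pot has_derivative (\<lambda>H. force X \<bullet> H)) (at X)"
proof -
  have *: "((\<lambda>X. w p / norm (X *v e p)) has_derivative
      (\<lambda>H. - (w p / norm (X *v e p) ^ 3 * ((X *v e p) \<bullet> (H *v e p))))) (at X)" if "p \<in> P" for p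
  proof -
    have nz: "X *v e p \<noteq> 0" using assms that by (auto simp: collisionless_def)
    have d: "((\<lambda>X. X *v e p) has_derivative (\<lambda>H. H *v e p)) (at X)"
      by (rule bounded_linear_imp_has_derivative)
        (rule bounded_bilinear.bounded_linear_left[OF bounded_bilinear_mv])
    have n: "((\<lambda>X. norm (X *v e p)) has_derivative (\<lambda>H. sgn (X *v e p) \<bullet> (H *v e p))) (at X)"
      using has_derivative_compose[OF d has_derivative_norm[OF nz]] by (simp add: inner_commute)
    show ?thesis
      by (rule has_derivative_eq_rhs[OF has_derivative_divide'[OF has_derivative_const n]])
        (use nz in \<open>auto simp: sgn_div_norm power3_eq_cube fun_eq_iff divide_simps\<close>)
  qed
  show ?thesis
    unfolding pot_def[abs_def] force_inner sum_negf[symmetric]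
    by (rule has_derivative_sum) (rule *)
qed

lemma continuous_on_pot: "(\<And>X. X \<in> S \<Longrightarrow> collisionless X) \<Longrightarrow> continuous_on S pot"
  by (meson continuous_at_imp_continuous_on has_derivative_continuous pot_has_derivative)

lemma open_collisionless: "open {X. collisionless X}"
proof -
  have "{X. collisionless X} = (\<Inter>p\<in>P. {X. X *v e p \<noteq> 0})"
    by (auto simp: collisionless_def)
  moreover have "open {X :: real ^ 'n ^ 'n. X *v e p \<noteq> 0}" for p
  proof -
    have "continuous_on UNIV (\<lambda>X::real^'n^'n. X *v e p)"
      by (rule linear_continuous_on) (rule bounded_bilinear.bounded_linear_left[OF bounded_bilinear_mv])
    from open_Collect_neq[OF this continuous_on_const[of _ 0]] show ?thesis .
  qed
  ultimately show ?thesis using finite_P by auto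
qed

lemma force_scaleR: "c > 0 \<Longrightarrow> force (c *\<^sub>R X) = (1 / c\<^sup>2) *\<^sub>R force X"
  unfolding force_def scaleR_minus_right scaleR_sum_right neg_equal_iff_equal
  by (rule sum.cong) (simp_all add: scaleR_matrix_vector_assoc[symmetric]
      bounded_bilinear.scaleR_left[OF bounded_bilinear_outer] power_mult_distrib power3_eq_cube
      power2_eq_square)

lemma pot_scaleR: "c > 0 \<Longrightarrow> pot (c *\<^sub>R X) = pot X / c"
  by (simp add: pot_def sum_divide_distrib scaleR_matrix_vector_assoc[symmetric] mult_ac)

lemma norm_force_le:
  assumes "\<And>p. p \<in> P \<Longrightarrow> r p \<le> norm (X *v e p)" "\<And>p. p \<in> P \<Longrightarrow> r p > 0"
  shows "norm (force X) \<le> (\<Sum>p\<in>P. w p * norm (e p) / (r p)\<^sup>2)"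
  unfolding force_def norm_minus_cancel
proof (rule sum_norm_le)
  fix p assume p: "p \<in> P"
  let ?n = "norm (X *v e p)"
  have "?n > 0" using assms p by (meson less_le_trans)
  have "norm ((w p / ?n ^ 3) *\<^sub>R outer (X *v e p) (e p)) = w p * norm (e p) / ?n\<^sup>2"
    using \<open>?n > 0\<close> w_pos[OF p] by (simp add: norm_outer power3_eq_cube power2_eq_square)
  also have "\<dots> \<le> w p * norm (e p) / (r p)\<^sup>2"
    using assms(1)[OF p] assms(2)[OF p] w_pos[OF p] \<open>?n > 0\<close>
    by (intro divide_left_mono) (auto intro!: power_mono)
  finally show "norm ((w p / ?n ^ 3) *\<^sub>R outer (X *v e p) (e p)) \<le> w p * norm (e p) / (r p)\<^sup>2" .
qed

lemma continuous_on_force: "(\<And>X. X \<in> S \<Longrightarrow> collisionless X) \<Longrightarrow> continuous_on S force"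
  unfolding force_def[abs_def]
  by (intro continuous_intros bounded_bilinear.continuous_on[OF bounded_bilinear_outer]
      bounded_bilinear.continuous_on[OF bounded_bilinear_mv]) (auto simp: collisionless_def)

lemma pot_reflect [simp]: "pot (reflect u X) = pot X"
  by (simp add: pot_def)

lemma collisionless_reflect [simp]: "collisionless (reflect u X) = collisionless X"
proof -
  have "reflect u X *v z = 0 \<longleftrightarrow> X *v z = 0" for z
    using norm_reflect_mv[of u X z] by (metis norm_eq_zero)
  then show ?thesis by (simp add: collisionless_def)
qed

end

section \<open>The discretized action\<close>

lemma compact_Pi_UNIV:
  fixes K :: "'a \<Rightarrow> 'b::topological_space set"
  assumes "\<And>i. compact (K i)"
  shows "compact {x. \<forall>i. x i \<in> K i}"
proof -
  have "compactin (product_topology (\<lambda>i. euclidean) UNIV) (PiE UNIV K)"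
    using assms by (simp add: compactin_PiE)
  then show ?thesis by (simp add: euclidean_product_topology PiE_UNIV_domain Pi_def)
qed

lemma continuous_on_coord: "continuous_on S (\<lambda>x. x i)" for S :: "('a \<Rightarrow> 'b::topological_space) set"
  by (rule continuous_on_subset[OF continuous_on_product_coordinates]) simp

context pair_potential
begin

text \<open>Kinetic energy plus \<open>pot\<close>, which is minus the potential energy. Only inner
  nodes carry potential: the first node is fixed, and the last is the total collision, where
  \<open>pot\<close> has the meaningless value 0.\<close>

definition action :: "real \<Rightarrow> nat \<Rightarrow> (nat \<Rightarrow> real ^ 'n ^ 'n) \<Rightarrow> real" where
  "action h N x = (\<Sum>k<N. (norm (x (Suc k) - x k))\<^sup>2 / (2 * h)) + h * (\<Sum>k\<in>{1..<N}. pot (x k))"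

text \<open>Collisions are excluded explicitly, because \<open>w p / 0 = 0\<close> makes them cheap
  rather than infinitely expensive. The tail is frozen at 0, which prescribes the total collision at
  step \<open>N\<close>.\<close>

definition paths :: "nat \<Rightarrow> real ^ 'n ^ 'n \<Rightarrow> (nat \<Rightarrow> real ^ 'n ^ 'n) set" where
  "paths N X = {x. x 0 = X \<and> (\<forall>k\<ge>N. x k = 0) \<and> (\<forall>k\<in>{1..<N}. collisionless (x k))}"

lemma link_le_action:
  assumes "h > 0" "k < N"
  shows "(norm (x (Suc k) - x k))\<^sup>2 / (2 * h) \<le> action h N x"
proof -
  have "(norm (x (Suc k) - x k))\<^sup>2 / (2 * h) \<le> (\<Sum>k<N. (norm (x (Suc k) - x k))\<^sup>2 / (2 * h))"
    using assms by (intro member_le_sum) auto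
  moreover have "0 \<le> h * (\<Sum>k\<in>{1..<N}. pot (x k))"
    using assms by (auto intro!: mult_nonneg_nonneg sum_nonneg pot_nonneg)
  ultimately show ?thesis unfolding action_def by linarith
qed

lemma pot_le_action:
  assumes "h > 0" "k \<in> {1..<N}"
  shows "h * pot (x k) \<le> action h N x"
proof -
  have "h * pot (x k) \<le> h * (\<Sum>k\<in>{1..<N}. pot (x k))"
    using assms by (intro mult_left_mono member_le_sum) (auto intro: pot_nonneg)
  moreover have "0 \<le> (\<Sum>k<N. (norm (x (Suc k) - x k))\<^sup>2 / (2 * h))"
    using assms by (intro sum_nonneg) auto
  ultimately show ?thesis unfolding action_def by linarith
qed

text \<open>The set of admissible paths is not closed, but low action keeps a path away from its
  boundary: short links confine the nodes to a ball, and a bounded potential keeps each pair apart.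
  The latter is written without denominators, as a closed condition.\<close>

lemma action_minimizer_exists:
  assumes h: "h > 0" and N: "N > 0" and y: "y \<in> paths N X"
  obtains x where "x \<in> paths N X" "\<And>z. z \<in> paths N X \<Longrightarrow> action h N x \<le> action h N z"
proof -
  define A where "A = action h N y"
  have A0: "A \<ge> 0"
    using link_le_action[OF h N, of y] h unfolding A_def
    by (meson divide_nonneg_nonneg dual_order.trans less_imp_le mult_nonneg_nonneg zero_le_numeral zero_le_power2)
  define s where "s = sqrt (2 * h * A)"
  define R where "R = norm X + real N * s"
  define K where "K k = (if k = 0 then {X} else if N \<le> k then {0} else cball 0 R)" for k
  define Z where "Z = {x. \<forall>k. x k \<in> K k} \<inter>
     (\<Inter>k\<in>{1..<N}. \<Inter>p\<in>P. {x. h * w p \<le> (A + 1) * norm (x k *v e p)})"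
  have "compact {x. \<forall>k. x k \<in> K k}"
    by (rule compact_Pi_UNIV) (simp add: K_def)
  moreover have "closed {x :: nat \<Rightarrow> real ^ 'n ^ 'n. h * w p \<le> (A + 1) * norm (x k *v e p)}" for k p
    by (intro closed_Collect_le continuous_intros continuous_on_coord
        bounded_bilinear.continuous_on[OF bounded_bilinear_mv])
  ultimately have "compact Z"
    unfolding Z_def by (intro compact_Int_closed closed_INT ballI)
  have Zpaths: "x \<in> paths N X" if "x \<in> Z" for x
  proof -
    have "x k *v e p \<noteq> 0" if "k \<in> {1..<N}" "p \<in> P" for k p
    proof
      assume "x k *v e p = 0"
      moreover have "h * w p \<le> (A + 1) * norm (x k *v e p)"
        using \<open>x \<in> Z\<close> that by (auto simp: Z_def)
      ultimately have "h * w p \<le> 0" by simp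
      with h w_pos[OF that(2)] show False by (simp add: mult_le_0_iff)
    qed
    moreover have K: "x k \<in> K k" for k using \<open>x \<in> Z\<close> by (simp add: Z_def)
    have "x 0 = X" using K[of 0] by (simp add: K_def)
    moreover have "x k = 0" if "k \<ge> N" for k using K[of k] N that by (simp add: K_def)
    ultimately show ?thesis unfolding paths_def collisionless_def by blast
  qed
  have inZ: "x \<in> Z" if x: "x \<in> paths N X" and le: "action h N x \<le> A" for x
  proof -
    have link: "norm (x (Suc k) - x k) \<le> s" if "k < N" for k
    proof -
      have "(norm (x (Suc k) - x k))\<^sup>2 / (2 * h) \<le> A"
        using link_le_action[OF h that, of x] le by linarith
      then have "(norm (x (Suc k) - x k))\<^sup>2 \<le> 2 * h * A"
        using h by (simp add: field_simps)
      then show ?thesis unfolding s_def by (rule real_le_rsqrt)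
    qed
    have bound: "norm (x k) \<le> norm X + real k * s" if "k \<le> N" for k
      using that
    proof (induction k)
      case 0
      with x show ?case by (simp add: paths_def)
    next
      case (Suc k)
      have "norm (x (Suc k)) \<le> norm (x k) + norm (x (Suc k) - x k)"
        by (metis add.commute diff_add_cancel norm_triangle_ineq)
      with Suc link[of k] show ?case by (simp add: algebra_simps)
    qed
    have s0: "s \<ge> 0" unfolding s_def using h A0 by simp
    have "norm (x k) \<le> R" if "k \<le> N" for k
    proof -
      have "real k * s \<le> real N * s" using that s0 by (intro mult_right_mono) auto
      with bound[OF that] show ?thesis unfolding R_def by linarith
    qed
    then have "x k \<in> K k" for k
      using x by (auto simp: K_def paths_def)
    moreover have "h * w p \<le> (A + 1) * norm (x k *v e p)" if k: "k \<in> {1..<N}" and p: "p \<in> P" for k p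
    proof -
      have nz: "norm (x k *v e p) > 0" using x k p by (auto simp: paths_def collisionless_def)
      have "h * (w p / norm (x k *v e p)) \<le> h * pot (x k)"
        using h pot_ge[OF p] by (intro mult_left_mono) auto
      also have "\<dots> \<le> A + 1" using pot_le_action[OF h k, of x] le by linarith
      finally show ?thesis using nz by (simp add: field_simps)
    qed
    ultimately show ?thesis by (auto simp: Z_def)
  qed
  have contpot: "continuous_on Z (\<lambda>x. pot (x k))" if "k \<in> {1..<N}" for k
  proof (rule continuous_on_compose2[OF continuous_on_pot[of "(\<lambda>x. x k) ` Z"] continuous_on_coord])
    show "collisionless V" if "V \<in> (\<lambda>x. x k) ` Z" for V
      using that Zpaths \<open>k \<in> {1..<N}\<close> by (auto simp: paths_def)
  qed auto
  have "continuous_on Z (action h N)"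
    unfolding action_def[abs_def]
    using h by (intro continuous_intros contpot continuous_on_coord) auto
  moreover have "y \<in> Z" using inZ[OF y] by (simp add: A_def)
  ultimately obtain x where x: "x \<in> Z" "\<And>z. z \<in> Z \<Longrightarrow> action h N x \<le> action h N z"
    using continuous_attains_inf[OF \<open>compact Z\<close>] by (metis empty_iff)
  show ?thesis
  proof
    show "x \<in> paths N X" using Zpaths x by auto
    fix z assume z: "z \<in> paths N X"
    show "action h N x \<le> action h N z"
    proof (cases "action h N z \<le> A")
      case True
      with inZ[OF z] x show ?thesis by auto
    next
      case False
      have "action h N x \<le> A" using x(2)[OF \<open>y \<in> Z\<close>] by (simp add: A_def)
      with False show ?thesis by linarith
    qed
  qed
qed

definition minimizer :: "real \<Rightarrow> nat \<Rightarrow> real ^ 'n ^ 'n \<Rightarrow> (nat \<Rightarrow> real ^ 'n ^ 'n) \<Rightarrow> bool" where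
  "minimizer h N X x \<longleftrightarrow> x \<in> paths N X \<and> (\<forall>z\<in>paths N X. action h N x \<le> action h N z)"

lemma action_update:
  assumes "k \<in> {1..<N}"
  shows "action h N (x(k := Z)) - action h N x
    = ((norm (x (Suc k) - Z))\<^sup>2 + (norm (Z - x (k - 1)))\<^sup>2) / (2 * h) + h * pot Z
     - (((norm (x (Suc k) - x k))\<^sup>2 + (norm (x k - x (k - 1)))\<^sup>2) / (2 * h) + h * pot (x k))"
proof -
  let ?z = "x(k := Z)"
  define l where "l y j = (norm (y (Suc j) - y j))\<^sup>2 / (2 * h)" for y :: "nat \<Rightarrow> real ^ 'n ^ 'n" and j
  have "(\<Sum>j<N. l ?z j) - (\<Sum>j<N. l x j) = (\<Sum>j<N. l ?z j - l x j)"
    by (simp add: sum_subtractf)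
  also have "\<dots> = (\<Sum>j\<in>{k - 1, k}. l ?z j - l x j)"
    using assms by (intro sum.mono_neutral_right) (auto simp: l_def)
  also have "\<dots> = ((norm (x (Suc k) - Z))\<^sup>2 + (norm (Z - x (k - 1)))\<^sup>2) / (2 * h)
     - ((norm (x (Suc k) - x k))\<^sup>2 + (norm (x k - x (k - 1)))\<^sup>2) / (2 * h)"
    using assms by (auto simp: l_def add_divide_distrib diff_divide_distrib)
  finally have 1: "(\<Sum>j<N. l ?z j) - (\<Sum>j<N. l x j) = \<dots>" .
  have "(\<Sum>j\<in>{1..<N}. pot (?z j)) - (\<Sum>j\<in>{1..<N}. pot (x j)) = (\<Sum>j\<in>{1..<N}. pot (?z j) - pot (x j))"
    by (simp add: sum_subtractf)
  also have "\<dots> = (\<Sum>j\<in>{k}. pot (?z j) - pot (x j))"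
    using assms by (intro sum.mono_neutral_right) auto
  finally have "(\<Sum>j\<in>{1..<N}. pot (?z j)) = (\<Sum>j\<in>{1..<N}. pot (x j)) + (pot Z - pot (x k))"
    by simp
  then have "h * (\<Sum>j\<in>{1..<N}. pot (?z j)) = h * (\<Sum>j\<in>{1..<N}. pot (x j)) + (h * pot Z - h * pot (x k))"
    by (simp add: distrib_left right_diff_distrib)
  with 1 show ?thesis
    unfolding action_def l_def[symmetric] by linarith
qed

lemma minimizer_euler_lagrange:
  assumes h: "h > 0" and x: "minimizer h N X x" and k: "k \<in> {1..<N}"
  shows "x (Suc k) + x (k - 1) - 2 *\<^sub>R x k = h\<^sup>2 *\<^sub>R force (x k)"
proof -
  define f where "f Z = ((norm (x (Suc k) - Z))\<^sup>2 + (norm (Z - x (k - 1)))\<^sup>2) / (2 * h) + h * pot Z" for Z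
  define f' where "f' H = (2 * ((x k - x (Suc k)) \<bullet> H) + 2 * ((x k - x (k - 1)) \<bullet> H)) / (2 * h) + h * (force (x k) \<bullet> H)" for H
  have xk: "collisionless (x k)" using x k by (auto simp: minimizer_def paths_def)
  have d: "(f has_derivative f') (at (x k))"
  proof -
    have "((\<lambda>Z. (norm (x (Suc k) - Z))\<^sup>2 + (norm (Z - x (k - 1)))\<^sup>2) has_derivative
       (\<lambda>H. 2 * ((x k - x (Suc k)) \<bullet> H) + 2 * ((x k - x (k - 1)) \<bullet> H))) (at (x k))"
      unfolding power2_norm_eq_inner
      by (rule derivative_eq_intros refl | rule ext)+
        (simp add: inner_commute inner_diff_left inner_diff_right algebra_simps)
    from has_derivative_add[OF has_derivative_mult_right[OF this, of "1 / (2 * h)"]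
        has_derivative_mult_right[OF pot_has_derivative[OF xk], of h]]
    show ?thesis unfolding f_def[abs_def] f'_def[abs_def] by simp
  qed
  have "f (x k) \<le> f Z" if "Z \<in> {X. collisionless X}" for Z
  proof -
    have "x(k := Z) \<in> paths N X"
      using x k that by (auto simp: minimizer_def paths_def)
    with x have "action h N x \<le> action h N (x(k := Z))" by (simp add: minimizer_def)
    with action_update[OF k, of h x Z] show ?thesis unfolding f_def by linarith
  qed
  then have "f' = (\<lambda>v. 0)"
    using differential_zero_maxmin[OF _ open_collisionless d] xk by blast
  \<comment> \<open>\<open>f' H * h = D \<bullet> H\<close> for every \<open>H\<close>, so testing
    with the defect itself gives \<open>D = 0\<close>.\<close>
  moreover define D where "D = h\<^sup>2 *\<^sub>R force (x k) - (x (Suc k) + x (k - 1) - 2 *\<^sub>R x k)"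
  have "f' D * h = D \<bullet> D"
    using h unfolding f'_def D_def
    by (simp add: field_simps inner_diff_left inner_diff_right inner_add_left inner_add_right power2_eq_square)
  ultimately have "D \<bullet> D = 0" by simp
  then show ?thesis by (simp add: D_def)
qed

end

lemma self_eq_neg_vec: "v = - v \<longleftrightarrow> v = 0" for v :: "'a::real_vector"
proof
  assume "v = - v"
  then have "2 *\<^sub>R v = 0" by (metis add.right_inverse scaleR_2)
  then show "v = 0" by simp
qed simp

text \<open>The discrete counterpart of integrating s^(-2/3): factoring a^3 - b^3 = 1 for
  consecutive cube roots bounds each term by the increment of 3 n^(1/3).\<close>

lemma sum_inverse_two_thirds: "(\<Sum>j=1..n. real j powr (- (2/3))) \<le> 3 * real n powr (1/3)"
proof (induction n)
  case (Suc n)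
  define a b where "a = real (Suc n) powr (1/3)" and "b = real n powr (1/3)"
  have a: "a ^ 3 = real (Suc n)" and a0: "a > 0"
    by (simp_all add: a_def powr_power)
  have b: "b ^ 3 = real n" and b0: "b \<ge> 0"
    by (cases "n = 0"; simp add: b_def powr_power)+
  have ab: "b \<le> a" unfolding a_def b_def by (intro powr_mono2) auto
  have "1 = (a - b) * (a\<^sup>2 + a * b + b\<^sup>2)"
    using a b by (simp add: algebra_simps power2_eq_square power3_eq_cube)
  also have "\<dots> \<le> (a - b) * (3 * a\<^sup>2)"
  proof (rule mult_left_mono)
    have "b * b \<le> a * a" "a * b \<le> a * a" using ab a0 b0 by (auto intro: mult_mono)
    then show "a\<^sup>2 + a * b + b\<^sup>2 \<le> 3 * a\<^sup>2" unfolding power2_eq_square by linarith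
  qed (use ab in simp)
  finally have "1 / a\<^sup>2 \<le> 3 * a - 3 * b"
    using a0 by (simp add: field_simps)
  moreover have "real (Suc n) powr (- (2/3)) = 1 / a\<^sup>2"
    unfolding powr_minus_divide by (simp add: a_def powr_power)
  ultimately show ?case using Suc by (simp add: a_def b_def)
qed simp

section \<open>Reflected tails and the shape of minimizers\<close>

context pair_potential
begin

text \<open>Reflections are isometries, preserve \<open>pot\<close> and fix the end point 0, so only
  the link from \<open>k\<close> to \<open>Suc k\<close> notices the change.\<close>

lemma action_reflect_tail:
  assumes "h > 0" "k < N" "u \<noteq> 0"
  shows "action h N (\<lambda>j. if j \<le> k then x j else reflect u (x j))
    = action h N x + 2 / (h * (u \<bullet> u)) * ((u v* x (Suc k)) \<bullet> (u v* x k))"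
proof -
  define y where "y = (\<lambda>j. if j \<le> k then x j else reflect u (x j))"
  define l where "l y j = (norm (y (Suc j) - y j))\<^sup>2 / (2 * h)" for y :: "nat \<Rightarrow> real ^ 'n ^ 'n" and j
  have "(\<Sum>j<N. l y j) - (\<Sum>j<N. l x j) = (\<Sum>j<N. l y j - l x j)"
    by (simp add: sum_subtractf)
  also have "\<dots> = (\<Sum>j\<in>{k}. l y j - l x j)"
    using assms by (intro sum.mono_neutral_right) (auto simp: l_def y_def reflect_diff)
  also have "\<dots> = 2 / (h * (u \<bullet> u)) * ((u v* x (Suc k)) \<bullet> (u v* x k))"
    using assms by (simp add: l_def y_def norm_reflect_diff field_simps)
  finally have "(\<Sum>j<N. l y j) = (\<Sum>j<N. l x j) + \<dots>" by simp
  moreover have "(\<Sum>j\<in>{1..<N}. pot (y j)) = (\<Sum>j\<in>{1..<N}. pot (x j))"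
    by (rule sum.cong) (auto simp: y_def)
  ultimately show ?thesis
    unfolding action_def l_def[symmetric] y_def[symmetric] by simp
qed

lemma reflect_tail_paths:
  assumes "x \<in> paths N X" "k < N"
  shows "(\<lambda>j. if j \<le> k then x j else reflect u (x j)) \<in> paths N X"
  using assms by (auto simp: paths_def)

text \<open>A negative value would make the path with reflected tail cheaper.\<close>

lemma minimizer_psd:
  assumes "h > 0" "minimizer h N X x" "k < N"
  shows "0 \<le> (u v* x (Suc k)) \<bullet> (u v* x k)"
proof (cases "u = 0")
  case False
  have "action h N x \<le> action h N (\<lambda>j. if j \<le> k then x j else reflect u (x j))"
    using assms reflect_tail_paths[of x N X k u] by (auto simp: minimizer_def)
  with action_reflect_tail[OF assms(1,3) False, of x]
  have "0 \<le> 2 / (h * (u \<bullet> u)) * ((u v* x (Suc k)) \<bullet> (u v* x k))" by simp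
  moreover have "2 / (h * (u \<bullet> u)) > 0" using assms False by simp
  ultimately show ?thesis using assms(1) by (simp add: zero_le_divide_iff mult_less_0_iff)
qed simp

lemma minimizer_step:
  assumes h: "h > 0" and x: "minimizer h N X x" and k: "Suc k < N"
  shows "u v* x (Suc (Suc k)) = 2 *\<^sub>R (u v* x (Suc k)) - u v* x k + h\<^sup>2 *\<^sub>R (u v* force (x (Suc k)))"
proof -
  have "x (Suc (Suc k)) = 2 *\<^sub>R x (Suc k) - x k + h\<^sup>2 *\<^sub>R force (x (Suc k))"
    using minimizer_euler_lagrange[OF h x, of "Suc k"] k by (simp add: algebra_simps)
  then show ?thesis
    by (simp add: vector_matrix_mult_diff_rdistrib vector_matrix_mult_add_rdistrib vector_scaleR_matrix_ac)
qed

lemma minimizer_last: "minimizer h N X x \<Longrightarrow> N \<le> k \<Longrightarrow> x k = 0"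
  and minimizer_first: "minimizer h N X x \<Longrightarrow> x 0 = X"
  by (auto simp: minimizer_def paths_def)

text \<open>The discrete angular momentum is conserved, and it vanishes at the end of the path because
  the last point is \<open>0\<close>.\<close>

lemma minimizer_sym:
  assumes h: "h > 0" and x: "minimizer h N X x" and k: "k < N"
  shows "(u v* x (Suc k)) \<bullet> (v v* x k) = (v v* x (Suc k)) \<bullet> (u v* x k)"
proof -
  obtain j where j: "N = Suc (k + j)" using k less_imp_Suc_add by auto
  show ?thesis using j
  proof (induction j arbitrary: k u v)
    case 0
    then show ?case using minimizer_last[OF x, of "Suc k"] by simp
  next
    case (Suc j)
    note e = minimizer_step[OF h x, of k]
    from Suc.IH[of "Suc k" u v] Suc.prems
    show ?case
      using vm_force_inner_sym[of u "x (Suc k)" v]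
      by (simp add: e inner_diff_left inner_add_left inner_diff_right inner_add_right inner_commute)
  qed
qed

text \<open>If the configuration degenerated for the first time at step \<open>k + 1\<close>, then reflecting the
  rest of the path would give a second minimizer with the same initial part, contradicting the
  Euler-Lagrange equation.\<close>

lemma minimizer_nondegenerate:
  assumes h: "h > 0" and x: "minimizer h N X x" and X: "\<And>u. u v* X = 0 \<Longrightarrow> u = 0"
    and k: "k < N" and u: "u v* x k = 0"
  shows "u = 0"
  using k u
proof (induction k arbitrary: u)
  case 0
  then show ?case using X minimizer_first[OF x] by simp
next
  case (Suc k)
  show ?case
  proof (rule ccontr)
    assume nz: "u \<noteq> 0"
    have f: "u v* force (x (Suc k)) = 0" by (rule vm_force_zero) (rule Suc.prems)
    from minimizer_step[OF h x Suc.prems(1), of u] Suc.prems(2)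
    have 1: "u v* x (Suc (Suc k)) = - (u v* x k)" by (simp add: f)
    define y where "y = (\<lambda>j. if j \<le> Suc k then x j else reflect u (x j))"
    have "action h N y = action h N x"
      using action_reflect_tail[OF h Suc.prems(1) nz, of x] Suc.prems(2) by (simp add: y_def)
    moreover have "y \<in> paths N X"
      unfolding y_def using x Suc.prems(1) by (intro reflect_tail_paths) (auto simp: minimizer_def)
    ultimately have y: "minimizer h N X y" using x by (simp add: minimizer_def)
    from minimizer_step[OF h y Suc.prems(1), of u] Suc.prems(2)
    have "- (u v* x (Suc (Suc k))) = - (u v* x k)"
      by (simp add: y_def f vm_reflect[OF nz])
    with 1 have "u v* x k = - (u v* x k)" by simp
    then have "u v* x k = 0" by (metis self_eq_neg_vec)
    with Suc.IH Suc.prems(1) nz show False by simp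
  qed
qed

lemma minimizer_surj:
  assumes "h > 0" "minimizer h N X x" "\<And>u. u v* X = 0 \<Longrightarrow> u = 0" "k < N"
  obtains u where "u v* x k = y"
  using minimizer_nondegenerate[OF assms] surj_vm_iff[of "x k"] by blast

text \<open>A discrete Riccati comparison: writing \<open>x (k + 1) = x k ** M\<close>, the Euler-Lagrange equation
  gives \<open>M' + M\<^sup>-\<^sup>1 \<le> 2\<close> for consecutive \<open>M, M'\<close>, and \<open>M = 0\<close> at the end.\<close>

lemma minimizer_lower:
  assumes h: "h > 0" and x: "minimizer h N X x" and X: "\<And>u. u v* X = 0 \<Longrightarrow> u = 0" and k: "k < N"
  shows "(real (N - k) - 1) / real (N - k) * (norm (u v* x k))\<^sup>2 \<le> (u v* x (Suc k)) \<bullet> (u v* x k)"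
proof -
  obtain j where "N = Suc (k + j)" using k less_imp_Suc_add by auto
  then show ?thesis
  proof (induction j arbitrary: k u)
    case 0
    then show ?case using minimizer_last[OF x, of "Suc k"] by simp
  next
    case (Suc j)
    have k: "Suc k < N" "k < N" using Suc.prems by auto
    define A where "A u v = (u v* x (Suc k)) \<bullet> (v v* x k)" for u v
    \<comment> \<open>The Euler-Lagrange equation, with the attractive force dropped, converts the
      lower bound for the next link into an upper bound for this one; the constant is 2 - j/(j+1) =
      (j+2)/(j+1).\<close>
    have up: "A z z \<le> (real j + 2) / (real j + 1) * (norm (z v* x (Suc k)))\<^sup>2" for z
    proof -
      have "real j / (real j + 1) * (norm (z v* x (Suc k)))\<^sup>2 \<le> (z v* x (Suc (Suc k))) \<bullet> (z v* x (Suc k))"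
        using Suc.IH[of "Suc k" z] Suc.prems by (simp add: add.commute)
      also have "\<dots> \<le> 2 * (norm (z v* x (Suc k)))\<^sup>2 - A z z"
        using mult_nonneg_nonpos[OF zero_le_power2[of h] vm_force_inner_nonpos[of z "x (Suc k)"]]
        unfolding minimizer_step[OF h x k(1)] A_def power2_norm_eq_inner inner_diff_left
          inner_add_left inner_scaleR_left inner_commute[of "z v* x k"]
        by linarith
      finally show ?thesis by (simp add: field_simps)
    qed
    \<comment> \<open>This choice inverts the link: \<open>A z u\<close> becomes
      \<open>(norm (u v* x k))\<^sup>2\<close>, and Cauchy-Schwarz for the form \<open>A\<close>
      produces the reciprocal constant (j+1)/(j+2).\<close>
    obtain z where z: "z v* x (Suc k) = u v* x k"
      using minimizer_surj[OF h x X k(1)] by blast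
    define n where "n = (norm (u v* x k))\<^sup>2"
    have "(A z u)\<^sup>2 \<le> A z z * A u u"
      unfolding A_def
      by (rule psd_cauchy_schwarz) (use minimizer_sym[OF h x k(2)] minimizer_psd[OF h x k(2)] in auto)
    moreover have "A z u = n" by (simp add: A_def z n_def power2_norm_eq_inner)
    moreover have "A z z * A u u \<le> (real j + 2) / (real j + 1) * n * A u u"
      using up[of z] minimizer_psd[OF h x k(2), of u]
      by (intro mult_right_mono) (auto simp: z n_def A_def)
    ultimately have 1: "n * n \<le> n * ((real j + 2) / (real j + 1) * A u u)"
      by (simp add: power2_eq_square mult_ac)
    have "n \<le> (real j + 2) / (real j + 1) * A u u"
    proof (cases "n = 0")
      case True
      then show ?thesis using minimizer_psd[OF h x k(2), of u] by (simp add: A_def)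
    next
      case False
      then have "n > 0" by (simp add: n_def)
      with 1 show ?thesis by (rule mult_left_le_imp_le)
    qed
    then have "(real j + 1) / (real j + 2) * n \<le> A u u" by (simp add: field_simps)
    moreover have "N - k = j + 2" using Suc.prems by simp
    ultimately show ?case unfolding A_def n_def by (simp add: add.commute)
  qed
qed

text \<open>By Cauchy-Schwarz each step shrinks \<open>norm (u v* x k)\<close> by at most the factor
  (N-k-1)/(N-k) of \<open>minimizer_lower\<close>, and the product of these factors telescopes. The
  extreme case is uniform motion into 0.\<close>

lemma minimizer_contraction:
  assumes h: "h > 0" and x: "minimizer h N X x" and X: "\<And>u. u v* X = 0 \<Longrightarrow> u = 0" and k: "k \<le> N"
  shows "real (N - k) / real N * norm (u v* X) \<le> norm (u v* x k)"
  using k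
proof (induction k)
  case 0
  then show ?case using minimizer_first[OF x] by (cases "N = 0") auto
next
  case (Suc k)
  let ?c = "(real (N - k) - 1) / real (N - k)"
  have j: "real (N - k) > 0" using Suc.prems by simp
  have e: "real (N - Suc k) = real (N - k) - 1" using Suc.prems by (simp add: of_nat_diff)
  have "?c * norm (u v* x k) * norm (u v* x k) \<le> norm (u v* x (Suc k)) * norm (u v* x k)"
    using minimizer_lower[OF h x X, of k u] norm_cauchy_schwarz[of "u v* x (Suc k)" "u v* x k"] Suc.prems
    by (simp add: power2_eq_square mult.assoc)
  then have 1: "?c * norm (u v* x k) \<le> norm (u v* x (Suc k))"
    using mult_right_le_imp_le[of "?c * norm (u v* x k)" "norm (u v* x k)" "norm (u v* x (Suc k))"]
    by (cases "norm (u v* x k) = 0") auto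
  have "real (N - Suc k) / real N * norm (u v* X) = ?c * (real (N - k) / real N * norm (u v* X))"
    using j unfolding e by (simp add: field_simps)
  also have "\<dots> \<le> ?c * norm (u v* x k)"
    using Suc e j by (intro mult_left_mono divide_nonneg_nonneg) auto
  finally show ?case using 1 by (rule order_trans)
qed

section \<open>Bounds for the minimal action and their consequences\<close>

lemma nondegenerate_mv:
  fixes X :: "real ^ 'n ^ 'n"
  assumes "\<And>u. u v* X = 0 \<Longrightarrow> u = 0" "X *v z = 0"
  shows "z = 0"
proof -
  obtain u where "u v* X = z" using assms(1) surj_vm_iff[of X] by blast
  then have "z \<bullet> z = u \<bullet> (X *v z)" by (metis dot_lmul_matrix)
  with assms(2) show ?thesis by simp
qed

lemma nondegenerate_collisionless: "(\<And>u. u v* X = 0 \<Longrightarrow> u = 0) \<Longrightarrow> collisionless X"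
  unfolding collisionless_def using nondegenerate_mv e_nz by blast

lemma collisionless_scaleR: "c \<noteq> 0 \<Longrightarrow> collisionless (c *\<^sub>R X) = collisionless X"
  by (simp add: collisionless_def scaleR_matrix_vector_assoc[symmetric])

text \<open>The competitor shrinks \<open>X\<close> homothetically along the parabolic profile \<open>(1 - t/T)\<^sup>2\<^sup>/\<^sup>3\<close>.\<close>

lemma low_action_path:
  assumes h: "h > 0" and X: "collisionless X" and N: "N > 0"
  obtains y where "y \<in> paths N X"
    "action h N y \<le> 3 * (norm X)\<^sup>2 / (2 * (h * real N)) + 3 * (h * real N) * pot X"
proof -
  define b where "b j = real j powr (2/3)" for j
  define c where "c k = b (N - k) / b N" for k
  define y where "y k = c k *\<^sub>R X" for k
  \<comment> \<open>The exponent 2/3 reduces both parts of the action to this sum: the squared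
    increments of \<open>b\<close> and the reciprocals of \<open>b\<close> are both of order
    j^(-2/3).\<close>
  define D where "D n = (\<Sum>j=1..n. real j powr (- (2/3)))" for n
  have bN: "b N > 0" using N by (simp add: b_def)
  have cpos: "c k > 0" if "k < N" for k using that bN by (simp add: c_def b_def)
  have step: "0 \<le> b j - b (j - 1)" "b j - b (j - 1) \<le> real j powr (- (1/3))" if "j > 0" for j
  proof -
    show "0 \<le> b j - b (j - 1)" unfolding b_def using that by (simp add: powr_mono2)
    \<comment> \<open>As \<open>b j = real j * real j powr (- (1/3))\<close>, this is the asserted
      bound on the increment; it holds because the second factor decreases in
      \<open>j\<close>.\<close>
    have "(real j - 1) * real j powr (- (1/3)) \<le> b (j - 1)"
    proof (cases "j = 1")
      case False
      with that have j: "real j > 1" by simp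
      have "(real j - 1) * real j powr (- (1/3)) \<le> (real j - 1) * (real j - 1) powr (- (1/3))"
        using j by (intro mult_left_mono powr_mono2') auto
      also have "\<dots> = (real j - 1) powr (2/3)"
        using j powr_mult_base[of "real j - 1" "- (1/3)"] by simp
      finally show ?thesis using that by (simp add: b_def of_nat_diff)
    qed (simp add: b_def)
    moreover have "b j = real j * real j powr (- (1/3))"
      using that powr_mult_base[of "real j" "- (1/3)"] by (simp add: b_def)
    ultimately show "b j - b (j - 1) \<le> real j powr (- (1/3))" by (simp add: algebra_simps)
  qed
  have D: "D n \<le> 3 * real n powr (1/3)" for n unfolding D_def by (rule sum_inverse_two_thirds)
  have reindex: "(\<Sum>k<N. real (N - k) powr (- (2/3))) = D N"
    "(\<Sum>k\<in>{1..<N}. real (N - k) powr (- (2/3))) = (\<Sum>j\<in>{1..<N}. real j powr (- (2/3)))"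
    unfolding D_def
    by (rule sum.reindex_bij_witness[of _ "\<lambda>j. N - j" "\<lambda>k. N - k"]; auto)+
  have link: "(norm (y (Suc k) - y k))\<^sup>2 / (2 * h)
      \<le> (norm X)\<^sup>2 / (2 * h * (b N)\<^sup>2) * real (N - k) powr (- (2/3))" if "k < N" for k
  proof -
    define j where "j = N - k"
    have j: "j > 0" "N - Suc k = j - 1" using that by (auto simp: j_def)
    have "(b j - b (j - 1))\<^sup>2 \<le> (real j powr (- (1/3)))\<^sup>2"
      using step[OF j(1)] by (intro power_mono)
    also have "\<dots> = real j powr (- (2/3))" using j by (simp add: powr_power)
    finally have 1: "(b j - b (j - 1))\<^sup>2 \<le> real j powr (- (2/3))" .
    have "norm (y (Suc k) - y k) = (b j - b (j - 1)) / b N * norm X"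
      using bN step[OF j(1)]
      by (simp add: y_def c_def j(2) j_def[symmetric] scaleR_left_diff_distrib[symmetric]
          diff_divide_distrib[symmetric])
    then have "(norm (y (Suc k) - y k))\<^sup>2 / (2 * h) = (norm X)\<^sup>2 / (2 * h * (b N)\<^sup>2) * (b j - b (j - 1))\<^sup>2"
      by (simp add: power_mult_distrib power_divide mult_ac)
    also have "\<dots> \<le> (norm X)\<^sup>2 / (2 * h * (b N)\<^sup>2) * real j powr (- (2/3))"
      using 1 h by (intro mult_left_mono) auto
    finally show ?thesis by (simp add: j_def)
  qed
  have NN: "real N powr (1/3) / (b N)\<^sup>2 = 1 / real N" "b N * real N powr (1/3) = real N"
  proof -
    define t where "t = real N powr (1/3)"
    have "t > 0" "real N = t ^ 3" "b N = t\<^sup>2"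
      using N by (simp_all add: t_def b_def powr_power)
    then show "real N powr (1/3) / (b N)\<^sup>2 = 1 / real N" "b N * real N powr (1/3) = real N"
      unfolding t_def[symmetric] by (simp_all add: power2_eq_square power3_eq_cube)
  qed
  have "(\<Sum>k<N. (norm (y (Suc k) - y k))\<^sup>2 / (2 * h))
     \<le> (\<Sum>k<N. (norm X)\<^sup>2 / (2 * h * (b N)\<^sup>2) * real (N - k) powr (- (2/3)))"
    by (rule sum_mono) (use link in simp)
  also have "\<dots> = (norm X)\<^sup>2 / (2 * h * (b N)\<^sup>2) * D N"
    unfolding sum_distrib_left[symmetric] reindex(1) ..
  also have "\<dots> \<le> (norm X)\<^sup>2 / (2 * h * (b N)\<^sup>2) * (3 * real N powr (1/3))"
    using h D by (intro mult_left_mono) auto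
  also have "\<dots> = 3 * (norm X)\<^sup>2 / (2 * h) * (real N powr (1/3) / (b N)\<^sup>2)" by simp
  also have "\<dots> = 3 * (norm X)\<^sup>2 / (2 * (h * real N))" unfolding NN by simp
  finally have kin: "(\<Sum>k<N. (norm (y (Suc k) - y k))\<^sup>2 / (2 * h)) \<le> \<dots>" .
  have "(\<Sum>k\<in>{1..<N}. pot (y k)) = (\<Sum>k\<in>{1..<N}. pot X * b N * real (N - k) powr (- (2/3)))"
  proof (rule sum.cong)
    fix k assume "k \<in> {1..<N}"
    then have "c k > 0" using cpos by auto
    then show "pot (y k) = pot X * b N * real (N - k) powr (- (2/3))"
      by (simp add: y_def pot_scaleR) (simp add: c_def b_def powr_minus_divide)
  qed simp
  also have "\<dots> = pot X * b N * (\<Sum>j\<in>{1..<N}. real j powr (- (2/3)))"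
    unfolding sum_distrib_left[symmetric] reindex(2) ..
  also have "\<dots> \<le> pot X * b N * D N"
    unfolding D_def using bN by (intro mult_left_mono sum_mono2) (auto simp: pot_nonneg)
  also have "\<dots> \<le> pot X * b N * (3 * real N powr (1/3))"
    using D bN by (intro mult_left_mono) (auto simp: pot_nonneg)
  also have "\<dots> = 3 * (b N * real N powr (1/3)) * pot X" by simp
  finally have "(\<Sum>k\<in>{1..<N}. pot (y k)) \<le> 3 * real N * pot X" unfolding NN by simp
  then have "h * (\<Sum>k\<in>{1..<N}. pot (y k)) \<le> 3 * (h * real N) * pot X"
    using mult_left_mono[of _ "3 * real N * pot X" h] h by (simp add: mult_ac)
  with kin have "action h N y \<le> 3 * (norm X)\<^sup>2 / (2 * (h * real N)) + 3 * (h * real N) * pot X"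
    unfolding action_def by linarith
  moreover have "y \<in> paths N X"
    unfolding paths_def
  proof safe
    show "y 0 = X" using bN by (simp add: y_def c_def)
    show "y k = 0" if "N \<le> k" for k using that by (simp add: y_def c_def b_def)
    show "collisionless (y k)" if "k \<in> {1..<N}" for k
      using cpos[of k] that X by (simp add: y_def collisionless_scaleR)
  qed
  ultimately show ?thesis using that by blast
qed

lemma minimizer_exists:
  assumes h: "h > 0" and X: "collisionless X" and N: "N > 0"
  obtains x where "minimizer h N X x"
    "action h N x \<le> 3 * (norm X)\<^sup>2 / (2 * (h * real N)) + 3 * (h * real N) * pot X"
proof -
  obtain y where y: "y \<in> paths N X"
    "action h N y \<le> 3 * (norm X)\<^sup>2 / (2 * (h * real N)) + 3 * (h * real N) * pot X"
    using low_action_path[OF assms] by blast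
  obtain x where x: "x \<in> paths N X" "\<And>z. z \<in> paths N X \<Longrightarrow> action h N x \<le> action h N z"
    using action_minimizer_exists[OF h N y(1)] by blast
  show ?thesis
  proof (rule that)
    show "minimizer h N X x" using x by (simp add: minimizer_def)
    show "action h N x \<le> 3 * (norm X)\<^sup>2 / (2 * (h * real N)) + 3 * (h * real N) * pot X"
      using x(2)[OF y(1)] y(2) by (rule order_trans)
  qed
qed

lemma sum_links_le_action:
  assumes "h > 0" "I \<subseteq> {..<N}"
  shows "(\<Sum>k\<in>I. (norm (x (Suc k) - x k))\<^sup>2) \<le> 2 * h * action h N x"
proof -
  have "(\<Sum>k\<in>I. (norm (x (Suc k) - x k))\<^sup>2) \<le> (\<Sum>k<N. (norm (x (Suc k) - x k))\<^sup>2)"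
    using assms by (intro sum_mono2) auto
  also have "\<dots> = 2 * h * (\<Sum>k<N. (norm (x (Suc k) - x k))\<^sup>2 / (2 * h))"
    using assms by (simp add: sum_distrib_left)
  also have "\<dots> \<le> 2 * h * action h N x"
  proof (rule mult_left_mono)
    have "0 \<le> h * (\<Sum>k\<in>{1..<N}. pot (x k))"
      using assms(1) by (intro mult_nonneg_nonneg sum_nonneg pot_nonneg) simp
    then show "(\<Sum>k<N. (norm (x (Suc k) - x k))\<^sup>2 / (2 * h)) \<le> action h N x"
      unfolding action_def by linarith
  qed (use assms in simp)
  finally show ?thesis .
qed

text \<open>The path ends at 0, so \<open>x k\<close> is minus the sum of the remaining links, and
  Cauchy-Schwarz applies. In the limit this bound yields the collision at time T.\<close>

lemma minimizer_norm_le: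
  assumes h: "h > 0" and x: "minimizer h N X x" and k: "k \<le> N"
  shows "(norm (x k))\<^sup>2 \<le> 2 * action h N x * (h * real (N - k))"
proof -
  have "norm (x k) \<le> (\<Sum>i\<in>{k..<N}. norm (x (Suc i) - x i))"
  proof -
    have "(\<Sum>i\<in>{k..<N}. x (Suc i) - x i) = - x k"
      using sum_Suc_diff'[OF k, of x] minimizer_last[OF x, of N] by simp
    then show ?thesis using norm_sum[of "\<lambda>i. x (Suc i) - x i" "{k..<N}"] by simp
  qed
  then have "(norm (x k))\<^sup>2 \<le> (\<Sum>i\<in>{k..<N}. norm (x (Suc i) - x i))\<^sup>2"
    by (intro power_mono) auto
  also have "\<dots> \<le> (\<Sum>i\<in>{k..<N}. (norm (x (Suc i) - x i))\<^sup>2) * real (N - k)"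
    using sum_squared_le_sum_of_squares[of "\<lambda>i. norm (x (Suc i) - x i)" "{k..<N}"] by simp
  also have "\<dots> \<le> 2 * h * action h N x * real (N - k)"
    by (intro mult_right_mono sum_links_le_action h) auto
  finally show ?thesis by (simp add: mult_ac)
qed

end

section \<open>Passage to the limit\<close>

text \<open>By Tychonoff's theorem; the filter \<open>U\<close> spares the selection of diagonal subsequences.\<close>

lemma pointwise_cluster_point:
  fixes g :: "nat \<Rightarrow> 'a \<Rightarrow> 'b::topological_space"
  assumes g: "\<And>n t. g n t \<in> K t" and K: "\<And>t. compact (K t)"
  obtains U f where "U \<noteq> bot" "U \<le> sequentially" "\<And>t. ((\<lambda>n. g n t) \<longlongrightarrow> f t) U"
proof -
  have "compact {x. \<forall>i. x i \<in> K i}" by (rule compact_Pi_UNIV) (rule K)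
  moreover have "filtermap g sequentially \<noteq> bot" by (simp add: filtermap_bot_iff)
  moreover have "eventually (\<lambda>x. x \<in> {x. \<forall>i. x i \<in> K i}) (filtermap g sequentially)"
    using g by (simp add: eventually_filtermap)
  ultimately obtain f where f: "inf (nhds f) (filtermap g sequentially) \<noteq> bot"
    unfolding compact_filter by blast
  define U where "U = inf sequentially (filtercomap g (nhds f))"
  have "U \<noteq> bot"
  proof
    assume "U = bot"
    then obtain P Q where P: "eventually P sequentially" and Q: "eventually Q (filtercomap g (nhds f))"
      and no: "\<And>n. P n \<Longrightarrow> Q n \<Longrightarrow> False"
      unfolding U_def trivial_limit_def eventually_inf by blast
    from Q obtain R where R: "eventually R (nhds f)" "\<And>n. R (g n) \<Longrightarrow> Q n"
      unfolding eventually_filtercomap by blast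
    have "eventually (\<lambda>y. \<not> R y) (filtermap g sequentially)"
      unfolding eventually_filtermap using P by (rule eventually_mono) (use no R in blast)
    with R(1) have "inf (nhds f) (filtermap g sequentially) = bot"
      unfolding trivial_limit_def eventually_inf by blast
    with f show False by simp
  qed
  moreover have "U \<le> sequentially" unfolding U_def by (rule inf_le1)
  moreover have "((\<lambda>n. g n t) \<longlongrightarrow> f t) U" for t
  proof -
    have "filterlim g (nhds f) U"
      unfolding U_def by (rule filterlim_mono[OF filterlim_filtercomap order_refl inf_le2])
    from continuous_on_tendsto_compose[OF continuous_on_product_coordinates this, of t]
    show ?thesis by simp
  qed
  ultimately show ?thesis by (rule that)
qed

section \<open>Estimates along minimizers that are uniform in the step\<close>

lemma telescope_bound:
  fixes a :: "nat \<Rightarrow> 'a::real_normed_vector"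
  assumes "k \<le> l" "\<And>i. k \<le> i \<Longrightarrow> i < l \<Longrightarrow> norm (a (Suc i) - a i - h *\<^sub>R g) \<le> h * \<epsilon>"
  shows "norm (a l - a k - (h * real (l - k)) *\<^sub>R g) \<le> h * real (l - k) * \<epsilon>"
proof -
  have "a l - a k - (h * real (l - k)) *\<^sub>R g = (\<Sum>i\<in>{k..<l}. a (Suc i) - a i - h *\<^sub>R g)"
    using sum_Suc_diff'[OF assms(1), of a] by (simp add: sum_subtractf scaleR_conv_of_real sum_constant_scaleR mult.commute)
  also have "norm \<dots> \<le> (\<Sum>i\<in>{k..<l}. h * \<epsilon>)" by (rule sum_norm_le) (use assms in auto)
  finally show ?thesis by (simp add: mult_ac)
qed

lemma telescope_norm:
  fixes a :: "nat \<Rightarrow> 'a::real_normed_vector"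
  assumes "k \<le> l" "\<And>i. k \<le> i \<Longrightarrow> i < l \<Longrightarrow> norm (a (Suc i) - a i) \<le> h * \<epsilon>"
  shows "norm (a l - a k) \<le> h * real (l - k) * \<epsilon>"
  using telescope_bound[of k l a h 0 \<epsilon>] assms by simp

text \<open>Intervals having \<open>t\<close> as either end point cover both one-sided derivatives
  at once. The time \<open>t1\<close> leaves room to the right of \<open>t\<close> while keeping
  away from \<open>T\<close>, where the bounds degenerate.\<close>

lemma has_vector_derivative_right_openI:
  fixes f :: "real \<Rightarrow> 'a::real_normed_vector"
  assumes t: "0 \<le> t" "t < t1" "t1 < T"
    and *: "\<And>\<epsilon>. \<epsilon> > 0 \<Longrightarrow> \<exists>\<delta>>0. \<forall>a b. 0 \<le> a \<and> a \<le> b \<and> b \<le> t1 \<and> b - a < \<delta> \<and> t \<in> {a, b} \<longrightarrow>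
      norm (f b - f a - (b - a) *\<^sub>R f') \<le> (b - a) * \<epsilon>"
  shows "(f has_vector_derivative f') (at t within {0..<T})"
  unfolding has_vector_derivative_def has_derivative_within_alt
proof safe
  show "bounded_linear (\<lambda>x. x *\<^sub>R f')" by (rule bounded_linear_scaleR_left)
  fix \<epsilon> :: real assume "\<epsilon> > 0"
  from *[OF this] obtain \<delta> where \<delta>: "\<delta> > 0" and D: "\<And>a b. 0 \<le> a \<Longrightarrow> a \<le> b \<Longrightarrow> b \<le> t1 \<Longrightarrow> b - a < \<delta> \<Longrightarrow> t \<in> {a, b} \<Longrightarrow>
      norm (f b - f a - (b - a) *\<^sub>R f') \<le> (b - a) * \<epsilon>" by blast
  show "\<exists>d>0. \<forall>y\<in>{0..<T}. norm (y - t) < d \<longrightarrow> norm (f y - f t - (y - t) *\<^sub>R f') \<le> \<epsilon> * norm (y - t)"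
  proof (intro exI[of _ "min \<delta> (t1 - t)"] conjI ballI impI)
    show "0 < min \<delta> (t1 - t)" using \<delta> t by simp
    fix y assume y: "y \<in> {0..<T}" "norm (y - t) < min \<delta> (t1 - t)"
    show "norm (f y - f t - (y - t) *\<^sub>R f') \<le> \<epsilon> * norm (y - t)"
    proof (cases "y \<le> t")
      case True
      have "norm (f t - f y - (t - y) *\<^sub>R f') \<le> (t - y) * \<epsilon>"
        by (rule D) (use y t True in auto)
      moreover have "f t - f y - (t - y) *\<^sub>R f' = - (f y - f t - (y - t) *\<^sub>R f')"
        by (simp add: algebra_simps)
      ultimately show ?thesis using True by (simp only: norm_minus_cancel) (simp add: mult.commute)
    next
      case False
      have "norm (f y - f t - (y - t) *\<^sub>R f') \<le> (y - t) * \<epsilon>"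
        by (rule D) (use y t False in auto)
      then show ?thesis using False by (simp add: mult.commute)
    qed
  qed
qed

context pair_potential
begin

text \<open>The first two bounds depend on \<open>X\<close> only through \<open>s\<close>, and not
  on the step: the contraction estimate bounds the rows from below, \<open>norm_mv_ge\<close>
  carries this over to the distances, and these bound the force.\<close>

lemma minimizer_force_bound:
  assumes h: "h > 0" and x: "minimizer h N X x" and T: "h * real N = T"
    and s: "s > 0" "\<And>u. s * norm u \<le> norm (u v* X)" and k: "h * real k \<le> t" and t: "t < T"
  shows "p \<in> P \<Longrightarrow> (1 - t / T) * s * norm (e p) \<le> norm (x k *v e p)"
    and "norm (force (x k)) \<le> (\<Sum>p\<in>P. w p * norm (e p) / ((1 - t / T) * s * norm (e p))\<^sup>2)"
    and "(1 - h * real k / T) * norm (u v* X) \<le> norm (u v* x k)"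
proof -
  have X: "u = 0" if "u v* X = 0" for u
    using s(2)[of u] s(1) that by (simp add: mult_le_0_iff)
  have "h * real k < h * real N" using k t T by linarith
  then have kN: "k < N" using h by simp
  then have Tpos: "T > 0" using h unfolding T[symmetric] by simp
  have eq: "real (N - k) / real N = 1 - h * real k / T"
    using kN h unfolding T[symmetric] by (simp add: of_nat_diff field_simps)
  show 1: "(1 - h * real k / T) * norm (u v* X) \<le> norm (u v* x k)" for u
    using minimizer_contraction[OF h x X, of k u] kN unfolding eq[symmetric] by simp
  have c: "1 - t / T > 0" "1 - t / T \<le> 1 - h * real k / T"
    using t k Tpos by (auto simp: divide_right_mono)
  have 2: "(1 - t / T) * s * norm u \<le> norm (u v* x k)" for u
  proof -
    have "(1 - t / T) * (s * norm u) \<le> (1 - h * real k / T) * norm (u v* X)"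
      using c s(1) by (intro mult_mono s(2)) auto
    with 1[of u] show ?thesis by (simp add: mult.assoc)
  qed
  show 3: "(1 - t / T) * s * norm (e p) \<le> norm (x k *v e p)" if "p \<in> P" for p
    using norm_mv_ge[OF _ 2] c s(1) by simp
  show "norm (force (x k)) \<le> (\<Sum>p\<in>P. w p * norm (e p) / ((1 - t / T) * s * norm (e p))\<^sup>2)"
    using c s(1) e_nz 3 by (intro norm_force_le) auto
qed

definition velocity :: "real \<Rightarrow> (nat \<Rightarrow> real ^ 'n ^ 'n) \<Rightarrow> nat \<Rightarrow> real ^ 'n ^ 'n" where
  "velocity h x k = (1 / h) *\<^sub>R (x (Suc k) - x k)"

lemma velocity_step:
  assumes h: "h > 0" and x: "minimizer h N X x" and k: "Suc k < N"
  shows "velocity h x (Suc k) - velocity h x k = h *\<^sub>R force (x (Suc k))"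
proof -
  have "velocity h x (Suc k) - velocity h x k = (1 / h) *\<^sub>R (x (Suc (Suc k)) + x k - 2 *\<^sub>R x (Suc k))"
    by (simp add: velocity_def algebra_simps scaleR_2)
  also have "\<dots> = (1 / h) *\<^sub>R (h\<^sup>2 *\<^sub>R force (x (Suc k)))"
    using minimizer_euler_lagrange[OF h x, of "Suc k"] k by simp
  finally show ?thesis using h by (simp add: power2_eq_square)
qed

lemma step_velocity: "h > 0 \<Longrightarrow> x (Suc k) - x k = h *\<^sub>R velocity h x k"
  by (simp add: velocity_def)

text \<open>The kinetic part of the action bounds the mean square velocity up to time
  \<open>t\<close>, so some velocity is at most \<open>sqrt (2 * A / t)\<close>; all others up to
  \<open>t\<close> differ from it by at most the accumulated force.\<close>

lemma minimizer_velocity_bound: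
  assumes h: "h > 0" and x: "minimizer h N X x" and T: "h * real N = T" "0 < t" "t < T"
    and A: "action h N x \<le> A" and F: "\<And>k. h * real k \<le> t \<Longrightarrow> norm (force (x k)) \<le> C"
    and k: "h * real k \<le> t"
  shows "norm (velocity h x k) \<le> sqrt (2 * A / t) + T * C"
proof -
  let ?v = "velocity h x"
  define K where "K = nat \<lfloor>t / h\<rfloor>"
  have "real K \<le> t / h" "t / h < real K + 1"
    using h T unfolding K_def by (auto simp: of_nat_floor)
  then have K: "h * real K \<le> t" "t < h * (real K + 1)" using h by (auto simp: field_simps)
  have C0: "C \<ge> 0" using F[OF k] norm_ge_zero by (rule order_trans[rotated])
  have lt: "j < N" if "h * real j \<le> t" for j
  proof -
    have "h * real j < h * real N" using that T by simp
    then show ?thesis using h by simp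
  qed
  have "\<exists>i\<le>K. (norm (?v i))\<^sup>2 \<le> 2 * A / t"
  proof (rule ccontr)
    assume "\<not> ?thesis"
    then have gt: "2 * A / t < (norm (?v i))\<^sup>2" if "i \<le> K" for i using that by force
    have "0 \<le> 2 * h * action h N x"
      using sum_links_le_action[OF h, of "{}" N x] by simp
    then have A0: "A \<ge> 0" using A h by (simp add: zero_le_mult_iff)
    have "2 * h * A * 1 \<le> 2 * h * A * (h * (real K + 1) / t)"
      using h A0 K(2) T(2) by (intro mult_left_mono) (auto simp: field_simps)
    also have "\<dots> = (\<Sum>i\<in>{..K}. h\<^sup>2 * (2 * A / t))"
      by (simp add: power2_eq_square)
    also have "\<dots> < (\<Sum>i\<in>{..K}. h\<^sup>2 * (norm (?v i))\<^sup>2)"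
      using gt h by (intro sum_strict_mono mult_strict_left_mono) auto
    also have "\<dots> = (\<Sum>i\<in>{..K}. (norm (x (Suc i) - x i))\<^sup>2)"
      using h by (simp add: step_velocity power_mult_distrib)
    also have "\<dots> \<le> 2 * h * action h N x"
      using lt[OF K(1)] by (intro sum_links_le_action h) auto
    also have "\<dots> \<le> 2 * h * A" using A h by (intro mult_left_mono) auto
    finally show False by simp
  qed
  then obtain i where i: "i \<le> K" "(norm (?v i))\<^sup>2 \<le> 2 * A / t" by blast
  have vi: "norm (?v i) \<le> sqrt (2 * A / t)" using i(2) by (rule real_le_rsqrt)
  have "h * real k < h * (real K + 1)" using k K(2) by linarith
  then have kK: "k \<le> K" using h by simp
  have tel: "norm (?v b - ?v a) \<le> T * C" if "a \<le> b" "b \<le> K" for a b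
  proof -
    have "norm (?v b - ?v a) \<le> h * real (b - a) * C"
    proof (rule telescope_norm[OF that(1)])
      fix j assume j: "a \<le> j" "j < b"
      have "h * real (Suc j) \<le> h * real K"
        using j that h by (intro mult_left_mono) auto
      then have "h * real (Suc j) \<le> t" using K by linarith
      from F[OF this] show "norm (?v (Suc j) - ?v j) \<le> h * C"
        unfolding velocity_step[OF h x lt[OF \<open>h * real (Suc j) \<le> t\<close>]] using h by simp
    qed
    also have "h * real (b - a) \<le> h * real K" using that h by (intro mult_left_mono) auto
    then have "h * real (b - a) * C \<le> T * C"
      using K(1) T C0 by (intro mult_right_mono) auto
    finally show ?thesis .
  qed
  have "norm (?v k - ?v i) \<le> T * C"
    using tel[of i k] tel[of k i] i kK by (cases "i \<le> k") (auto simp: norm_minus_commute)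
  then show ?thesis using vi norm_triangle_sub[of "?v k" "?v i"] by linarith
qed

text \<open>These are the two-point estimates that pass to the limit: the first becomes the
  derivative of the position, the third that of the velocity, and the second controls how far the
  force in the third can vary. The index \<open>r\<close> will be that of the time at which one
  differentiates.\<close>

lemma minimizer_increments:
  assumes h: "h > 0" and x: "minimizer h N X x" and T: "h * real N = T" "t < T"
    and C: "\<And>k. h * real k \<le> t \<Longrightarrow> norm (force (x k)) \<le> C"
    and V: "\<And>k. h * real k \<le> t \<Longrightarrow> norm (velocity h x k) \<le> V"
    and kl: "k \<le> l" "h * real l \<le> t"
  shows "\<And>r. r \<in> {k..l} \<Longrightarrow> norm (x l - x k - (h * real (l - k)) *\<^sub>R velocity h x r) \<le> h * real (l - k) * (h * real (l - k) * C)"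
    and "\<And>i r. i \<in> {k..l} \<Longrightarrow> r \<in> {k..l} \<Longrightarrow> norm (x i - x r) \<le> h * real (l - k) * V"
    and "\<And>r \<omega>. (\<And>i. i \<in> {k..l} \<Longrightarrow> norm (force (x i) - force (x r)) \<le> \<omega>) \<Longrightarrow>
      norm (velocity h x l - velocity h x k - (h * real (l - k)) *\<^sub>R force (x r)) \<le> h * real (l - k) * \<omega>"
proof -
  let ?v = "velocity h x"
  have le: "h * real j \<le> t" if "j \<le> l" for j
  proof -
    have "h * real j \<le> h * real l" using that h by (intro mult_left_mono) auto
    then show ?thesis using kl by linarith
  qed
  have lt: "j < N" if "j \<le> l" for j
  proof -
    have "h * real j < h * real N" using le[OF that] T by simp
    then show ?thesis using h by simp
  qed
  have C0: "C \<ge> 0" using C[OF kl(2)] norm_ge_zero by (rule order_trans[rotated])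
  have V0: "V \<ge> 0" using V[OF kl(2)] norm_ge_zero by (rule order_trans[rotated])
  have mono: "h * real (b - a) * c \<le> h * real (l - k) * c" if "k \<le> a" "b \<le> l" "c \<ge> 0" for a b c
    using that h by (intro mult_right_mono mult_left_mono) auto
  have vdiff: "norm (?v i - ?v r) \<le> h * real (l - k) * C" if "i \<in> {k..l}" "r \<in> {k..l}" for i r
  proof -
    have "norm (?v b - ?v a) \<le> h * real (b - a) * C" if "a \<le> b" "b \<le> l" for a b
      using that C[OF le] h lt by (intro telescope_norm) (auto simp: velocity_step[OF h x])
    from this[of i r] this[of r i] mono[of i r C] mono[of r i C] that C0
    show ?thesis by (cases "i \<le> r") (force simp: norm_minus_commute)+
  qed
  show "norm (x i - x r) \<le> h * real (l - k) * V" if "i \<in> {k..l}" "r \<in> {k..l}" for i r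
  proof -
    have "norm (x b - x a) \<le> h * real (b - a) * V" if "a \<le> b" "b \<le> l" for a b
      using that V[OF le] h by (intro telescope_norm) (auto simp: step_velocity[OF h])
    from this[of i r] this[of r i] mono[of i r V] mono[of r i V] that V0
    show ?thesis by (cases "i \<le> r") (force simp: norm_minus_commute)+
  qed
  show "norm (x l - x k - (h * real (l - k)) *\<^sub>R ?v r) \<le> h * real (l - k) * (h * real (l - k) * C)"
    if "r \<in> {k..l}" for r
  proof (rule telescope_bound[OF kl(1)])
    fix i assume i: "k \<le> i" "i < l"
    have "x (Suc i) - x i - h *\<^sub>R ?v r = h *\<^sub>R (?v i - ?v r)"
      by (simp add: step_velocity[OF h] scaleR_diff_right)
    then show "norm (x (Suc i) - x i - h *\<^sub>R ?v r) \<le> h * (h * real (l - k) * C)"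
      using vdiff[of i r] i that h by simp
  qed
  show "norm (?v l - ?v k - (h * real (l - k)) *\<^sub>R force (x r)) \<le> h * real (l - k) * \<omega>"
    if "\<And>i. i \<in> {k..l} \<Longrightarrow> norm (force (x i) - force (x r)) \<le> \<omega>" for r \<omega>
  proof (rule telescope_bound[OF kl(1)])
    fix i assume i: "k \<le> i" "i < l"
    have "?v (Suc i) - ?v i - h *\<^sub>R force (x r) = h *\<^sub>R (force (x (Suc i)) - force (x r))"
      using i lt[of "Suc i"] by (simp add: velocity_step[OF h x] scaleR_diff_right)
    then show "norm (?v (Suc i) - ?v i - h *\<^sub>R force (x r)) \<le> h * \<omega>"
      using that[of "Suc i"] i h by simp
  qed
qed

end

section \<open>The limiting collision path\<close>

lemma vm_bounded_below:
  fixes X :: "real ^ 'n ^ 'n"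
  assumes "\<And>u. u v* X = 0 \<Longrightarrow> u = 0"
  obtains s where "s > 0" "\<And>u. s * norm u \<le> norm (u v* X)"
proof -
  have lin: "linear (\<lambda>u. u v* X)"
    by (intro bounded_linear.linear bounded_bilinear.bounded_linear_left[OF bounded_bilinear_vm])
  moreover have "inj (\<lambda>u. u v* X)" using linear_injective_0[OF lin] assms by blast
  ultimately show ?thesis using linear_inj_bounded_below_pos that by blast
qed

lemma tendsto_vm [tendsto_intros]:
  "(f \<longlongrightarrow> l) F \<Longrightarrow> ((\<lambda>n. u v* f n) \<longlongrightarrow> u v* l) F" for f :: "'a \<Rightarrow> real ^ 'n ^ 'm"
  by (rule bounded_bilinear.tendsto[OF bounded_bilinear_vm tendsto_const])

context pair_potential
begin

lemma isCont_force: "collisionless X \<Longrightarrow> isCont force X"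
  using continuous_on_force[of "{X. collisionless X}"] open_collisionless
  by (simp add: continuous_on_eq_continuous_at)

lemma compact_away_from_collisions:
  "compact {Y :: real ^ 'n ^ 'n. norm Y \<le> R \<and> (\<forall>p\<in>P. r p \<le> norm (Y *v e p))}"
proof -
  have "{Y :: real ^ 'n ^ 'n. norm Y \<le> R \<and> (\<forall>p\<in>P. r p \<le> norm (Y *v e p))} =
     cball 0 R \<inter> (\<Inter>p\<in>P. {Y. r p \<le> norm (Y *v e p)})" by auto
  moreover have "closed {Y :: real ^ 'n ^ 'n. r p \<le> norm (Y *v e p)}" for p
    by (intro closed_Collect_le continuous_intros bounded_bilinear.continuous_on[OF bounded_bilinear_mv])
  ultimately show ?thesis
    by (simp only:) (intro compact_Int_closed compact_cball closed_INT ballI)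
qed

theorem collision_path_exists:
  assumes T: "T > 0" and X: "\<And>u. u v* X = 0 \<Longrightarrow> u = 0"
  obtains \<xi> \<nu> R where "\<xi> 0 = X"
    "\<And>t. t \<in> {0..<T} \<Longrightarrow> (\<xi> has_vector_derivative \<nu> t) (at t within {0..<T})"
    "\<And>t. t \<in> {0..<T} \<Longrightarrow> (\<nu> has_vector_derivative force (\<xi> t)) (at t within {0..<T})"
    "\<And>t. t \<in> {0..<T} \<Longrightarrow> (norm (\<xi> t))\<^sup>2 \<le> R * (T - t)"
    "\<And>t u. t \<in> {0..<T} \<Longrightarrow> u v* \<xi> t = 0 \<Longrightarrow> u = 0"
    "\<And>t u v. t \<in> {0..<T} \<Longrightarrow> (u v* \<nu> t) \<bullet> (v v* \<xi> t) = (v v* \<nu> t) \<bullet> (u v* \<xi> t)"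
    "\<And>t u. t \<in> {0..<T} \<Longrightarrow> - (1 / (T - t)) * (norm (u v* \<xi> t))\<^sup>2 \<le> (u v* \<nu> t) \<bullet> (u v* \<xi> t)"
proof -
  obtain s where s: "s > 0" "\<And>u. s * norm u \<le> norm (u v* X)"
    using vm_bounded_below X by blast
  define h where "h n = T / real (Suc n)" for n
  have h: "h n > 0" "h n * real (Suc n) = T" for n using T by (simp_all add: h_def)
  define A where "A = 3 * (norm X)\<^sup>2 / (2 * T) + 3 * T * pot X"
  have A0: "A \<ge> 0" using T pot_nonneg[of X] by (simp add: A_def)
  have "\<exists>x. minimizer (h n) (Suc n) X x \<and> action (h n) (Suc n) x \<le> A" for n
    using minimizer_exists[OF h(1)[of n] nondegenerate_collisionless[OF X], where N = "Suc n"] h(2)[of n]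
    unfolding A_def by (metis zero_less_Suc)
  then obtain x where x: "\<And>n. minimizer (h n) (Suc n) X (x n)" "\<And>n. action (h n) (Suc n) (x n) \<le> A"
    by metis
  define \<kappa> where "\<kappa> n t = nat \<lfloor>t / h n\<rfloor>" for n t
  have \<kappa>: "h n * real (\<kappa> n t) \<le> t" "t < h n * real (\<kappa> n t) + h n" if "t \<ge> 0" for n t
  proof -
    have "real (\<kappa> n t) \<le> t / h n" "t / h n < real (\<kappa> n t) + 1"
      using h(1)[of n] that unfolding \<kappa>_def by (auto simp: of_nat_floor)
    then show "h n * real (\<kappa> n t) \<le> t" "t < h n * real (\<kappa> n t) + h n"
      using h(1)[of n] by (auto simp: field_simps)
  qed
  have \<kappa>_mono: "\<kappa> n a \<le> \<kappa> n b" if "a \<le> b" for n a b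
    using that h(1)[of n] unfolding \<kappa>_def by (intro nat_mono floor_mono divide_right_mono) auto
  define v where "v n k = velocity (h n) (x n) k" for n k
  define \<rho> where "\<rho> t p = (1 - t / T) * s * norm (e p)" for t p
  define C where "C t = (\<Sum>p\<in>P. w p * norm (e p) / (\<rho> t p)\<^sup>2)" for t
  define V where "V t = sqrt (2 * A / t) + T * C t" for t
  have away: "\<rho> t p \<le> norm (x n k *v e p)" if "h n * real k \<le> t" "t < T" "p \<in> P" for n k t p
    unfolding \<rho>_def by (rule minimizer_force_bound(1)[OF h(1) x(1) h(2) s]) (use that in auto)
  have F: "norm (force (x n k)) \<le> C t" if "h n * real k \<le> t" "t < T" for n k t
    unfolding C_def \<rho>_def by (rule minimizer_force_bound(2)[OF h(1) x(1) h(2) s]) (use that in auto)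
  have V: "norm (v n k) \<le> V t" if "h n * real k \<le> t" "0 < t" "t < T" for n k t
    unfolding V_def v_def
    by (rule minimizer_velocity_bound[OF h(1) x(1) h(2) _ _ x(2)]) (use that F in auto)
  have lt: "k < Suc n" if "h n * real k < T" for n k
  proof -
    have "h n * real k < h n * real (Suc n)" using that h(2)[of n] by linarith
    then show ?thesis using h(1)[of n] by (simp only: mult_less_cancel_left_pos of_nat_less_iff)
  qed
  have N: "(norm (x n k))\<^sup>2 \<le> 2 * A * (T - h n * real k)" if "h n * real k < T" for n k
  proof -
    have "(norm (x n k))\<^sup>2 \<le> 2 * action (h n) (Suc n) (x n) * (h n * real (Suc n - k))"
      by (rule minimizer_norm_le[OF h(1) x(1)]) (use lt[OF that] in simp)
    also have "\<dots> \<le> 2 * A * (h n * real (Suc n - k))"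
      using x(2)[of n] h(1)[of n] by (intro mult_right_mono mult_left_mono) auto
    also have "h n * real (Suc n - k) = T - h n * real k"
      using h(2)[of n] lt[OF that] by (simp add: of_nat_diff algebra_simps)
    finally show ?thesis .
  qed
  \<comment> \<open>The velocity bound is taken at \<open>(t + T) / 2\<close> because
    \<open>V\<close> bounds velocities only for positive arguments, while \<open>t\<close> may be
    0.\<close>
  define B where "B t = (if t \<in> {0..<T} then sqrt (2 * A * T) + V ((t + T) / 2) else 0)" for t
  \<comment> \<open>Positions and velocities are paired so that one filter makes both
    converge.\<close>
  define g where "g n t = (if t \<in> {0..<T} then (x n (\<kappa> n t), v n (\<kappa> n t)) else 0)" for n t
  have "g n t \<in> cball 0 (B t)" for n t
  proof (cases "t \<in> {0..<T}")
    case True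
    have k: "h n * real (\<kappa> n t) \<le> t" using \<kappa> True by simp
    have "(norm (x n (\<kappa> n t)))\<^sup>2 \<le> 2 * A * (T - h n * real (\<kappa> n t))"
      by (rule N) (use k True in simp)
    also have "\<dots> \<le> 2 * A * T" using A0 h(1)[of n] by (intro mult_left_mono) auto
    finally have "norm (x n (\<kappa> n t)) \<le> sqrt (2 * A * T)" by (rule real_le_rsqrt)
    moreover have "norm (v n (\<kappa> n t)) \<le> V ((t + T) / 2)"
      by (rule V) (use k True in auto)
    ultimately show ?thesis
      using norm_Pair_le[of "x n (\<kappa> n t)" "v n (\<kappa> n t)"] True by (simp add: g_def B_def)
  qed (auto simp: g_def B_def)
  then obtain U f where U: "U \<noteq> bot" "U \<le> sequentially" and f: "\<And>t. ((\<lambda>n. g n t) \<longlongrightarrow> f t) U"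
    using pointwise_cluster_point[of g "\<lambda>t. cball 0 (B t)"] by (metis compact_cball)
  define \<xi> \<nu> where "\<xi> t = fst (f t)" and "\<nu> t = snd (f t)" for t
  have \<xi>: "((\<lambda>n. x n (\<kappa> n t)) \<longlongrightarrow> \<xi> t) U" and \<nu>: "((\<lambda>n. v n (\<kappa> n t)) \<longlongrightarrow> \<nu> t) U"
    if "t \<in> {0..<T}" for t
    using tendsto_fst[OF f[of t]] tendsto_snd[OF f[of t]] that
    by (simp_all add: g_def \<xi>_def \<nu>_def)
  have "h \<longlonglongrightarrow> 0" 
    using tendsto_mult[OF tendsto_const LIMSEQ_inverse_real_of_nat, of T]
    by (simp add: h_def[abs_def] divide_inverse)
  then have h0: "(h \<longlongrightarrow> 0) U" using U(2) by (rule tendsto_mono[rotated])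
  have time: "((\<lambda>n. h n * real (\<kappa> n t)) \<longlongrightarrow> t) U" if "t \<ge> 0" for t
  proof (rule tendsto_sandwich[of "\<lambda>n. t - h n" _ _ "\<lambda>n. t"])
    show "((\<lambda>n. t - h n) \<longlongrightarrow> t) U" using tendsto_diff[OF tendsto_const h0, of t] by simp
  qed (use \<kappa>[OF that] in \<open>auto intro!: always_eventually simp: less_imp_le field_simps\<close>)
  have dtime: "((\<lambda>n. h n * real (\<kappa> n b - \<kappa> n a)) \<longlongrightarrow> b - a) U" if "0 \<le> a" "a \<le> b" for a b
  proof -
    have "h n * real (\<kappa> n b - \<kappa> n a) = h n * real (\<kappa> n b) - h n * real (\<kappa> n a)" for n
      using \<kappa>_mono[OF that(2)] by (simp add: of_nat_diff algebra_simps)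
    then show ?thesis using tendsto_diff[OF time time] that by simp
  qed
  have ltT: "h n * real (\<kappa> n t) < T" if "t \<in> {0..<T}" for n t
    using \<kappa>(1)[of t n] that by simp
  have lower: "(1 - t / T) * norm (u v* X) \<le> norm (u v* \<xi> t)" if "t \<in> {0..<T}" for t u
  proof (rule tendsto_le[OF U(1)])
    show "((\<lambda>n. norm (u v* x n (\<kappa> n t))) \<longlongrightarrow> norm (u v* \<xi> t)) U"
      by (intro tendsto_intros \<xi> that)
    show "((\<lambda>n. (1 - h n * real (\<kappa> n t) / T) * norm (u v* X)) \<longlongrightarrow> (1 - t / T) * norm (u v* X)) U"
      using that T by (intro tendsto_intros time) auto
    show "\<forall>\<^sub>F n in U. (1 - h n * real (\<kappa> n t) / T) * norm (u v* X) \<le> norm (u v* x n (\<kappa> n t))"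
      by (intro always_eventually allI minimizer_force_bound(3)[OF h(1) x(1) h(2) s])
        (use ltT[OF that] in auto)
  qed
  have nondeg: "u = 0" if "t \<in> {0..<T}" "u v* \<xi> t = 0" for t u
  proof -
    have "(1 - t / T) * norm (u v* X) \<le> 0" using lower[OF that(1), of u] that(2) by simp
    moreover have "1 - t / T > 0" using that T by simp
    ultimately have "u v* X = 0" by (simp add: mult_le_0_iff)
    with X show ?thesis by simp
  qed
  have \<kappa>_le: "h n * real (\<kappa> n b) \<le> t1" if "0 \<le> b" "b \<le> t1" for b t1 n
    using \<kappa>(1)[OF that(1), of n] that by linarith
  have d\<xi>: "(\<xi> has_vector_derivative \<nu> t) (at t within {0..<T})" if t: "t \<in> {0..<T}" for t
  proof (rule has_vector_derivative_right_openI[of t "(t + T) / 2"])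
    define t1 where "t1 = (t + T) / 2"
    have t1: "0 < t1" "t1 < T" using t by (auto simp: t1_def)
    have C0: "C t1 \<ge> 0" unfolding C_def by (intro sum_nonneg divide_nonneg_nonneg mult_nonneg_nonneg w_nonneg) auto
    fix \<epsilon> :: real assume \<epsilon>: "\<epsilon> > 0"
    have "norm (\<xi> b - \<xi> a - (b - a) *\<^sub>R \<nu> t) \<le> (b - a) * \<epsilon>"
      if ab: "0 \<le> a" "a \<le> b" "b \<le> t1" "b - a < \<epsilon> / (C t1 + 1)" "t \<in> {a, b}" for a b
    proof -
      have abT: "a \<in> {0..<T}" "b \<in> {0..<T}" using ab t1 by auto
      have "norm (\<xi> b - \<xi> a - (b - a) *\<^sub>R \<nu> t) \<le> (b - a) * ((b - a) * C t1)"
      proof (rule tendsto_le[OF U(1)])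
        show "((\<lambda>n. norm (x n (\<kappa> n b) - x n (\<kappa> n a) - (h n * real (\<kappa> n b - \<kappa> n a)) *\<^sub>R v n (\<kappa> n t)))
          \<longlongrightarrow> norm (\<xi> b - \<xi> a - (b - a) *\<^sub>R \<nu> t)) U"
          by (intro tendsto_intros \<xi> \<nu> dtime abT ab t)
        show "((\<lambda>n. h n * real (\<kappa> n b - \<kappa> n a) * (h n * real (\<kappa> n b - \<kappa> n a) * C t1))
          \<longlongrightarrow> (b - a) * ((b - a) * C t1)) U"
          by (intro tendsto_intros dtime ab)
        show "\<forall>\<^sub>F n in U. norm (x n (\<kappa> n b) - x n (\<kappa> n a) - (h n * real (\<kappa> n b - \<kappa> n a)) *\<^sub>R v n (\<kappa> n t))
          \<le> h n * real (\<kappa> n b - \<kappa> n a) * (h n * real (\<kappa> n b - \<kappa> n a) * C t1)"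
          unfolding v_def
          by (intro always_eventually allI minimizer_increments(1)[OF h(1) x(1) h(2) t1(2), where V = "V t1"])
            (use F t1 V[OF _ t1] \<kappa>_mono \<kappa>_le ab in \<open>auto simp: v_def\<close>)
      qed
      also have "\<dots> \<le> (b - a) * \<epsilon>"
      proof (rule mult_left_mono)
        have "(b - a) * C t1 \<le> (b - a) * (C t1 + 1)" using ab by (intro mult_left_mono) auto
        also have "\<dots> < \<epsilon>" using ab(4) C0 by (simp add: pos_less_divide_eq)
        finally show "(b - a) * C t1 \<le> \<epsilon>" by simp
      qed (use ab in simp)
      finally show ?thesis .
    qed
    then show "\<exists>\<delta>>0. \<forall>a b. 0 \<le> a \<and> a \<le> b \<and> b \<le> (t + T) / 2 \<and> b - a < \<delta> \<and> t \<in> {a, b} \<longrightarrow>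
      norm (\<xi> b - \<xi> a - (b - a) *\<^sub>R \<nu> t) \<le> (b - a) * \<epsilon>"
      using \<epsilon> C0 unfolding t1_def[symmetric] by (intro exI[of _ "\<epsilon> / (C t1 + 1)"]) auto
  qed (use t in auto)
  have d\<nu>: "(\<nu> has_vector_derivative force (\<xi> t)) (at t within {0..<T})" if t: "t \<in> {0..<T}" for t
  proof (rule has_vector_derivative_right_openI[of t "(t + T) / 2"])
    define t1 where "t1 = (t + T) / 2"
    have t1: "0 < t1" "t1 < T" using t by (auto simp: t1_def)
    have \<rho>pos: "\<rho> t1 p > 0" if "p \<in> P" for p using s t1 T e_nz[OF that] by (simp add: \<rho>_def)
    \<comment> \<open>This compact set contains all grid positions up to \<open>t1\<close> for every
      \<open>n\<close>, so the force has one modulus of continuity along all approximations.\<close>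
    define K where "K = {Y :: real ^ 'n ^ 'n. norm Y \<le> sqrt (2 * A * T) \<and> (\<forall>p\<in>P. \<rho> t1 p \<le> norm (Y *v e p))}"
    have "compact K" unfolding K_def by (rule compact_away_from_collisions)
    moreover have "continuous_on K force"
      using \<rho>pos by (intro continuous_on_force) (fastforce simp: K_def collisionless_def)
    ultimately have uc: "uniformly_continuous_on K force"
      by (rule compact_uniformly_continuous[rotated])
    have inK: "x n k \<in> K" if "h n * real k \<le> t1" for n k
    proof -
      have "(norm (x n k))\<^sup>2 \<le> 2 * A * (T - h n * real k)" by (rule N) (use that t1 in simp)
      also have "\<dots> \<le> 2 * A * T" using A0 h(1)[of n] by (intro mult_left_mono) auto
      finally have "norm (x n k) \<le> sqrt (2 * A * T)" by (rule real_le_rsqrt)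
      with away[OF that t1(2)] show ?thesis by (simp add: K_def)
    qed
    have "norm (v 0 0) \<le> V t1" by (rule V) (use t1 in auto)
    then have V0: "V t1 \<ge> 0" by (rule order_trans[OF norm_ge_zero])
    fix \<epsilon> :: real assume \<epsilon>: "\<epsilon> > 0"
    then obtain d where d: "d > 0" "\<And>Y Z. Y \<in> K \<Longrightarrow> Z \<in> K \<Longrightarrow> norm (Y - Z) < d \<Longrightarrow> norm (force Y - force Z) < \<epsilon>"
      using uc unfolding uniformly_continuous_on_def dist_norm by metis
    have "norm (\<nu> b - \<nu> a - (b - a) *\<^sub>R force (\<xi> t)) \<le> (b - a) * \<epsilon>"
      if ab: "0 \<le> a" "a \<le> b" "b \<le> t1" "b - a < d / (V t1 + 1)" "t \<in> {a, b}" for a b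
    proof -
      have abT: "a \<in> {0..<T}" "b \<in> {0..<T}" using ab t1 by auto
      have "(b - a) * V t1 \<le> (b - a) * (V t1 + 1)" using ab by (intro mult_left_mono) auto
      also have "\<dots> < d" using ab(4) V0 by (simp add: pos_less_divide_eq)
      finally have small: "(b - a) * V t1 < d" .
      have ev: "\<forall>\<^sub>F n in U. h n * real (\<kappa> n b - \<kappa> n a) * V t1 < d"
        by (rule order_tendstoD(2)[OF _ small]) (intro tendsto_intros dtime ab)
      show ?thesis
      proof (rule tendsto_le[OF U(1)])
        have "collisionless (\<xi> t)" using nondeg[OF t] by (rule nondegenerate_collisionless)
        from isCont_tendsto_compose[OF isCont_force[OF this] \<xi>[OF t]]
        show "((\<lambda>n. norm (v n (\<kappa> n b) - v n (\<kappa> n a) - (h n * real (\<kappa> n b - \<kappa> n a)) *\<^sub>R force (x n (\<kappa> n t))))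
          \<longlongrightarrow> norm (\<nu> b - \<nu> a - (b - a) *\<^sub>R force (\<xi> t))) U"
          by (intro tendsto_intros \<nu> dtime abT ab)
        show "((\<lambda>n. h n * real (\<kappa> n b - \<kappa> n a) * \<epsilon>) \<longlongrightarrow> (b - a) * \<epsilon>) U"
          by (intro tendsto_intros dtime ab)
        show "\<forall>\<^sub>F n in U. norm (v n (\<kappa> n b) - v n (\<kappa> n a) - (h n * real (\<kappa> n b - \<kappa> n a)) *\<^sub>R force (x n (\<kappa> n t)))
          \<le> h n * real (\<kappa> n b - \<kappa> n a) * \<epsilon>"
          using ev
        proof (rule eventually_mono)
          fix n assume n: "h n * real (\<kappa> n b - \<kappa> n a) * V t1 < d"
          let ?k = "\<kappa> n a" and ?l = "\<kappa> n b" and ?r = "\<kappa> n t"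
          have kl: "?k \<le> ?l" "h n * real ?l \<le> t1" using \<kappa>_mono \<kappa>_le ab by auto
          have le: "h n * real i \<le> t1" if "i \<le> ?l" for i
          proof -
            have "h n * real i \<le> h n * real ?l" using that h(1)[of n] by (intro mult_left_mono) auto
            then show ?thesis using kl by linarith
          qed
          have r: "?r \<in> {?k..?l}" using ab(5) kl(1) by auto
          have b: "norm (x n i - x n ?r) \<le> h n * real (?l - ?k) * V t1" if "i \<in> {?k..?l}" for i
            by (rule minimizer_increments(2)[OF h(1) x(1) h(2) t1(2), where C = "C t1"])
              (use F t1 V[OF _ t1] kl r that in \<open>auto simp: v_def\<close>)
          show "norm (v n ?l - v n ?k - (h n * real (?l - ?k)) *\<^sub>R force (x n ?r)) \<le> h n * real (?l - ?k) * \<epsilon>"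
            unfolding v_def
          proof (rule minimizer_increments(3)[OF h(1) x(1) h(2) t1(2), where C = "C t1" and V = "V t1"])
            fix i assume i: "i \<in> {?k..?l}"
            have "norm (force (x n i) - force (x n ?r)) < \<epsilon>"
              by (rule d(2)) (use inK le i r b[OF i] n in auto)
            then show "norm (force (x n i) - force (x n ?r)) \<le> \<epsilon>" by simp
          qed (use F t1 V[OF _ t1] kl in \<open>auto simp: v_def\<close>)
        qed
      qed
    qed
    then show "\<exists>\<delta>>0. \<forall>a b. 0 \<le> a \<and> a \<le> b \<and> b \<le> (t + T) / 2 \<and> b - a < \<delta> \<and> t \<in> {a, b} \<longrightarrow>
      norm (\<nu> b - \<nu> a - (b - a) *\<^sub>R force (\<xi> t)) \<le> (b - a) * \<epsilon>"
      using d(1) V0 unfolding t1_def[symmetric] by (intro exI[of _ "d / (V t1 + 1)"]) auto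
  qed (use t in auto)
  have vx: "(u v* v n k) \<bullet> (z v* x n k) = (1 / h n) * ((u v* x n (Suc k)) \<bullet> (z v* x n k) - (u v* x n k) \<bullet> (z v* x n k))" for n k u z
    by (simp add: v_def velocity_def vector_scaleR_matrix_ac vector_matrix_mult_diff_rdistrib inner_diff_left)
  show ?thesis
  proof (rule that)
    show "\<xi> 0 = X"
    proof (rule tendsto_unique[OF U(1)])
      show "((\<lambda>n. x n (\<kappa> n 0)) \<longlongrightarrow> \<xi> 0) U" using T by (intro \<xi>) simp
      show "((\<lambda>n. x n (\<kappa> n 0)) \<longlongrightarrow> X) U" using minimizer_first[OF x(1)] by (simp add: \<kappa>_def)
    qed
    show "(norm (\<xi> t))\<^sup>2 \<le> 2 * A * (T - t)" if "t \<in> {0..<T}" for t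
    proof (rule tendsto_le[OF U(1)])
      show "((\<lambda>n. (norm (x n (\<kappa> n t)))\<^sup>2) \<longlongrightarrow> (norm (\<xi> t))\<^sup>2) U" by (intro tendsto_intros \<xi> that)
      show "((\<lambda>n. 2 * A * (T - h n * real (\<kappa> n t))) \<longlongrightarrow> 2 * A * (T - t)) U"
        using that by (intro tendsto_intros time) auto
      show "\<forall>\<^sub>F n in U. (norm (x n (\<kappa> n t)))\<^sup>2 \<le> 2 * A * (T - h n * real (\<kappa> n t))"
        using N ltT[OF that] by (intro always_eventually allI) auto
    qed
    show "(u v* \<nu> t) \<bullet> (z v* \<xi> t) = (z v* \<nu> t) \<bullet> (u v* \<xi> t)" if t: "t \<in> {0..<T}" for t u z
    proof (rule tendsto_unique[OF U(1)])
      show "((\<lambda>n. (u v* v n (\<kappa> n t)) \<bullet> (z v* x n (\<kappa> n t))) \<longlongrightarrow> (u v* \<nu> t) \<bullet> (z v* \<xi> t)) U"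
        by (intro tendsto_intros \<xi> \<nu> t)
      have "((\<lambda>n. (z v* v n (\<kappa> n t)) \<bullet> (u v* x n (\<kappa> n t))) \<longlongrightarrow> (z v* \<nu> t) \<bullet> (u v* \<xi> t)) U"
        by (intro tendsto_intros \<xi> \<nu> t)
      moreover have "(u v* v n (\<kappa> n t)) \<bullet> (z v* x n (\<kappa> n t)) = (z v* v n (\<kappa> n t)) \<bullet> (u v* x n (\<kappa> n t))" for n
        unfolding vx using minimizer_sym[OF h(1) x(1) lt[OF ltT[OF t]]] by (simp add: inner_commute)
      ultimately show "((\<lambda>n. (u v* v n (\<kappa> n t)) \<bullet> (z v* x n (\<kappa> n t))) \<longlongrightarrow> (z v* \<nu> t) \<bullet> (u v* \<xi> t)) U"
        by simp
    qed
    show "- (1 / (T - t)) * (norm (u v* \<xi> t))\<^sup>2 \<le> (u v* \<nu> t) \<bullet> (u v* \<xi> t)" if t: "t \<in> {0..<T}" for t u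
    proof (rule tendsto_le[OF U(1)])
      show "((\<lambda>n. (u v* v n (\<kappa> n t)) \<bullet> (u v* x n (\<kappa> n t))) \<longlongrightarrow> (u v* \<nu> t) \<bullet> (u v* \<xi> t)) U"
        by (intro tendsto_intros \<xi> \<nu> t)
      show "((\<lambda>n. - (1 / (T - h n * real (\<kappa> n t))) * (norm (u v* x n (\<kappa> n t)))\<^sup>2)
        \<longlongrightarrow> - (1 / (T - t)) * (norm (u v* \<xi> t))\<^sup>2) U"
        using t by (intro tendsto_intros \<xi> time) auto
      show "\<forall>\<^sub>F n in U. - (1 / (T - h n * real (\<kappa> n t))) * (norm (u v* x n (\<kappa> n t)))\<^sup>2
        \<le> (u v* v n (\<kappa> n t)) \<bullet> (u v* x n (\<kappa> n t))"
      proof (intro always_eventually allI)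
        fix n
        let ?k = "\<kappa> n t"
        have k: "?k < Suc n" using lt[OF ltT[OF t]] .
        define j where "j = real (Suc n - ?k)"
        have j: "j > 0" using k by (simp add: j_def)
        have hj: "T - h n * real ?k = h n * j"
          using h(2)[of n] k by (simp add: j_def of_nat_diff algebra_simps)
        define q where "q = (norm (u v* x n ?k))\<^sup>2"
        have "(j - 1) / j * q \<le> (u v* x n (Suc ?k)) \<bullet> (u v* x n ?k)"
          unfolding q_def j_def by (rule minimizer_lower[OF h(1) x(1) X k])
        then have "- (1 / j) * q \<le> (u v* x n (Suc ?k)) \<bullet> (u v* x n ?k) - q"
          using j by (simp add: field_simps)
        then have "(1 / h n) * (- (1 / j) * q) \<le> (1 / h n) * ((u v* x n (Suc ?k)) \<bullet> (u v* x n ?k) - q)"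
          using h(1)[of n] by (intro mult_left_mono) auto
        then show "- (1 / (T - h n * real ?k)) * (norm (u v* x n ?k))\<^sup>2 \<le> (u v* v n ?k) \<bullet> (u v* x n ?k)"
          unfolding vx hj q_def[symmetric] using h(1)[of n] j
          by (simp add: power2_norm_eq_inner[symmetric] q_def)
      qed
    qed
  qed (use d\<xi> d\<nu> nondeg in auto)
qed

end

section \<open>Real analysis on a half-line\<close>

text \<open>After the last time at which \<open>f\<close> is at most \<open>k\<close>, the mean
  value theorem forbids any rise.\<close>

lemma barrier:
  fixes f :: "real \<Rightarrow> real"
  assumes d: "\<And>t. t \<ge> a \<Longrightarrow> (f has_real_derivative f' t) (at t)"
    and k: "\<And>t. t \<ge> a \<Longrightarrow> f t > k \<Longrightarrow> f' t \<le> 0" and a: "f a \<le> k" and t: "t \<ge> a"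
  shows "f t \<le> k"
proof (rule ccontr)
  assume nt: "\<not> f t \<le> k"
  have cont: "continuous_on {a..t} f"
    by (meson atLeastAtMost_iff d DERIV_isCont continuous_at_imp_continuous_on)
  define S where "S = {x \<in> {a..t}. f x \<le> k}"
  have "closed S"
    unfolding S_def using continuous_on_closed_Collect_le[OF cont continuous_on_const] by simp
  moreover have S: "S \<noteq> {}" "bdd_above S" using a t by (auto simp: S_def)
  ultimately have c: "Sup S \<in> S" by (metis closed_contains_Sup)
  define c where "c = Sup S"
  have cS: "a \<le> c" "c < t" "f c \<le> k" using c nt by (auto simp: S_def c_def order_le_less)
  obtain z where z: "c < z" "z < t" "f t - f c = (t - c) * f' z"
    using MVT2[of c t f f'] cS d by auto
  have "z \<notin> S" using z(1) S(2) cSup_upper[of z S] by (auto simp: c_def)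
  then have "f z > k" using z cS by (auto simp: S_def)
  then have "f' z \<le> 0" using k z cS by auto
  then have "(t - c) * f' z \<le> 0" using cS by (intro mult_nonneg_nonpos) auto
  with z(3) cS(3) nt show False by linarith
qed

lemma deriv_nonneg_mono:
  fixes f :: "real \<Rightarrow> real"
  assumes d: "\<And>t. t \<ge> a \<Longrightarrow> (f has_real_derivative f' t) (at t)"
    and k: "\<And>t. t \<ge> a \<Longrightarrow> 0 \<le> f' t" and "a \<le> s" "s \<le> t"
  shows "f s \<le> f t"
proof (rule DERIV_nonneg_imp_nondecreasing[OF assms(4)])
  fix x assume "s \<le> x" "x \<le> t"
  then have "a \<le> x" using assms(3) by simp
  then show "\<exists>y. (f has_real_derivative y) (at x) \<and> 0 \<le> y" using d k by blast
qed

lemma convergent_mono_at_top: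
  fixes f :: "real \<Rightarrow> real"
  assumes mono: "\<And>s t. a \<le> s \<Longrightarrow> s \<le> t \<Longrightarrow> f s \<le> f t" and b: "\<And>t. a \<le> t \<Longrightarrow> f t \<le> B"
  obtains l where "(f \<longlongrightarrow> l) at_top"
proof
  have bdd: "bdd_above (f ` {a..})" using b by (auto intro!: bdd_aboveI2)
  show "(f \<longlongrightarrow> Sup (f ` {a..})) at_top"
  proof (rule increasing_tendsto)
    show "\<forall>\<^sub>F t in at_top. f t \<le> Sup (f ` {a..})"
      using eventually_ge_at_top[of a] by (rule eventually_mono) (auto intro: cSup_upper bdd)
    fix x assume "x < Sup (f ` {a..})"
    then obtain s where s: "a \<le> s" "x < f s" using less_cSup_iff[OF _ bdd] by auto
    show "\<forall>\<^sub>F t in at_top. x < f t"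
      using eventually_ge_at_top[of s] by (rule eventually_mono) (use mono s in force)
  qed
qed

text \<open>Over a window of fixed length the increment of \<open>f\<close> tends to 0, while
  uniform continuity keeps \<open>f'\<close> nearly constant there; so \<open>f'\<close> itself must
  be small.\<close>

lemma barbalat:
  fixes f :: "real \<Rightarrow> 'a::real_normed_vector"
  assumes d: "\<And>t. t \<ge> a \<Longrightarrow> (f has_vector_derivative f' t) (at t)"
    and l: "(f \<longlongrightarrow> l) at_top" and uc: "uniformly_continuous_on {a..} f'"
  shows "(f' \<longlongrightarrow> 0) at_top"
proof (rule tendstoI)
  fix \<epsilon> :: real assume "\<epsilon> > 0"
  then obtain \<delta> where \<delta>: "\<delta> > 0" "\<And>s t. s \<ge> a \<Longrightarrow> t \<ge> a \<Longrightarrow> dist s t < \<delta> \<Longrightarrow> dist (f' s) (f' t) < \<epsilon> / 2"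
    using uc unfolding uniformly_continuous_on_def by (metis atLeast_iff half_gt_zero)
  define h where "h = \<delta> / 2"
  have h: "h > 0" "h < \<delta>" using \<delta> by (auto simp: h_def)
  have "((\<lambda>t. f (h + t) - f t) \<longlongrightarrow> l - l) at_top"
    by (intro tendsto_diff l filterlim_compose[OF l] filterlim_tendsto_add_at_top[OF tendsto_const filterlim_ident])
  then have "\<forall>\<^sub>F t in at_top. dist (f (h + t) - f t) 0 < h * (\<epsilon> / 2)"
    using h \<open>\<epsilon> > 0\<close> by (intro tendstoD) auto
  then show "\<forall>\<^sub>F t in at_top. dist (f' t) 0 < \<epsilon>"
    using eventually_ge_at_top[of a]
  proof eventually_elim
    case (elim t)
    define g where "g s = f s - (s - t) *\<^sub>R f' t" for s
    have "norm (g (t + h) - g t) \<le> (\<epsilon> / 2) * norm (t + h - t)"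
    proof (rule differentiable_bound[of "{t..t + h}" g "\<lambda>s x. x *\<^sub>R (f' s - f' t)"])
      fix s assume s: "s \<in> {t..t + h}"
      have "(g has_vector_derivative f' s - f' t) (at s)"
        unfolding g_def[abs_def] using s elim
        by (auto intro!: derivative_eq_intros d)
      then show "(g has_derivative (\<lambda>x. x *\<^sub>R (f' s - f' t))) (at s within {t..t + h})"
        unfolding has_vector_derivative_def by (rule has_derivative_at_withinI)
      have "dist (f' s) (f' t) < \<epsilon> / 2" by (rule \<delta>(2)) (use s h elim in \<open>auto simp: dist_real_def\<close>)
      then have "\<bar>x\<bar> * norm (f' s - f' t) \<le> \<bar>x\<bar> * (\<epsilon> / 2)" for x :: real
        by (intro mult_left_mono) (auto simp: dist_norm)
      then show "onorm (\<lambda>x. x *\<^sub>R (f' s - f' t)) \<le> \<epsilon> / 2"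
        by (intro onorm_le) (simp add: mult.commute)
    qed (use h in auto)
    then have "norm ((f (h + t) - f t) - h *\<^sub>R f' t) \<le> \<epsilon> / 2 * h"
      using h by (simp add: g_def add.commute diff_diff_eq)
    moreover have "norm (h *\<^sub>R f' t) \<le> norm (f (h + t) - f t) + norm ((f (h + t) - f t) - h *\<^sub>R f' t)"
      by (metis norm_minus_commute norm_triangle_sub)
    moreover have "norm (f (h + t) - f t) < h * (\<epsilon> / 2)" using elim by simp
    moreover have "norm (h *\<^sub>R f' t) = h * norm (f' t)" using h by simp
    ultimately have "h * norm (f' t) < h * \<epsilon>" by argo
    then show ?case using h by simp
  qed
qed

lemma bounded_deriv_uniformly_continuous:
  fixes f :: "real \<Rightarrow> 'a::real_normed_vector"
  assumes d: "\<And>t. t \<ge> a \<Longrightarrow> (f has_vector_derivative f' t) (at t)"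
    and b: "\<And>t. t \<ge> a \<Longrightarrow> norm (f' t) \<le> B"
  shows "uniformly_continuous_on {a..} f"
proof -
  have lip: "norm (f s - f t) \<le> (\<bar>B\<bar> + 1) * norm (s - t)" if "s \<ge> a" "t \<ge> a" for s t
  proof (rule differentiable_bound[of "{a..}" f "\<lambda>s x. x *\<^sub>R f' s"])
    fix s assume s: "s \<in> {a..}"
    then show "(f has_derivative (\<lambda>x. x *\<^sub>R f' s)) (at s within {a..})"
      using d[of s] unfolding has_vector_derivative_def by (auto intro: has_derivative_at_withinI)
    have "norm (f' s) \<le> \<bar>B\<bar> + 1" using b[of s] s by simp
    then have "\<bar>x\<bar> * norm (f' s) \<le> \<bar>x\<bar> * (\<bar>B\<bar> + 1)" for x :: real
      by (intro mult_left_mono) auto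
    then show "onorm (\<lambda>x. x *\<^sub>R f' s) \<le> \<bar>B\<bar> + 1"
      by (intro onorm_le) (simp add: mult.commute)
  qed (use that in auto)
  show ?thesis
    unfolding uniformly_continuous_on_def dist_norm
  proof (intro allI impI)
    fix \<epsilon> :: real assume \<epsilon>: "\<epsilon> > 0"
    show "\<exists>d>0. \<forall>x\<in>{a..}. \<forall>x'\<in>{a..}. norm (x' - x) < d \<longrightarrow> norm (f x' - f x) < \<epsilon>"
    proof (intro exI[of _ "\<epsilon> / (\<bar>B\<bar> + 1)"] conjI ballI impI)
      show "0 < \<epsilon> / (\<bar>B\<bar> + 1)" using \<epsilon> by simp
      fix s t assume st: "s \<in> {a..}" "t \<in> {a..}" "norm (t - s) < \<epsilon> / (\<bar>B\<bar> + 1)"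
      have "norm (f t - f s) \<le> (\<bar>B\<bar> + 1) * norm (t - s)" using st by (intro lip) auto
      also have "\<dots> < \<epsilon>" using st(3) by (simp add: pos_less_divide_eq mult.commute)
      finally show "norm (f t - f s) < \<epsilon>" .
    qed
  qed
qed

lemma exp_growth_dominates: "k > 0 \<Longrightarrow> \<exists>t\<ge>b. c * exp (t / 3) < k * exp t" for k c b :: real
proof -
  assume k: "k > 0"
  \<comment> \<open>As exp (2t/3) > 2t/3, it suffices that k * 2t/3 is at least |c|.\<close>
  define t where "t = max (max b 0) (3 / 2 * \<bar>c\<bar> / k)"
  have "3 / 2 * \<bar>c\<bar> / k \<le> t" unfolding t_def by simp
  then have "\<bar>c\<bar> \<le> k * (2 * t / 3)" using k by (simp add: field_simps)
  also have "\<dots> < k * exp (2 * t / 3)"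
    using k exp_ge_add_one_self[of "2 * t / 3"] by (intro mult_strict_left_mono) linarith+
  finally have "c < k * exp (2 * t / 3)" by linarith
  then have "c * exp (t / 3) < k * exp (2 * t / 3) * exp (t / 3)" by simp
  also have "\<dots> = k * exp t" by (simp add: exp_add[symmetric])
  finally show ?thesis by (intro exI[of _ t]) (simp add: t_def)
qed

section \<open>Determinants and symmetric matrices\<close>

lemma nondegenerate_iff_det: "(\<forall>u. u v* A = 0 \<longrightarrow> u = 0) \<longleftrightarrow> det A \<noteq> 0" for A :: "real ^ 'n ^ 'n"
proof -
  have "det A \<noteq> 0 \<longleftrightarrow> det (transpose A) \<noteq> 0" by (simp add: det_transpose)
  also have "\<dots> \<longleftrightarrow> (\<exists>B. B ** transpose A = mat 1)"
    by (metis invertible_det_nz invertible_left_inverse)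
  also have "\<dots> \<longleftrightarrow> (\<forall>u. transpose A *v u = 0 \<longrightarrow> u = 0)"
    by (rule matrix_left_invertible_ker)
  finally show ?thesis by simp
qed

lemma tendsto_det: "(f \<longlongrightarrow> l) F \<Longrightarrow> ((\<lambda>x. det (f x)) \<longlongrightarrow> det l) F" for f :: "'x \<Rightarrow> real ^ 3 ^ 3"
  unfolding det_3 by (intro tendsto_intros)

lemma det_sign_constant:
  fixes f :: "real \<Rightarrow> real ^ 3 ^ 3"
  assumes cont: "continuous_on {s..t} f" and nz: "\<And>r. r \<in> {s..t} \<Longrightarrow> det (f r) \<noteq> 0" and st: "s \<le> t"
  shows "sgn (det (f t)) = sgn (det (f s))"
proof (rule ccontr)
  assume ne: "sgn (det (f t)) \<noteq> sgn (det (f s))"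
  have cont: "continuous_on {s..t} (\<lambda>r. det (f r))"
    using cont unfolding det_3 by (intro continuous_intros)
  have n0: "det (f s) \<noteq> 0" "det (f t) \<noteq> 0" using nz st by auto
  have "\<exists>r\<in>{s..t}. det (f r) = 0"
  proof (cases "det (f s) \<le> 0")
    case True
    then have "0 \<le> det (f t)" using ne n0 by (auto simp: sgn_if split: if_splits)
    with IVT'[of "\<lambda>r. det (f r)" s 0 t] True st cont show ?thesis by auto
  next
    case False
    then have "det (f t) \<le> 0" using ne by (auto simp: sgn_if split: if_splits)
    with IVT2'[of "\<lambda>r. det (f r)" t 0 s] False st cont show ?thesis by auto
  qed
  then show False using nz by blast
qed

text \<open>\<open>det1 A B\<close> and \<open>det2 A B\<close> are the coefficients of \<open>s\<close> and \<open>s\<^sup>2\<close> in \<open>det (A + s B)\<close>.\<close>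

definition det1 :: "real ^ 3 ^ 3 \<Rightarrow> real ^ 3 ^ 3 \<Rightarrow> real" where
  "det1 A B = det (vector [B $ 1, A $ 2, A $ 3]) + det (vector [A $ 1, B $ 2, A $ 3])
    + det (vector [A $ 1, A $ 2, B $ 3])"

definition det2 :: "real ^ 3 ^ 3 \<Rightarrow> real ^ 3 ^ 3 \<Rightarrow> real" where
  "det2 A B = det (vector [B $ 1, B $ 2, A $ 3]) + det (vector [A $ 1, B $ 2, B $ 3])
    + det (vector [B $ 1, A $ 2, B $ 3])"

text \<open>Together with \<open>det2_mult\<close> this is the expansion of det (A + s A Y) = det A
  det (1 + s Y): the coefficients are the first two elementary symmetric functions of the
  eigenvalues of \<open>Y\<close>.\<close>

lemma det1_mult: "det1 A (A ** Y) = det A * trace Y"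
  by (simp add: det1_def det_3 trace_def sum_3 matrix_matrix_mult_def vector_3 algebra_simps)

lemma det2_mult: "2 * det2 A (A ** Y) = det A * ((trace Y)\<^sup>2 - trace (Y ** Y))"
  by (simp add: det2_def det_3 trace_def sum_3 matrix_matrix_mult_def vector_3 power2_eq_square algebra_simps)

lemma has_vector_derivative_component:
  assumes "(f has_vector_derivative f') F" shows "((\<lambda>t. f t $ i) has_vector_derivative f' $ i) F"
  using bounded_linear.has_vector_derivative[OF bounded_linear_vec_nth assms] .

lemma has_vector_derivative_entry:
  fixes f :: "real \<Rightarrow> real ^ 'n ^ 'm"
  assumes "(f has_vector_derivative f') (at t within S)"
  shows "((\<lambda>t. f t $ i $ j) has_real_derivative f' $ i $ j) (at t within S)"
  using has_vector_derivative_component[OF has_vector_derivative_component[OF assms]]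
  by (simp add: has_real_derivative_iff_has_vector_derivative)

lemma det_has_derivative:
  fixes f :: "real \<Rightarrow> real ^ 3 ^ 3"
  assumes f: "(f has_vector_derivative f') (at t within S)"
  shows "((\<lambda>t. det (f t)) has_real_derivative det1 (f t) f') (at t within S)"
  unfolding det_3 det1_def vector_3
  by (rule derivative_eq_intros has_vector_derivative_entry[OF f] refl)+ (simp add: algebra_simps)

lemma det1_has_derivative:
  fixes f g :: "real \<Rightarrow> real ^ 3 ^ 3"
  assumes f: "(f has_vector_derivative g t) (at t within S)" and g: "(g has_vector_derivative g') (at t within S)"
  shows "((\<lambda>t. det1 (f t) (g t)) has_real_derivative 2 * det2 (f t) (g t) + det1 (f t) g') (at t within S)"
  unfolding det_3 det1_def det2_def vector_3
  by (rule derivative_eq_intros has_vector_derivative_entry[OF f] has_vector_derivative_entry[OF g] refl)+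
    (simp add: algebra_simps)

lemma trace_square_symmetric:
  fixes Y :: "real ^ 'n ^ 'n"
  assumes "transpose Y = Y"
  shows "trace (Y ** Y) = (norm Y)\<^sup>2"
proof -
  have "Y $ j $ i = Y $ i $ j" for i j using assms by (metis transpose_def vec_lambda_beta)
  then show ?thesis
    by (simp add: trace_def matrix_matrix_mult_def power2_norm_eq_inner inner_vec_def)
qed

lemma trace_square_ge: "(trace Y)\<^sup>2 \<le> real CARD('n) * (norm Y)\<^sup>2" for Y :: "real ^ 'n ^ 'n"
proof -
  have "(trace Y)\<^sup>2 \<le> (\<Sum>i\<in>UNIV. (Y $ i $ i)\<^sup>2) * real CARD('n)"
    unfolding trace_def by (rule sum_squared_le_sum_of_squares)
  also have "(\<Sum>i\<in>UNIV. (Y $ i $ i)\<^sup>2) \<le> (\<Sum>i\<in>UNIV. \<Sum>j\<in>UNIV. (Y $ i $ j)\<^sup>2)"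
    by (intro sum_mono member_le_sum) auto
  also have "\<dots> = (norm Y)\<^sup>2"
    by (simp add: power2_norm_eq_inner inner_vec_def power2_eq_square[of "Y $ _ $ _"])
  finally show ?thesis by (simp add: mult.commute)
qed

text \<open>\<open>Y + c\<close> is positive semidefinite, so its diagonal entries are bounded by
  its trace, and testing with the sums and differences of two basis vectors bounds the other entries
  by the diagonal ones.\<close>

lemma psd_shift_norm_le:
  fixes Y :: "real ^ 'n ^ 'n"
  assumes sym: "transpose Y = Y" and c: "c \<ge> 0" and ge: "\<And>v. - c * (norm v)\<^sup>2 \<le> v \<bullet> (Y *v v)"
  shows "- c * real CARD('n) \<le> trace Y"
    and "norm Y \<le> real CARD('n) * real CARD('n) * (trace Y + c * real CARD('n) + c)"
proof -
  define Z where "Z i j = Y $ i $ j + (if i = j then c else 0)" for i j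
  have Ysym: "Y $ j $ i = Y $ i $ j" for i j using sym by (metis transpose_def vec_lambda_beta)
  have ent: "axis i 1 \<bullet> (Y *v axis j 1) = Y $ i $ j" for i j
    by (simp add: inner_axis' matrix_vector_mult_basis column_def)
  have diag: "Z i i \<ge> 0" for i
    using ge[of "axis i 1"] by (simp add: ent Z_def norm_axis_1)
  have tr: "(\<Sum>i\<in>UNIV. Z i i) = trace Y + c * real CARD('n)"
    by (simp add: Z_def trace_def sum.distrib mult.commute)
  with sum_nonneg[of UNIV "\<lambda>i. Z i i"] diag show "- c * real CARD('n) \<le> trace Y" by simp
  have Zi: "Z i i \<le> trace Y + c * real CARD('n)" for i
    using member_le_sum[of i UNIV "\<lambda>i. Z i i"] diag tr by simp
  have "\<bar>Y $ i $ j\<bar> \<le> trace Y + c * real CARD('n) + c" for i j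
  proof (cases "i = j")
    case True
    then show ?thesis using diag[of i] Zi[of i] c by (simp add: Z_def)
  next
    case False
    have n: "(norm (axis i 1 + s *\<^sub>R axis j 1 :: real ^ 'n))\<^sup>2 = 1 + s * s" for s
      using False by (simp add: power2_norm_eq_inner inner_add_left inner_add_right inner_axis_axis)
    have q: "0 \<le> Z i i + s * s * Z j j + 2 * s * Y $ i $ j" for s
      using ge[of "axis i 1 + s *\<^sub>R axis j 1"]
      by (simp add: n inner_add_left inner_add_right matrix_vector_right_distrib matrix_vector_mult_scaleR
          ent Ysym[of i j] Z_def algebra_simps)
    have "2 * \<bar>Y $ i $ j\<bar> \<le> Z i i + Z j j" using q[of 1] q[of "-1"] by auto
    with Zi[of i] Zi[of j] c show ?thesis by simp
  qed
  then have "(\<Sum>i\<in>UNIV. \<Sum>j\<in>UNIV. \<bar>Y $ i $ j\<bar>) \<le> (\<Sum>i\<in>(UNIV::'n set). \<Sum>j\<in>(UNIV::'n set). trace Y + c * real CARD('n) + c)"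
    by (intro sum_mono)
  moreover have "norm Y \<le> (\<Sum>i\<in>UNIV. \<Sum>j\<in>UNIV. \<bar>Y $ i $ j\<bar>)"
  proof -
    have "norm Y \<le> (\<Sum>i\<in>UNIV. norm (Y $ i))" unfolding norm_vec_def[of Y] by (rule L2_set_le_sum) simp
    also have "\<dots> \<le> (\<Sum>i\<in>UNIV. \<Sum>j\<in>UNIV. \<bar>Y $ i $ j\<bar>)" by (intro sum_mono norm_le_l1_cart)
    finally show ?thesis .
  qed
  ultimately show "norm Y \<le> real CARD('n) * real CARD('n) * (trace Y + c * real CARD('n) + c)" by simp
qed

section \<open>Rescaled collision orbits\<close>

context pair_potential
begin

definition stiffness :: "real ^ 'n ^ 'n \<Rightarrow> real ^ 'n ^ 'n" where
  "stiffness X = (\<Sum>p\<in>P. (w p / norm (X *v e p) ^ 3) *\<^sub>R outer (e p) (e p))"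

lemma force_eq_stiffness: "force X = - (X ** stiffness X)"
proof -
  interpret bl: bounded_linear "\<lambda>A::real^'n^'n. X ** A"
    by (rule bounded_bilinear.bounded_linear_right[OF bounded_bilinear_mm])
  show ?thesis by (simp add: force_def stiffness_def bl.sum bl.scaleR matrix_mult_outer)
qed

lemma trace_stiffness: "trace (stiffness X) = (\<Sum>p\<in>P. w p / norm (X *v e p) ^ 3 * (norm (e p))\<^sup>2)"
proof -
  have "trace (stiffness X) = (\<Sum>i\<in>UNIV. \<Sum>p\<in>P. w p / norm (X *v e p) ^ 3 * (e p $ i * e p $ i))"
    by (simp add: trace_def stiffness_def outer_def mult_ac)
  also have "\<dots> = (\<Sum>p\<in>P. \<Sum>i\<in>UNIV. w p / norm (X *v e p) ^ 3 * (e p $ i * e p $ i))"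
    by (rule sum.swap)
  finally show ?thesis
    by (simp add: power2_norm_eq_inner inner_vec_def sum_distrib_left sum_divide_distrib mult_ac)
qed

lemma trace_stiffness_nonneg: "0 \<le> trace (stiffness X)"
  unfolding trace_stiffness by (intro sum_nonneg mult_nonneg_nonneg divide_nonneg_nonneg w_nonneg) auto

lemma force_inner_self: "force X \<bullet> X = - pot X"
proof -
  have "a / n ^ 3 * n\<^sup>2 = a / n" for a n :: real
    by (cases "n = 0") (simp_all add: power2_eq_square power3_eq_cube)
  then show ?thesis
    by (simp add: force_inner pot_def power2_norm_eq_inner[symmetric])
qed

lemma continuous_trace_stiffness:
  assumes "collisionless X" shows "isCont (\<lambda>X. trace (stiffness X)) X"
proof -
  have "isCont (\<lambda>X::real^'n^'n. X *v e p) X" for p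
    by (intro linear_continuous_at bounded_bilinear.bounded_linear_left[OF bounded_bilinear_mv])
  then show ?thesis
    unfolding trace_stiffness using assms
    by (intro continuous_intros) (auto simp: collisionless_def)
qed

end

text \<open>\<open>lower\<close> and \<open>growth\<close> are the rescaled bounds of the path: the
  drift of the new variable adds 2/3 to -1, and |x|^2 of order T - t = exp (-t) is multiplied by exp
  (4t/3). The last assumption isolates what depends on the geometry of the bodies.\<close>

locale collision_orbit = pair_potential P e w
  for P :: "'i set" and e :: "'i \<Rightarrow> real ^ 3" and w :: "'i \<Rightarrow> real" +
  fixes \<xi> \<eta> :: "real \<Rightarrow> real ^ 3 ^ 3" and a C :: real
  assumes d\<xi>: "t \<ge> a \<Longrightarrow> (\<xi> has_vector_derivative \<eta> t) (at t)"
    and d\<eta>: "t \<ge> a \<Longrightarrow> (\<eta> has_vector_derivative (1/3) *\<^sub>R \<eta> t + (2/9) *\<^sub>R \<xi> t + force (\<xi> t)) (at t)"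
    and nondeg: "t \<ge> a \<Longrightarrow> det (\<xi> t) \<noteq> 0"
    and sym: "t \<ge> a \<Longrightarrow> (u v* \<eta> t) \<bullet> (v v* \<xi> t) = (v v* \<eta> t) \<bullet> (u v* \<xi> t)"
    and lower: "t \<ge> a \<Longrightarrow> - (1/3) * (norm (u v* \<xi> t))\<^sup>2 \<le> (u v* \<eta> t) \<bullet> (u v* \<xi> t)"
    and growth: "t \<ge> a \<Longrightarrow> (norm (\<xi> t))\<^sup>2 \<le> C * exp (t / 3)"
    and degenerate_critical: "collisionless Y \<Longrightarrow> force Y = - (2/9) *\<^sub>R Y \<Longrightarrow> det Y = 0 \<Longrightarrow>
      2/3 < trace (stiffness Y)"
begin

lemma collisionless_orbit: "t \<ge> a \<Longrightarrow> collisionless (\<xi> t)"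
  using nondegenerate_collisionless nondegenerate_iff_det nondeg by blast

text \<open>\<open>E\<close> is the energy of the rescaled equation, whose damping has the wrong sign, so that \<open>E\<close> is
  nondecreasing; \<open>J\<close> is the energy of the original motion in rescaled variables, so it decays
  like \<open>exp (- 2 t / 3)\<close>.\<close>

definition "\<rho> t = \<xi> t \<bullet> \<xi> t"
definition "E t = (1/2) * (\<eta> t \<bullet> \<eta> t) - pot (\<xi> t) - (1/9) * \<rho> t"
definition "J t = E t - (2/3) * (\<xi> t \<bullet> \<eta> t) + (1/3) * \<rho> t"

lemma inner_deriv:
  fixes f g :: "real \<Rightarrow> real ^ 3 ^ 3"
  assumes "(f has_vector_derivative f') (at t)" "(g has_vector_derivative g') (at t)"
  shows "((\<lambda>t. f t \<bullet> g t) has_real_derivative f t \<bullet> g' + f' \<bullet> g t) (at t)"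
  using bounded_bilinear.has_vector_derivative[OF bounded_bilinear_inner assms]
  by (simp add: has_real_derivative_iff_has_vector_derivative)

lemma \<rho>_deriv: "t \<ge> a \<Longrightarrow> (\<rho> has_real_derivative 2 * (\<xi> t \<bullet> \<eta> t)) (at t)"
  using inner_deriv[OF d\<xi> d\<xi>, of t] by (simp add: \<rho>_def[abs_def] inner_commute)

lemma pot_deriv: "t \<ge> a \<Longrightarrow> ((\<lambda>t. pot (\<xi> t)) has_real_derivative force (\<xi> t) \<bullet> \<eta> t) (at t)"
proof -
  assume t: "t \<ge> a"
  have "((pot \<circ> \<xi>) has_derivative (\<lambda>H. force (\<xi> t) \<bullet> H) \<circ> (\<lambda>x. x *\<^sub>R \<eta> t)) (at t)"
    using d\<xi>[OF t] pot_has_derivative[OF collisionless_orbit[OF t]]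
    unfolding has_vector_derivative_def by (rule diff_chain_at)
  then show ?thesis
    by (simp add: has_field_derivative_def o_def mult.commute[of _ "force (\<xi> t) \<bullet> \<eta> t"])
qed

lemma E_deriv: "t \<ge> a \<Longrightarrow> (E has_real_derivative (norm (\<eta> t))\<^sup>2 / 3) (at t)"
  unfolding E_def[abs_def]
  by (rule DERIV_cong[OF DERIV_diff[OF DERIV_diff[OF DERIV_cmult[OF inner_deriv[OF d\<eta> d\<eta>]] pot_deriv]
        DERIV_cmult[OF \<rho>_deriv]]])
    (simp_all add: inner_add_left inner_add_right inner_commute power2_norm_eq_inner field_simps)

lemma J_deriv: "t \<ge> a \<Longrightarrow> (J has_real_derivative - (2/3) * J t) (at t)"
  unfolding J_def[abs_def]
  by (rule DERIV_cong[OF DERIV_add[OF DERIV_diff[OF E_deriv DERIV_cmult[OF inner_deriv[OF d\<xi> d\<eta>]]]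
        DERIV_cmult[OF \<rho>_deriv]]])
    (simp_all add: E_def inner_add_left inner_add_right inner_commute power2_norm_eq_inner \<rho>_def
      force_inner_self[of "\<xi> t", unfolded inner_commute[of "force _"]] field_simps)

lemma J_bound: "t \<ge> a \<Longrightarrow> \<bar>J t\<bar> \<le> \<bar>J a\<bar>"
proof -
  assume t: "t \<ge> a"
  have d: "((\<lambda>t. (J t)\<^sup>2) has_real_derivative - (4/3) * (J t)\<^sup>2) (at t)" if "t \<ge> a" for t
    by (rule derivative_eq_intros J_deriv[OF that] refl)+ (simp add: power2_eq_square)
  have "(J t)\<^sup>2 \<le> (J a)\<^sup>2" by (rule barrier[of a, OF d]) (use t in auto)
  then show ?thesis by (simp add: abs_le_square_iff)
qed

lemma E_mono: "a \<le> s \<Longrightarrow> s \<le> t \<Longrightarrow> E s \<le> E t"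
  by (rule deriv_nonneg_mono[of a, OF E_deriv]) auto

lemma \<rho>_deriv': "2 * (\<xi> t \<bullet> \<eta> t) = \<rho> t + 3 * E t - 3 * J t"
  by (simp add: J_def)

text \<open>The derivative of \<rho> is \<rho> + 3 E - 3 J. Once \<rho> exceeds the threshold it
  grows like exp t, whereas \<open>growth\<close> allows only exp (t/3). This upgrades the rough
  collision estimate to the exponent 2/3.\<close>

lemma \<rho>_bounded: "t \<ge> a \<Longrightarrow> \<rho> t \<le> 3 * (\<bar>E a\<bar> + \<bar>J a\<bar>)"
proof (rule ccontr)
  define c where "c = 3 * (\<bar>E a\<bar> + \<bar>J a\<bar>)"
  assume t: "t \<ge> a" and "\<not> \<rho> t \<le> 3 * (\<bar>E a\<bar> + \<bar>J a\<bar>)"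
  then have gt: "\<rho> t > c" by (simp add: c_def)
  have d: "((\<lambda>s. (\<rho> s - c) * exp (- s)) has_real_derivative (2 * (\<xi> s \<bullet> \<eta> s) - (\<rho> s - c)) * exp (- s)) (at s)"
    if "s \<ge> a" for s
    by (rule derivative_eq_intros \<rho>_deriv[OF that] refl)+ (simp add: algebra_simps)
  have mono: "(\<rho> t - c) * exp (- t) \<le> (\<rho> s - c) * exp (- s)" if "s \<ge> t" for s
  proof (rule deriv_nonneg_mono[of a, OF d])
    fix r assume r: "a \<le> r"
    have "3 * E r - 3 * J r + c \<ge> 0"
      using E_mono[OF order_refl r] J_bound[OF r] abs_ge_minus_self[of "E a"] abs_ge_self[of "J r"]
      unfolding c_def by argo
    then show "0 \<le> (2 * (\<xi> r \<bullet> \<eta> r) - (\<rho> r - c)) * exp (- r)"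
      unfolding \<rho>_deriv' by (intro mult_nonneg_nonneg) auto
  qed (use t that in auto)
  define k where "k = (\<rho> t - c) * exp (- t)"
  have "k > 0" using gt by (simp add: k_def)
  then obtain s where s: "s \<ge> t" "C * exp (s / 3) < k * exp s" using exp_growth_dominates by blast
  have "k * exp s \<le> \<rho> s - c" using mono[OF s(1)] by (simp add: k_def exp_minus field_simps)
  also have "\<dots> \<le> C * exp (s / 3)"
    using growth[of s] s(1) t unfolding c_def by (simp add: \<rho>_def power2_norm_eq_inner)
  finally show False using s(2) by simp
qed

text \<open>A larger value of the nondecreasing \<open>E\<close> would force the derivative of
  \<rho> to be at least 1 from then on, contradicting \<open>\<rho>_bounded\<close>.\<close>

lemma E_bounded: "t \<ge> a \<Longrightarrow> E t \<le> \<bar>J a\<bar> + 1/3"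
proof (rule ccontr)
  define c where "c = 3 * (\<bar>E a\<bar> + \<bar>J a\<bar>)"
  assume t: "t \<ge> a" and "\<not> E t \<le> \<bar>J a\<bar> + 1/3"
  then have gt: "E t > \<bar>J a\<bar> + 1/3" by simp
  have d: "((\<lambda>s. \<rho> s - s) has_real_derivative 2 * (\<xi> s \<bullet> \<eta> s) - 1) (at s)" if "s \<ge> t" for s
    by (rule derivative_eq_intros \<rho>_deriv refl | use that t in simp)+
  have nn: "\<rho> s \<ge> 0" for s by (simp add: \<rho>_def)
  have c0: "c \<ge> 0" by (simp add: c_def)
  have "\<rho> t - t \<le> \<rho> (t + c + 1) - (t + c + 1)"
  proof (rule deriv_nonneg_mono[of t, OF d])
    fix r assume r: "t \<le> r"
    show "0 \<le> 2 * (\<xi> r \<bullet> \<eta> r) - 1"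
      unfolding \<rho>_deriv' using E_mono[OF t r] gt J_bound[of r] nn[of r] r t by linarith
  qed (use c0 in auto)
  moreover have "\<rho> (t + c + 1) \<le> c" using \<rho>_bounded[of "t + c + 1"] t c0 by (simp add: c_def)
  ultimately show False using nn[of t] by linarith
qed

text \<open>\<open>Y\<close> satisfies the Riccati equation \<open>Y' = Y / 3 - Y\<^sup>2 + 2 / 9 - stiffness\<close>; only its trace \<open>y\<close>
  is differentiated.\<close>

definition "y t = det1 (\<xi> t) (\<eta> t) / det (\<xi> t)"
definition "Y t = matrix_inv (\<xi> t) ** \<eta> t"

lemma Y: "t \<ge> a \<Longrightarrow> \<xi> t ** Y t = \<eta> t"
proof -
  assume "t \<ge> a"
  then have "invertible (\<xi> t)" using nondeg by (simp add: invertible_det_nz)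
  then have "\<xi> t ** matrix_inv (\<xi> t) = mat 1"
    unfolding invertible_def matrix_inv_def by (metis (mono_tags, lifting) someI_ex)
  then show ?thesis by (simp add: Y_def matrix_mul_assoc)
qed

lemma y_trace: "t \<ge> a \<Longrightarrow> y t = trace (Y t)"
  using nondeg[of t] det1_mult[of "\<xi> t" "Y t"] by (simp add: y_def Y)

lemma Y_forms:
  assumes t: "t \<ge> a"
  shows "transpose (Y t) = Y t" and "- (1/3) * (norm v)\<^sup>2 \<le> v \<bullet> (Y t *v v)"
proof -
  have surj: "\<exists>u. u v* \<xi> t = z" for z
    using surj_vm_iff[of "\<xi> t"] nondegenerate_iff_det[of "\<xi> t"] nondeg[OF t] by blast
  have vm: "u v* \<eta> t = (u v* \<xi> t) v* Y t" for u
    by (simp add: vector_matrix_mul_assoc Y[OF t])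
  have s: "(p v* Y t) \<bullet> q = (q v* Y t) \<bullet> p" for p q
    using surj[of p] surj[of q] sym[OF t] vm by metis
  show "transpose (Y t) = Y t"
  proof -
    have "transpose (Y t) *v p = Y t *v p" for p
    proof (rule vector_eq_rdot[THEN iffD1], rule allI)
      fix q show "(transpose (Y t) *v p) \<bullet> q = (Y t *v p) \<bullet> q"
        using s[of p q] dot_lmul_matrix[of q "Y t" p] by (simp add: inner_commute)
    qed
    then show ?thesis by (simp add: matrix_eq)
  qed
  obtain u where u: "u v* \<xi> t = v" using surj by blast
  show "- (1/3) * (norm v)\<^sup>2 \<le> v \<bullet> (Y t *v v)"
    using lower[OF t, of u] unfolding vm u by (simp add: dot_lmul_matrix)
qed

text \<open>Differentiating the quotient of \<open>det1\<close> by \<open>det\<close> avoids the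
  derivative of the inverse matrix; the square of \<open>y\<close> coming from \<open>det2\<close>
  cancels against the one from the quotient rule.\<close>

lemma y_deriv:
  assumes t: "t \<ge> a"
  shows "(y has_real_derivative y t / 3 - (norm (Y t))\<^sup>2 + 2/3 - trace (stiffness (\<xi> t))) (at t)"
proof -
  define W where "W = (1/3) *\<^sub>R Y t + (2/9) *\<^sub>R mat 1 - stiffness (\<xi> t)"
  interpret bl: bounded_linear "\<lambda>A. \<xi> t ** A"
    by (rule bounded_bilinear.bounded_linear_right[OF bounded_bilinear_mm])
  have W: "(1/3) *\<^sub>R \<eta> t + (2/9) *\<^sub>R \<xi> t + force (\<xi> t) = \<xi> t ** W"
    unfolding W_def by (simp only: bl.add bl.diff bl.scaleR Y[OF t] force_eq_stiffness matrix_mul_rid) simp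
  have trW: "trace W = y t / 3 + 2/3 - trace (stiffness (\<xi> t))"
    by (simp add: W_def y_trace[OF t] trace_def sum_3 mat_def field_simps)
  note D = nondeg[OF t]
  have 1: "((\<lambda>t. det1 (\<xi> t) (\<eta> t)) has_real_derivative
      det (\<xi> t) * ((y t)\<^sup>2 - (norm (Y t))\<^sup>2 + trace W)) (at t)"
  proof (rule DERIV_cong[OF det1_has_derivative[where g = \<eta>, OF d\<xi>[OF t] d\<eta>[OF t]]])
    have "2 * det2 (\<xi> t) (\<eta> t) = det (\<xi> t) * ((y t)\<^sup>2 - (norm (Y t))\<^sup>2)"
      using det2_mult[of "\<xi> t" "Y t"]
      by (simp add: Y[OF t] y_trace[OF t] trace_square_symmetric[OF Y_forms(1)[OF t]])
    then show "2 * det2 (\<xi> t) (\<eta> t) + det1 (\<xi> t) ((1/3) *\<^sub>R \<eta> t + (2/9) *\<^sub>R \<xi> t + force (\<xi> t))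
        = det (\<xi> t) * ((y t)\<^sup>2 - (norm (Y t))\<^sup>2 + trace W)"
      unfolding W det1_mult by (simp add: distrib_left)
  qed
  have 2: "((\<lambda>t. det (\<xi> t)) has_real_derivative det (\<xi> t) * y t) (at t)"
    using det_has_derivative[OF d\<xi>[OF t]] D by (simp add: y_def)
  show ?thesis
    unfolding y_def[abs_def]
  proof (rule DERIV_cong[OF DERIV_divide[OF 1 2 D]])
    have "det1 (\<xi> t) (\<eta> t) = det (\<xi> t) * y t" using D by (simp add: y_def)
    then have "(det (\<xi> t) * ((y t)\<^sup>2 - (norm (Y t))\<^sup>2 + trace W) * det (\<xi> t)
        - det1 (\<xi> t) (\<eta> t) * (det (\<xi> t) * y t))
      = ((y t)\<^sup>2 - (norm (Y t))\<^sup>2 + trace W - y t * y t) * (det (\<xi> t) * det (\<xi> t))"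
      by (simp add: algebra_simps)
    then show "(det (\<xi> t) * ((y t)\<^sup>2 - (norm (Y t))\<^sup>2 + trace W) * det (\<xi> t)
        - det1 (\<xi> t) (\<eta> t) * (det (\<xi> t) * y t)) / (det (\<xi> t) * det (\<xi> t))
      = det1 (\<xi> t) (\<eta> t) / det (\<xi> t) / 3 - (norm (Y t))\<^sup>2 + 2/3 - trace (stiffness (\<xi> t))"
      using D by (simp add: trW power2_eq_square y_def[symmetric])
  qed
qed

lemma y_ge: "t \<ge> a \<Longrightarrow> -1 \<le> y t"
  using psd_shift_norm_le(1)[of "Y t" "1/3"] Y_forms[of t] by (simp add: y_trace)

text \<open>The trace inequality bounds the derivative of \<open>y\<close> by y/3 - y^2/3 + 2/3 =
  -(y - 2)(y + 1)/3, which is nonpositive above 2.\<close>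

lemma y_le: "t \<ge> a \<Longrightarrow> y t \<le> max 2 (y a)"
proof (rule barrier[of a, OF y_deriv])
  fix t assume t: "t \<ge> a" "y t > max 2 (y a)"
  have "(y t)\<^sup>2 \<le> 3 * (norm (Y t))\<^sup>2" using trace_square_ge[of "Y t"] t by (simp add: y_trace)
  moreover have "(y t - 2) * (y t + 1) \<ge> 0" using t by (intro mult_nonneg_nonneg) auto
  ultimately have "y t / 3 - (norm (Y t))\<^sup>2 + 2/3 \<le> 0"
    by (simp add: algebra_simps power2_eq_square)
  then show "y t / 3 - (norm (Y t))\<^sup>2 + 2/3 - trace (stiffness (\<xi> t)) \<le> 0"
    using trace_stiffness_nonneg[of "\<xi> t"] by linarith
qed auto

section \<open>Compactness and asymptotics of the rescaled orbit\<close>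

lemma \<xi>_norm_bounded: "\<exists>R. \<forall>t\<ge>a. norm (\<xi> t) \<le> R"
proof (intro exI allI impI)
  fix t assume "t \<ge> a"
  then have "(norm (\<xi> t))\<^sup>2 \<le> 3 * (\<bar>E a\<bar> + \<bar>J a\<bar>)"
    using \<rho>_bounded by (simp add: \<rho>_def power2_norm_eq_inner)
  then show "norm (\<xi> t) \<le> sqrt (3 * (\<bar>E a\<bar> + \<bar>J a\<bar>))" by (rule real_le_rsqrt)
qed

text \<open>\<eta> is \<xi> times \<open>Y\<close>, and \<open>Y\<close> is symmetric with
  eigenvalues at least -1/3 and bounded trace.\<close>

lemma \<eta>_norm_bounded: "\<exists>R. \<forall>t\<ge>a. norm (\<eta> t) \<le> R"
proof -
  obtain R where R: "\<And>t. t \<ge> a \<Longrightarrow> norm (\<xi> t) \<le> R" using \<xi>_norm_bounded by blast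
  obtain K where K: "K > 0" "\<And>(A :: real ^ 3 ^ 3) (B :: real ^ 3 ^ 3). norm (A ** B) \<le> norm A * norm B * K"
    using bounded_bilinear.pos_bounded[OF bounded_bilinear_mm] by blast
  define M where "M = 9 * (max 2 (y a) + 4/3)"
  have "norm (\<eta> t) \<le> R * M * K" if t: "t \<ge> a" for t
  proof -
    have "norm (Y t) \<le> M"
      using psd_shift_norm_le(2)[of "Y t" "1/3"] Y_forms[OF t] y_le[OF t] by (simp add: y_trace[OF t] M_def)
    then have "norm (\<xi> t) * norm (Y t) * K \<le> R * M * K"
      using R[OF t] K(1) by (intro mult_right_mono mult_mono) (auto intro: order_trans[OF norm_ge_zero])
    with K(2)[of "\<xi> t" "Y t"] show ?thesis unfolding Y[OF t] by linarith
  qed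
  then show ?thesis by blast
qed

text \<open>\<open>E\<close> never falls below its initial value and \<eta> is bounded, so
  \<open>pot\<close> is bounded above, which keeps every pair at a definite distance.\<close>

lemma orbit_in_compact:
  obtains K where "compact K" "\<And>X. X \<in> K \<Longrightarrow> collisionless X" "\<And>t. t \<ge> a \<Longrightarrow> \<xi> t \<in> K"
proof -
  obtain R where R: "\<And>t. t \<ge> a \<Longrightarrow> norm (\<xi> t) \<le> R" using \<xi>_norm_bounded by blast
  obtain R' where R': "\<And>t. t \<ge> a \<Longrightarrow> norm (\<eta> t) \<le> R'" using \<eta>_norm_bounded by blast
  define M where "M = max 1 (R'\<^sup>2 / 2 - E a)"
  have M: "pot (\<xi> t) \<le> M" if t: "t \<ge> a" for t
  proof -
    have "(norm (\<eta> t))\<^sup>2 \<le> R'\<^sup>2" using R'[OF t] by (intro power_mono) auto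
    moreover have "\<rho> t \<ge> 0" by (simp add: \<rho>_def)
    ultimately show ?thesis
      using E_mono[OF order_refl t] by (simp add: E_def[of t] M_def power2_norm_eq_inner)
  qed
  define K where "K = {X :: real ^ 3 ^ 3. norm X \<le> R \<and> (\<forall>p\<in>P. w p / M \<le> norm (X *v e p))}"
  have Mpos: "M > 0" by (simp add: M_def)
  show ?thesis
  proof (rule that)
    show "compact K" unfolding K_def by (rule compact_away_from_collisions)
    show "collisionless X" if "X \<in> K" for X
      unfolding collisionless_def
    proof
      fix p assume p: "p \<in> P"
      have "0 < w p / M" using w_pos[OF p] Mpos by simp
      also have "\<dots> \<le> norm (X *v e p)" using that p by (simp add: K_def)
      finally show "X *v e p \<noteq> 0" by auto
    qed
    show "\<xi> t \<in> K" if t: "t \<ge> a" for t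
      unfolding K_def
    proof (safe intro!: R[OF t])
      fix p assume p: "p \<in> P"
      have "norm (\<xi> t *v e p) > 0" using collisionless_orbit[OF t] p by (simp add: collisionless_def)
      moreover have "w p / norm (\<xi> t *v e p) \<le> M" using pot_ge[OF p] M[OF t] by (rule order_trans)
      ultimately show "w p / M \<le> norm (\<xi> t *v e p)" using Mpos by (simp add: field_simps)
    qed
  qed
qed

lemma \<xi>_uc: "uniformly_continuous_on {a..} \<xi>"
  using bounded_deriv_uniformly_continuous[OF d\<xi>] \<eta>_norm_bounded by blast

lemma force_bounded: "\<exists>R. \<forall>t\<ge>a. norm (force (\<xi> t)) \<le> R"
proof -
  obtain K where K: "compact K" "\<And>X. X \<in> K \<Longrightarrow> collisionless X" "\<And>t. t \<ge> a \<Longrightarrow> \<xi> t \<in> K"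
    using orbit_in_compact by blast
  have "compact (force ` K)" by (rule compact_continuous_image[OF continuous_on_force[OF K(2)] K(1)])
  then show ?thesis using K(3) by (meson bounded_iff compact_imp_bounded imageI)
qed

lemma force_uc: "uniformly_continuous_on {a..} (\<lambda>t. force (\<xi> t))"
proof -
  obtain K where K: "compact K" "\<And>X. X \<in> K \<Longrightarrow> collisionless X" "\<And>t. t \<ge> a \<Longrightarrow> \<xi> t \<in> K"
    using orbit_in_compact by blast
  have "uniformly_continuous_on K force"
    using compact_uniformly_continuous[OF continuous_on_force[OF K(2)] K(1)] .
  then have "uniformly_continuous_on (\<xi> ` {a..}) force"
    unfolding uniformly_continuous_on_def
    using K(3) by (metis (no_types, lifting) atLeast_iff imageE)
  from uniformly_continuous_on_compose[OF \<xi>_uc this] show ?thesis by (simp add: o_def)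
qed

lemma \<eta>_deriv_bounded: "\<exists>R. \<forall>t\<ge>a. norm ((1/3) *\<^sub>R \<eta> t + (2/9) *\<^sub>R \<xi> t + force (\<xi> t)) \<le> R"
proof -
  obtain R1 R2 R3 where R: "\<forall>t\<ge>a. norm (\<xi> t) \<le> R1" "\<forall>t\<ge>a. norm (\<eta> t) \<le> R2" "\<forall>t\<ge>a. norm (force (\<xi> t)) \<le> R3"
    using \<xi>_norm_bounded \<eta>_norm_bounded force_bounded by blast
  have "norm ((1/3) *\<^sub>R \<eta> t + (2/9) *\<^sub>R \<xi> t + force (\<xi> t)) \<le> R2 / 3 + 2 * R1 / 9 + R3" if "t \<ge> a" for t
    using that R by (intro norm_triangle_mono) (auto simp: field_simps)
  then show ?thesis by blast
qed

text \<open>\<open>E\<close> is nondecreasing and bounded, hence converges, and its derivative is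
  |\<eta>|^2 / 3; \<open>barbalat\<close> makes that tend to 0.\<close>

lemma \<eta>_tendsto: "(\<eta> \<longlongrightarrow> 0) at_top"
proof -
  obtain l where l: "(E \<longlongrightarrow> l) at_top"
    using convergent_mono_at_top[of a E] E_mono E_bounded by blast
  obtain R where R: "\<And>t. t \<ge> a \<Longrightarrow> norm (\<eta> t) \<le> R" using \<eta>_norm_bounded by blast
  obtain R' where R': "\<And>t. t \<ge> a \<Longrightarrow> norm ((1/3) *\<^sub>R \<eta> t + (2/9) *\<^sub>R \<xi> t + force (\<xi> t)) \<le> R'"
    using \<eta>_deriv_bounded by blast
  let ?g = "\<lambda>t. (1/3) *\<^sub>R \<eta> t + (2/9) *\<^sub>R \<xi> t + force (\<xi> t)"
  have "uniformly_continuous_on {a..} (\<lambda>t. (norm (\<eta> t))\<^sup>2 / 3)"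
  proof (rule bounded_deriv_uniformly_continuous)
    fix t assume t: "t \<ge> a"
    show "((\<lambda>t. (norm (\<eta> t))\<^sup>2 / 3) has_vector_derivative (2/3) * (\<eta> t \<bullet> ?g t)) (at t)"
      using DERIV_cdivide[OF inner_deriv[OF d\<eta>[OF t] d\<eta>[OF t]], of 3]
      unfolding has_real_derivative_iff_has_vector_derivative[symmetric] power2_norm_eq_inner
      by (rule DERIV_cong) (simp add: inner_commute)
    have "\<bar>\<eta> t \<bullet> ?g t\<bar> \<le> norm (\<eta> t) * norm (?g t)" by (rule Cauchy_Schwarz_ineq2)
    also have "\<dots> \<le> R * R'"
      using R[OF t] R'[OF t] by (intro mult_mono) (auto intro: order_trans[OF norm_ge_zero])
    finally have b: "\<bar>\<eta> t \<bullet> ?g t\<bar> \<le> R * R'" .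
    then show "norm ((2/3) * (\<eta> t \<bullet> ?g t)) \<le> R * R'"
      unfolding real_norm_def abs_mult using abs_ge_zero[of "\<eta> t \<bullet> ?g t"] by simp
  qed
  with E_deriv[unfolded has_real_derivative_iff_has_vector_derivative] l
  have "((\<lambda>t. (norm (\<eta> t))\<^sup>2 / 3) \<longlongrightarrow> 0) at_top"
    by (rule barbalat)
  then have "((\<lambda>t. sqrt (3 * ((norm (\<eta> t))\<^sup>2 / 3))) \<longlongrightarrow> sqrt (3 * 0)) at_top"
    by (intro tendsto_intros)
  then show ?thesis by (simp add: tendsto_norm_zero_iff)
qed

text \<open>A second use of \<open>barbalat\<close>, now for \<eta>: its derivative tends to 0 as
  well.\<close>

lemma critical_tendsto: "((\<lambda>t. (2/9) *\<^sub>R \<xi> t + force (\<xi> t)) \<longlongrightarrow> 0) at_top"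
proof -
  have "uniformly_continuous_on {a..} (\<lambda>t. (1/3) *\<^sub>R \<eta> t + (2/9) *\<^sub>R \<xi> t + force (\<xi> t))"
    using bounded_deriv_uniformly_continuous[OF d\<eta>] \<eta>_deriv_bounded
    by (intro uniformly_continuous_on_add uniformly_continuous_on_cmul \<xi>_uc force_uc) blast
  from barbalat[OF d\<eta> \<eta>_tendsto this]
  have "((\<lambda>t. ((1/3) *\<^sub>R \<eta> t + (2/9) *\<^sub>R \<xi> t + force (\<xi> t)) - (1/3) *\<^sub>R \<eta> t) \<longlongrightarrow> 0 - (1/3) *\<^sub>R 0) at_top"
    by (intro tendsto_diff tendsto_scaleR tendsto_const \<eta>_tendsto) auto
  then show ?thesis by (simp add: algebra_simps)
qed

lemma subsequence_limit:
  assumes s: "\<And>n. s n \<ge> a" "filterlim s at_top sequentially"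
  obtains r X where "strict_mono r" "(\<lambda>n. \<xi> (s (r n))) \<longlonglongrightarrow> X" "collisionless X" "force X = - (2/9) *\<^sub>R X"
proof -
  obtain K where K: "compact K" "\<And>X. X \<in> K \<Longrightarrow> collisionless X" "\<And>t. t \<ge> a \<Longrightarrow> \<xi> t \<in> K"
    using orbit_in_compact by blast
  have "\<forall>n. \<xi> (s n) \<in> K" using K(3) s(1) by blast
  then obtain X r where X: "X \<in> K" "strict_mono r" "((\<lambda>n. \<xi> (s n)) \<circ> r) \<longlonglongrightarrow> X"
    by (rule seq_compactE[OF compact_imp_seq_compact[OF K(1)]])
  have lim: "(\<lambda>n. \<xi> (s (r n))) \<longlonglongrightarrow> X" using X(3) by (simp add: o_def)
  have cl: "collisionless X" using K(2) X(1) by blast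
  have "filterlim (\<lambda>n. s (r n)) at_top sequentially"
    using filterlim_compose[OF s(2) filterlim_subseq[OF X(2)]] .
  from filterlim_compose[OF critical_tendsto this]
  have "(\<lambda>n. (2/9) *\<^sub>R \<xi> (s (r n)) + force (\<xi> (s (r n)))) \<longlonglongrightarrow> 0" .
  moreover have "(\<lambda>n. (2/9) *\<^sub>R \<xi> (s (r n)) + force (\<xi> (s (r n)))) \<longlonglongrightarrow> (2/9) *\<^sub>R X + force X"
    by (intro tendsto_intros lim isCont_tendsto_compose[OF isCont_force[OF cl]])
  ultimately have "(2/9) *\<^sub>R X + force X = 0" by (rule LIMSEQ_unique[rotated])
  then have "force X = - (2/9) *\<^sub>R X" by (simp add: add_eq_0_iff2)
  then show ?thesis using that X(2) lim cl by blast
qed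

text \<open>Violations at arbitrarily late times with arbitrarily small volume would accumulate at a
  degenerate critical matrix with trace at most 2/3, against the strict inequality of
  \<open>degenerate_critical\<close>.\<close>

lemma near_degenerate:
  obtains \<epsilon> b where "\<epsilon> > 0" "b \<ge> a" "\<And>t. t \<ge> b \<Longrightarrow> (det (\<xi> t))\<^sup>2 < \<epsilon> \<Longrightarrow> 2/3 \<le> trace (stiffness (\<xi> t))"
proof -
  have "\<exists>n::nat. \<forall>t\<ge>max a (real n). (det (\<xi> t))\<^sup>2 < 1 / (real n + 1) \<longrightarrow> 2/3 \<le> trace (stiffness (\<xi> t))"
  proof (rule ccontr)
    assume "\<not> ?thesis"
    then obtain s where s: "\<And>n::nat. s n \<ge> max a (real n)" "\<And>n. (det (\<xi> (s n)))\<^sup>2 < 1 / (real n + 1)"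
      "\<And>n. trace (stiffness (\<xi> (s n))) < 2/3"
      unfolding not_ex not_all not_imp not_le by metis
    have sa: "s n \<ge> a" for n using s(1)[of n] by simp
    have lim: "filterlim s at_top sequentially"
      by (rule filterlim_at_top_mono[OF filterlim_real_sequentially]) (use s(1) in auto)
    obtain r X where X: "strict_mono r" "(\<lambda>n. \<xi> (s (r n))) \<longlonglongrightarrow> X" "collisionless X" "force X = - (2/9) *\<^sub>R X"
      using subsequence_limit[OF sa lim] by blast
    have "(\<lambda>n. (det (\<xi> (s (r n))))\<^sup>2) \<longlonglongrightarrow> 0"
    proof (rule tendsto_sandwich[OF _ _ tendsto_const])
      show "\<forall>\<^sub>F n in sequentially. (det (\<xi> (s (r n))))\<^sup>2 \<le> inverse (real (Suc n))"
      proof (intro always_eventually allI)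
        fix n
        have "(det (\<xi> (s (r n))))\<^sup>2 < 1 / (real (r n) + 1)" by (rule s(2))
        also have "\<dots> \<le> inverse (real (Suc n))"
          using seq_suble[OF X(1), of n] by (simp add: field_simps)
        finally show "(det (\<xi> (s (r n))))\<^sup>2 \<le> inverse (real (Suc n))" by simp
      qed
    qed (use LIMSEQ_inverse_real_of_nat in auto)
    moreover have "(\<lambda>n. (det (\<xi> (s (r n))))\<^sup>2) \<longlonglongrightarrow> (det X)\<^sup>2"
      by (intro tendsto_power tendsto_det X)
    ultimately have "(det X)\<^sup>2 = 0" by (rule LIMSEQ_unique[rotated])
    then have "2/3 < trace (stiffness X)" using degenerate_critical X by simp
    moreover have "trace (stiffness X) \<le> 2/3"
    proof (rule tendsto_upperbound)
      show "(\<lambda>n. trace (stiffness (\<xi> (s (r n))))) \<longlonglongrightarrow> trace (stiffness X)"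
        using isCont_tendsto_compose[OF continuous_trace_stiffness[OF X(3)] X(2)] .
    qed (use s(3) in \<open>auto intro!: always_eventually less_imp_le\<close>)
    ultimately show False by simp
  qed
  then obtain n :: nat where "\<And>t. t \<ge> max a (real n) \<Longrightarrow> (det (\<xi> t))\<^sup>2 < 1 / (real n + 1) \<Longrightarrow> 2/3 \<le> trace (stiffness (\<xi> t))"
    by blast
  then show ?thesis by (intro that[of "1 / (real n + 1)" "max a (real n)"]) auto
qed

lemma det_square_deriv: "t \<ge> a \<Longrightarrow> ((\<lambda>t. (det (\<xi> t))\<^sup>2) has_real_derivative 2 * y t * (det (\<xi> t))\<^sup>2) (at t)"
proof -
  assume t: "t \<ge> a"
  have "((\<lambda>t. det (\<xi> t)) has_real_derivative det (\<xi> t) * y t) (at t)"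
    using det_has_derivative[OF d\<xi>[OF t]] nondeg[OF t] by (simp add: y_def)
  from DERIV_power[OF this, of 2] show ?thesis
    by (rule DERIV_cong) (simp add: power2_eq_square)
qed

text \<open>If the volume were shrinking close to a degenerate configuration, then \<open>y' \<le> y / 3 < 0\<close>
  would persist and drive \<open>y\<close> below its lower bound.\<close>

lemma volume_growth_near_degenerate:
  assumes b: "b \<ge> a" and \<epsilon>: "\<And>t. t \<ge> b \<Longrightarrow> (det (\<xi> t))\<^sup>2 < \<epsilon> \<Longrightarrow> 2/3 \<le> trace (stiffness (\<xi> t))"
    and t: "t \<ge> b" "(det (\<xi> t))\<^sup>2 < \<epsilon>"
  shows "0 \<le> y t"
proof (rule ccontr)
  assume "\<not> 0 \<le> y t"
  then have neg: "y t < 0" by simp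
  have cont: "continuous_on {t..u} y" for u
    by (intro continuous_at_imp_continuous_on ballI) (use b t in \<open>auto intro!: DERIV_isCont[OF y_deriv]\<close>)
  \<comment> \<open>As long as \<open>y\<close> is negative the volume shrinks, so the orbit stays
    in the region where the trace bound holds.\<close>
  have small: "(det (\<xi> s))\<^sup>2 < \<epsilon>" if s: "s \<ge> t" and n: "\<And>r. t < r \<Longrightarrow> r < s \<Longrightarrow> y r < 0" for s
  proof (cases "s = t")
    case False
    obtain z where z: "t < z" "z < s" "(det (\<xi> s))\<^sup>2 - (det (\<xi> t))\<^sup>2 = (s - t) * (2 * y z * (det (\<xi> z))\<^sup>2)"
      using MVT2[of t s "\<lambda>t. (det (\<xi> t))\<^sup>2" "\<lambda>t. 2 * y t * (det (\<xi> t))\<^sup>2"] det_square_deriv s False b t by force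
    have "(s - t) * (2 * y z * (det (\<xi> z))\<^sup>2) \<le> 0"
      using n[OF z(1,2)] s by (intro mult_nonneg_nonpos mult_nonpos_nonneg) auto
    with z(3) t(2) show ?thesis by linarith
  qed (use t in simp)
  have dneg: "y r / 3 - (norm (Y r))\<^sup>2 + 2/3 - trace (stiffness (\<xi> r)) \<le> y r / 3"
    if r: "r \<ge> t" and "\<And>q. t < q \<Longrightarrow> q < r \<Longrightarrow> y q < 0" for r
  proof -
    have "2/3 \<le> trace (stiffness (\<xi> r))" using \<epsilon>[of r] small[OF that] r t(1) by simp
    moreover have "0 \<le> (norm (Y r))\<^sup>2" by simp
    ultimately show ?thesis by argo
  qed
  \<comment> \<open>Continuation: before the first time \<open>c\<close> with
    \<open>0 \<le> y c\<close> the derivative of \<open>y\<close> is at most y/3 < 0, so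
    \<open>y\<close> cannot have risen to 0.\<close>
  have yneg: "y s < 0" if s: "s \<ge> t" for s
  proof (rule ccontr)
    assume "\<not> y s < 0"
    define S where "S = {r \<in> {t..s}. 0 \<le> y r}"
    have "closed S" unfolding S_def
      using continuous_on_closed_Collect_le[OF continuous_on_const cont[of s]] by simp
    moreover have S: "S \<noteq> {}" "bdd_below S" using s \<open>\<not> y s < 0\<close> by (auto simp: S_def)
    ultimately have "Inf S \<in> S" by (metis closed_contains_Inf)
    define c where "c = Inf S"
    have c: "t < c" "0 \<le> y c" using \<open>Inf S \<in> S\<close> neg by (auto simp: S_def c_def order_le_less)
    have before: "y r < 0" if "t < r" "r < c" for r
    proof (rule ccontr)
      assume "\<not> y r < 0"
      then have "r \<in> S" using that \<open>Inf S \<in> S\<close> by (auto simp: S_def c_def)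
      then have "c \<le> r" unfolding c_def by (rule cInf_lower[OF _ S(2)])
      with that show False by simp
    qed
    obtain z where z: "t < z" "z < c" "y c - y t = (c - t) * (y z / 3 - (norm (Y z))\<^sup>2 + 2/3 - trace (stiffness (\<xi> z)))"
      using MVT2[of t c y "\<lambda>r. y r / 3 - (norm (Y r))\<^sup>2 + 2/3 - trace (stiffness (\<xi> r))"] y_deriv c(1) b t by force
    have "y z / 3 - (norm (Y z))\<^sup>2 + 2/3 - trace (stiffness (\<xi> z)) \<le> y z / 3"
      by (rule dneg) (use before z in auto)
    also have "\<dots> \<le> 0" using before[of z] z by simp
    finally have "y c - y t \<le> 0" unfolding z(3) using c by (intro mult_nonneg_nonpos) auto
    with c neg show False by simp
  qed
  have ymono: "y s \<le> y t" if s: "s \<ge> t" for s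
  proof (rule barrier[of t y, OF y_deriv _ order_refl s])
    fix r assume "r \<ge> t"
    then show "r \<ge> a" using b t by simp
    show "y r / 3 - (norm (Y r))\<^sup>2 + 2/3 - trace (stiffness (\<xi> r)) \<le> 0"
      using dneg[of r] yneg \<open>r \<ge> t\<close> by (smt (verit) divide_nonpos_pos)
  qed
  \<comment> \<open>The derivative of \<open>y\<close> is at most \<open>y t / 3\<close> from
    \<open>t\<close> on, so during this time \<open>y\<close> drops by at least 1, to a value below
    -1.\<close>
  define s where "s = t + 3 / - y t"
  have s: "s > t" using neg by (simp add: s_def divide_neg_neg)
  obtain z where z: "t < z" "z < s" "y s - y t = (s - t) * (y z / 3 - (norm (Y z))\<^sup>2 + 2/3 - trace (stiffness (\<xi> z)))"
    using MVT2[of t s y "\<lambda>r. y r / 3 - (norm (Y r))\<^sup>2 + 2/3 - trace (stiffness (\<xi> r))"] y_deriv s b t by force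
  have "y z / 3 - (norm (Y z))\<^sup>2 + 2/3 - trace (stiffness (\<xi> z)) \<le> y z / 3"
    by (rule dneg) (use yneg z in auto)
  also have "\<dots> \<le> y t / 3" using ymono[of z] z by simp
  finally have "y s - y t \<le> (s - t) * (y t / 3)"
    unfolding z(3) using s by (intro mult_left_mono) auto
  also have "\<dots> = -1" using neg by (simp add: s_def)
  finally show False using y_ge[of s] neg s b t by simp
qed

text \<open>Below the level \<open>m\<close> the squared volume has nonnegative derivative, so it
  cannot sink through that level.\<close>

lemma volume_bounded_below: obtains m b where "m > 0" "b \<ge> a" "\<And>t. t \<ge> b \<Longrightarrow> m \<le> (det (\<xi> t))\<^sup>2"
proof -
  obtain \<epsilon> b where \<epsilon>: "\<epsilon> > 0" "b \<ge> a" "\<And>t. t \<ge> b \<Longrightarrow> (det (\<xi> t))\<^sup>2 < \<epsilon> \<Longrightarrow> 2/3 \<le> trace (stiffness (\<xi> t))"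
    using near_degenerate by blast
  define m where "m = min \<epsilon> ((det (\<xi> b))\<^sup>2)"
  have "m > 0" using \<epsilon> nondeg[of b] by (simp add: m_def)
  moreover have "m \<le> (det (\<xi> t))\<^sup>2" if t: "t \<ge> b" for t
  proof -
    have "- (det (\<xi> t))\<^sup>2 \<le> - m"
    proof (rule barrier[of b "\<lambda>t. - (det (\<xi> t))\<^sup>2" "\<lambda>t. - (2 * y t * (det (\<xi> t))\<^sup>2)"])
      show "((\<lambda>t. - (det (\<xi> t))\<^sup>2) has_real_derivative - (2 * y t * (det (\<xi> t))\<^sup>2)) (at t)" if "t \<ge> b" for t
        by (rule DERIV_minus[OF det_square_deriv]) (use that \<epsilon> in simp)
      fix t assume "t \<ge> b" "- m < - (det (\<xi> t))\<^sup>2"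
      then have "0 \<le> y t"
        by (intro volume_growth_near_degenerate[OF \<epsilon>(2,3)]) (auto simp: m_def)
      then show "- (2 * y t * (det (\<xi> t))\<^sup>2) \<le> 0" by simp
    qed (use t in \<open>auto simp: m_def\<close>)
    then show ?thesis by simp
  qed
  ultimately show ?thesis using that \<epsilon>(2) by blast
qed

lemma det_sign: "t \<ge> a \<Longrightarrow> sgn (det (\<xi> t)) = sgn (det (\<xi> a))"
proof (rule det_sign_constant)
  show "continuous_on {a..t} \<xi>"
    using \<xi>_uc by (rule uniformly_continuous_imp_continuous[THEN continuous_on_subset]) auto
qed (use nondeg in auto)

theorem limit_points:
  assumes s: "\<And>n. s n \<ge> a" "filterlim s at_top sequentially"
  obtains r X where "strict_mono r" "(\<lambda>n. \<xi> (s (r n))) \<longlonglongrightarrow> X" "collisionless X"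
    "force X = - (2/9) *\<^sub>R X" "det X \<noteq> 0" "sgn (det X) = sgn (det (\<xi> a))"
proof -
  obtain r X where X: "strict_mono r" "(\<lambda>n. \<xi> (s (r n))) \<longlonglongrightarrow> X" "collisionless X" "force X = - (2/9) *\<^sub>R X"
    using subsequence_limit[OF assms] by blast
  obtain m b where m: "m > 0" "b \<ge> a" "\<And>t. t \<ge> b \<Longrightarrow> m \<le> (det (\<xi> t))\<^sup>2"
    using volume_bounded_below by blast
  have D: "(\<lambda>n. det (\<xi> (s (r n)))) \<longlonglongrightarrow> det X" by (intro tendsto_det X)
  have "filterlim (\<lambda>n. s (r n)) at_top sequentially"
    using filterlim_compose[OF s(2) filterlim_subseq[OF X(1)]] .
  then have "\<forall>\<^sub>F n in sequentially. b \<le> s (r n)" by (simp add: filterlim_at_top)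
  then have "\<forall>\<^sub>F n in sequentially. m \<le> (det (\<xi> (s (r n))))\<^sup>2"
    by (rule eventually_mono) (rule m(3))
  then have "m \<le> (det X)\<^sup>2"
    by (intro tendsto_lowerbound[OF tendsto_power[OF D]]) auto
  then have nz: "det X \<noteq> 0" using m(1) by auto
  have "(\<lambda>n. sgn (det (\<xi> (s (r n))))) \<longlonglongrightarrow> sgn (det X)" by (rule tendsto_sgn[OF D nz])
  then have "(\<lambda>n. sgn (det (\<xi> a))) \<longlonglongrightarrow> sgn (det X)" using det_sign[OF s(1)] by simp
  then have "sgn (det X) = sgn (det (\<xi> a))" by (simp add: LIMSEQ_const_iff)
  then show ?thesis using that X nz by blast
qed

end

section \<open>Critical configurations of four bodies\<close>

text \<open>Writing r = (r + s) - s reduces the claim to s / (r + s)^3 < 1 / s^2.\<close>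

lemma inverse_square_gap:
  fixes s r :: real
  assumes "0 < s" "0 < r"
  shows "1 / (r + s)\<^sup>2 - 1 / s\<^sup>2 < r / (r + s) ^ 3"
proof -
  have "s / (r + s) ^ 3 < s / s ^ 3"
    using assms by (intro divide_strict_left_mono power_strict_mono) auto
  also have "s / s ^ 3 = 1 / s\<^sup>2" using assms by (simp add: power2_eq_square power3_eq_cube)
  also have "s / (r + s) ^ 3 = 1 / (r + s)\<^sup>2 - r / (r + s) ^ 3"
  proof -
    have "1 / (r + s)\<^sup>2 = (r + s) / (r + s) ^ 3" using assms by (simp add: power2_eq_square power3_eq_cube)
    then show ?thesis by (simp add: add_divide_distrib)
  qed
  finally show ?thesis by simp
qed

text \<open>The Perron-Frobenius argument: in terms of the three gaps the linearization has negative
  off-diagonal entries and fixes the positive direction with eigenvalue \<open>l\<close>,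
  so each diagonal entry exceeds \<open>l\<close>.\<close>

lemma collinear_gap:
  fixes r :: real
  assumes r: "r > 0" and eq: "l * r = (m1 + m2) / r\<^sup>2 + (m3 / (r + s)\<^sup>2 - m3 / s\<^sup>2) + (m4 / (r + t)\<^sup>2 - m4 / t\<^sup>2)"
    and pos: "m3 > 0" "m4 > 0" "s > 0" "t > 0"
  shows "l < (m1 + m2) / r ^ 3 + m3 / (r + s) ^ 3 + m4 / (r + t) ^ 3"
proof -
  have "m3 / (r + s)\<^sup>2 - m3 / s\<^sup>2 < r * (m3 / (r + s) ^ 3)"
    using mult_strict_left_mono[OF inverse_square_gap[OF pos(3) r] pos(1)] by (simp add: right_diff_distrib mult_ac)
  moreover have "m4 / (r + t)\<^sup>2 - m4 / t\<^sup>2 < r * (m4 / (r + t) ^ 3)"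
    using mult_strict_left_mono[OF inverse_square_gap[OF pos(4) r] pos(2)] by (simp add: right_diff_distrib mult_ac)
  moreover have "(m1 + m2) / r\<^sup>2 = r * ((m1 + m2) / r ^ 3)"
    using r by (simp add: power2_eq_square power3_eq_cube)
  ultimately have "l * r < r * ((m1 + m2) / r ^ 3) + r * (m3 / (r + s) ^ 3) + r * (m4 / (r + t) ^ 3)"
    using eq by linarith
  then have "r * l < r * ((m1 + m2) / r ^ 3 + m3 / (r + s) ^ 3 + m4 / (r + t) ^ 3)"
    by (simp only: distrib_left mult.commute[of l])
  then show ?thesis using r by (simp only: mult_less_cancel_left_pos)
qed

text \<open>Subtracting the equations of neighbouring bodies gives one equation for each of the
  three gaps. In the sum of the three estimates every pair receives both of its masses, which makes
  the right-hand side the trace of the stiffness.\<close>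

lemma collinear_sum:
  fixes x1 x2 x3 x4 m1 m2 m3 m4 l :: real
  assumes o: "x1 < x2" "x2 < x3" "x3 < x4" and m: "m1 > 0" "m2 > 0" "m3 > 0" "m4 > 0"
    and e1: "l * x1 = - (m2 / (x2 - x1)\<^sup>2) - m3 / (x3 - x1)\<^sup>2 - m4 / (x4 - x1)\<^sup>2"
    and e2: "l * x2 = m1 / (x2 - x1)\<^sup>2 - m3 / (x3 - x2)\<^sup>2 - m4 / (x4 - x2)\<^sup>2"
    and e3: "l * x3 = m1 / (x3 - x1)\<^sup>2 + m2 / (x3 - x2)\<^sup>2 - m4 / (x4 - x3)\<^sup>2"
    and e4: "l * x4 = m1 / (x4 - x1)\<^sup>2 + m2 / (x4 - x2)\<^sup>2 + m3 / (x4 - x3)\<^sup>2"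
  shows "3 * l < (m1 + m2) / (x2 - x1) ^ 3 + (m1 + m3) / (x3 - x1) ^ 3 + (m1 + m4) / (x4 - x1) ^ 3
    + (m2 + m3) / (x3 - x2) ^ 3 + (m2 + m4) / (x4 - x2) ^ 3 + (m3 + m4) / (x4 - x3) ^ 3"
proof -
  have "l < (m1 + m2) / (x2 - x1) ^ 3 + m3 / ((x2 - x1) + (x3 - x2)) ^ 3 + m4 / ((x2 - x1) + (x4 - x2)) ^ 3"
    using o m e1 e2 by (intro collinear_gap) (simp_all add: right_diff_distrib add_divide_distrib)
  moreover have "l < (m2 + m3) / (x3 - x2) ^ 3 + m1 / ((x3 - x2) + (x2 - x1)) ^ 3 + m4 / ((x3 - x2) + (x4 - x3)) ^ 3"
    using o m e3 e2 by (intro collinear_gap) (simp_all add: right_diff_distrib add_divide_distrib)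
  moreover have "l < (m3 + m4) / (x4 - x3) ^ 3 + m1 / ((x4 - x3) + (x3 - x1)) ^ 3 + m2 / ((x4 - x3) + (x3 - x2)) ^ 3"
    using o m e3 e4 by (intro collinear_gap) (simp_all add: right_diff_distrib add_divide_distrib)
  ultimately show ?thesis by (simp add: add_divide_distrib)
qed

lemma sort_four:
  fixes x :: "4 \<Rightarrow> real"
  assumes "inj x"
  obtains i1 i2 i3 i4 where "x i1 < x i2" "x i2 < x i3" "x i3 < x i4" "UNIV = {i1, i2, i3, i4}"
proof -
  define L where "L = sorted_list_of_set (range x)"
  have L: "sorted L" "distinct L" "set L = range x" "length L = 4"
    using assms by (auto simp: L_def card_image)
  from L(4) obtain y1 y2 y3 y4 where y: "L = [y1, y2, y3, y4]"
    by (auto simp: numeral_eq_Suc length_Suc_conv)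
  have "y1 \<in> range x" "y2 \<in> range x" "y3 \<in> range x" "y4 \<in> range x" using L(3) y by auto
  then obtain i1 i2 i3 i4 where i: "y1 = x i1" "y2 = x i2" "y3 = x i3" "y4 = x i4" by auto
  have "i \<in> {i1, i2, i3, i4}" for i
  proof -
    have "x i \<in> {x i1, x i2, x i3, x i4}" using L(3) y i by auto
    with assms show ?thesis by (simp add: inj_eq)
  qed
  moreover have "x i1 < x i2" "x i2 < x i3" "x i3 < x i4" using L(1,2) y i by auto
  ultimately show ?thesis using that by blast
qed

text \<open>The map taking a matrix \<open>X\<close> to the configuration \<open>X b\<^sub>i\<close> identifies the \<open>3 \<times> 3\<close>
  matrices, with the Frobenius norm, with the centered configurations, with the mass norm. The columns
  of \<open>X\<close> are normalized Jacobi vectors.\<close>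

locale mass_frame =
  fixes m :: "4 \<Rightarrow> real" and b :: "4 \<Rightarrow> real ^ 3" and M :: real
  assumes m_pos: "m i > 0"
    and M_def: "M = sum m UNIV"
    and gram: "b i \<bullet> b j = (if i = j then 1 / m i else 0) - 1 / M"
    and frame: "(\<Sum>i\<in>UNIV. m i * (b i \<bullet> u) * (b i \<bullet> v)) = u \<bullet> v"
begin

definition "pairs = {(i, j). i < (j :: 4)}"
definition "edge p = b (fst p) - b (snd p)"
definition "weight p = m (fst p) * m (snd p)"

lemma M_pos: "M > 0"
  unfolding M_def by (rule sum_pos) (auto simp: m_pos)

text \<open>Against edges the vectors \<open>m k *\<^sub>R b k\<close> act as a dual basis, so
  testing the stiffness with them isolates single pairs.\<close>

lemma dual: "(m k *\<^sub>R b k) \<bullet> (b i - b j) = (if k = i then 1 else 0) - (if k = j then 1 else 0)"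
  using m_pos[of k] by (auto simp: inner_diff_right gram right_diff_distrib)

lemma edge_norm: "i \<noteq> j \<Longrightarrow> (norm (b i - b j))\<^sup>2 = 1 / m i + 1 / m j"
  by (simp add: power2_norm_eq_inner inner_diff_left inner_diff_right gram)

lemma b_inj: "i \<noteq> j \<Longrightarrow> b i \<noteq> b j"
  using edge_norm[of i j] m_pos[of i] m_pos[of j] by (auto simp: add_pos_pos less_imp_neq)

lemma sum_b: "(\<Sum>i\<in>UNIV. m i *\<^sub>R b i) = 0"
proof -
  have "(\<Sum>i\<in>UNIV. m i *\<^sub>R b i) \<bullet> b j = 0" for j
  proof -
    have "(\<Sum>i\<in>UNIV. m i *\<^sub>R b i) \<bullet> b j = (\<Sum>i\<in>UNIV. (if i = j then 1 else 0) - m i / M)"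
      unfolding inner_sum_left inner_scaleR_left gram using m_pos[THEN less_imp_neq]
      by (intro sum.cong) (auto simp: right_diff_distrib)
    also have "\<dots> = 0" using M_pos by (simp add: sum_subtractf sum_divide_distrib[symmetric] M_def[symmetric])
    finally show ?thesis .
  qed
  moreover have "z \<bullet> (\<Sum>i\<in>UNIV. m i *\<^sub>R b i) = (\<Sum>i\<in>UNIV. m i * (z \<bullet> b i))" for z
    by (simp add: inner_sum_right)
  ultimately have "(\<Sum>i\<in>UNIV. m i *\<^sub>R b i) \<bullet> (\<Sum>i\<in>UNIV. m i *\<^sub>R b i) = 0" by simp
  then show ?thesis by simp
qed

lemma frame_expand: "v = (\<Sum>i\<in>UNIV. (m i * (b i \<bullet> v)) *\<^sub>R b i)"
  by (rule vector_eq_rdot[THEN iffD1]) (simp add: inner_sum_left frame)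

sublocale pair_potential pairs edge weight
proof
  show "finite pairs" by simp
  show "weight p > 0" for p by (simp add: weight_def m_pos)
  show "edge p \<noteq> 0" if "p \<in> pairs" for p using that b_inj by (auto simp: pairs_def edge_def)
qed

lemma sum_pairs:
  fixes f :: "4 \<Rightarrow> 4 \<Rightarrow> 'a::comm_monoid_add"
  assumes "\<And>i. f i i = 0"
  shows "(\<Sum>i\<in>UNIV. \<Sum>j\<in>UNIV. f i j) = (\<Sum>p\<in>pairs. f (fst p) (snd p) + f (snd p) (fst p))"
proof -
  let ?Q = "{(i, j). j < (i :: 4)}"
  have "(\<Sum>i\<in>UNIV. \<Sum>j\<in>UNIV. f i j) = (\<Sum>p\<in>UNIV. f (fst p) (snd p))"
    by (simp add: sum.cartesian_product UNIV_Times_UNIV split_beta)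
  also have "\<dots> = (\<Sum>p\<in>pairs \<union> ?Q. f (fst p) (snd p))"
  proof (rule sum.mono_neutral_right)
    show "\<forall>p\<in>UNIV - (pairs \<union> ?Q). f (fst p) (snd p) = 0"
    proof
      fix p assume "p \<in> UNIV - (pairs \<union> ?Q)"
      then have "fst p = snd p"
        using less_linear[of "fst p" "snd p"] by (auto simp: pairs_def case_prod_beta)
      then show "f (fst p) (snd p) = 0" using assms by simp
    qed
  qed auto
  also have "\<dots> = (\<Sum>p\<in>pairs. f (fst p) (snd p)) + (\<Sum>p\<in>?Q. f (fst p) (snd p))"
    by (rule sum.union_disjoint) (auto simp: pairs_def)
  also have "(\<Sum>p\<in>?Q. f (fst p) (snd p)) = (\<Sum>p\<in>pairs. f (snd p) (fst p))"
    by (rule sum.reindex_bij_witness[of _ "\<lambda>p. (snd p, fst p)" "\<lambda>p. (snd p, fst p)"]) (auto simp: pairs_def)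
  finally show ?thesis by (simp add: sum.distrib)
qed

lemma collisionless_iff: "collisionless X \<longleftrightarrow> (\<forall>i j. i \<noteq> j \<longrightarrow> X *v b i \<noteq> X *v b j)"
proof -
  have "collisionless X \<longleftrightarrow> (\<forall>i j. i < j \<longrightarrow> X *v b i \<noteq> X *v b j)"
  proof -
    have "(\<forall>p\<in>pairs. Q p) \<longleftrightarrow> (\<forall>i j. i < j \<longrightarrow> Q (i, j))" for Q by (auto simp: pairs_def)
    then show ?thesis unfolding collisionless_def by (simp add: edge_def matrix_vector_mult_diff_distrib)
  qed
  also have "\<dots> \<longleftrightarrow> (\<forall>i j. i \<noteq> j \<longrightarrow> X *v b i \<noteq> X *v b j)"
    by (metis neq_iff)
  finally show ?thesis .
qed

section \<open>Mutual distances and the moment of inertia\<close>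

definition dst :: "real ^ 3 ^ 3 \<Rightarrow> 4 \<Rightarrow> 4 \<Rightarrow> real" where
  "dst X i j = norm (X *v b i - X *v b j)"

lemma dst_sym: "dst X i j = dst X j i" by (simp add: dst_def norm_minus_commute)
lemma dst_self [simp]: "dst X i i = 0" by (simp add: dst_def)

lemma stiffness_form:
  "u \<bullet> (stiffness X *v v) = (\<Sum>p\<in>pairs. weight p / dst X (fst p) (snd p) ^ 3 * (edge p \<bullet> u) * (edge p \<bullet> v))"
proof -
  interpret bl: bounded_linear "\<lambda>A :: real^3^3. A *v v"
    by (rule bounded_bilinear.bounded_linear_left[OF bounded_bilinear_mv])
  show ?thesis
    by (simp add: stiffness_def bl.sum bl.scaleR outer_vec inner_sum_right dst_def edge_def
        matrix_vector_mult_diff_distrib inner_commute mult_ac)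
qed

lemma stiffness_sym: "u \<bullet> (stiffness X *v v) = v \<bullet> (stiffness X *v u)"
  unfolding stiffness_form by (simp add: mult_ac)

lemma pot_dst: "pot X = (\<Sum>p\<in>pairs. weight p / dst X (fst p) (snd p))"
  by (simp add: pot_def dst_def edge_def matrix_vector_mult_diff_distrib)

lemma trace_stiffness_dst:
  "trace (stiffness X) = (\<Sum>p\<in>pairs. (m (fst p) + m (snd p)) / dst X (fst p) (snd p) ^ 3)"
  unfolding trace_stiffness
proof (rule sum.cong)
  fix p assume "p \<in> pairs"
  then have "(norm (edge p))\<^sup>2 = 1 / m (fst p) + 1 / m (snd p)"
    using edge_norm[of "fst p" "snd p"] by (auto simp: pairs_def edge_def)
  then have "weight p * (norm (edge p))\<^sup>2 = m (fst p) + m (snd p)"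
    using m_pos[of "fst p"] m_pos[of "snd p"] by (simp add: weight_def field_simps)
  then show "weight p / norm (X *v edge p) ^ 3 * (norm (edge p))\<^sup>2
      = (m (fst p) + m (snd p)) / dst X (fst p) (snd p) ^ 3"
    by (simp add: dst_def edge_def matrix_vector_mult_diff_distrib)
qed simp

lemma norm_frame: "(norm (X :: real ^ 3 ^ 3))\<^sup>2 = (\<Sum>i\<in>UNIV. m i * (norm (X *v b i))\<^sup>2)"
proof -
  have "(\<Sum>i\<in>UNIV. m i * (norm (X *v b i))\<^sup>2) = (\<Sum>k\<in>UNIV. \<Sum>i\<in>UNIV. m i * (b i \<bullet> (X $ k)) * (b i \<bullet> (X $ k)))"
    by (subst sum.swap) (simp add: power2_norm_eq_inner inner_vec_def[of "X *v b _"] matrix_vector_mul_component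
        inner_commute sum_distrib_left mult_ac)
  also have "\<dots> = (norm X)\<^sup>2"
    unfolding frame by (simp add: power2_norm_eq_inner inner_vec_def)
  finally show ?thesis ..
qed

lemma sum_mv_b: "(\<Sum>i\<in>UNIV. m i *\<^sub>R (X *v b i)) = 0"
proof -
  have "(\<Sum>i\<in>UNIV. m i *\<^sub>R (X *v b i)) = X *v (\<Sum>i\<in>UNIV. m i *\<^sub>R b i)"
    by (simp add: matrix_vector_mult_scaleR linear_sum[OF matrix_vector_mul_linear])
  then show ?thesis by (simp add: sum_b)
qed

text \<open>Leibniz's identity. It is used with the masses, where the last term vanishes by
  centering, and with weights of sum zero, where the middle term vanishes.\<close>

lemma weighted_square_sum:
  fixes q :: "4 \<Rightarrow> real ^ 3"
  shows "(\<Sum>i\<in>UNIV. \<Sum>j\<in>UNIV. c i * c j * (norm (q i - q j))\<^sup>2)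
    = 2 * sum c UNIV * (\<Sum>i\<in>UNIV. c i * (norm (q i))\<^sup>2) - 2 * (norm (\<Sum>i\<in>UNIV. c i *\<^sub>R q i))\<^sup>2"
proof -
  have "(\<Sum>i\<in>UNIV. \<Sum>j\<in>UNIV. c i * c j * (norm (q i - q j))\<^sup>2)
     = (\<Sum>i\<in>UNIV. \<Sum>j\<in>UNIV. c j * (c i * (norm (q i))\<^sup>2) + c i * (c j * (norm (q j))\<^sup>2) - 2 * (c i * (c j * (q i \<bullet> q j))))"
    by (intro sum.cong refl) (simp add: power2_norm_eq_inner inner_diff_left inner_diff_right inner_commute algebra_simps)
  also have "\<dots> = sum c UNIV * (\<Sum>i\<in>UNIV. c i * (norm (q i))\<^sup>2) + sum c UNIV * (\<Sum>i\<in>UNIV. c i * (norm (q i))\<^sup>2)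
     - 2 * (\<Sum>i\<in>UNIV. \<Sum>j\<in>UNIV. c i * (c j * (q i \<bullet> q j)))"
    by (simp only: sum_subtractf sum.distrib sum_distrib_left[symmetric] sum_distrib_right[symmetric])
  also have "(\<Sum>i\<in>UNIV. \<Sum>j\<in>UNIV. c i * (c j * (q i \<bullet> q j))) = (norm (\<Sum>i\<in>UNIV. c i *\<^sub>R q i))\<^sup>2"
    by (simp add: power2_norm_eq_inner inner_sum_left inner_sum_right sum_distrib_left inner_commute mult_ac)
  finally show ?thesis by simp
qed

lemma inertia: "M * (norm X)\<^sup>2 = (\<Sum>p\<in>pairs. weight p * (dst X (fst p) (snd p))\<^sup>2)"
proof -
  have "(\<Sum>i\<in>UNIV. \<Sum>j\<in>UNIV. m i * m j * (dst X i j)\<^sup>2) = 2 * M * (norm X)\<^sup>2"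
    unfolding dst_def weighted_square_sum[of m "\<lambda>i. X *v b i"] sum_mv_b M_def[symmetric] norm_frame by simp
  moreover have "(\<Sum>i\<in>UNIV. \<Sum>j\<in>UNIV. m i * m j * (dst X i j)\<^sup>2) = (\<Sum>p\<in>pairs. 2 * (weight p * (dst X (fst p) (snd p))\<^sup>2))"
    by (subst sum_pairs) (auto intro!: sum.cong simp: weight_def dst_sym[of X "snd _"] mult_ac)
  ultimately show ?thesis by (simp add: sum_distrib_left[symmetric])
qed

text \<open>The weights \<open>m i * (b i \<bullet> n)\<close> have sum zero and represent
  \<open>n\<close> in the frame. Consequently the mutual distances determine the Gram matrix of
  \<open>X\<close>.\<close>

lemma norm_mv_dst:
  "(norm (X *v n))\<^sup>2 = - (1/2) * (\<Sum>i\<in>UNIV. \<Sum>j\<in>UNIV. m i * (b i \<bullet> n) * (m j * (b j \<bullet> n)) * (dst X i j)\<^sup>2)"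
proof -
  define c where "c i = m i * (b i \<bullet> n)" for i
  have "(\<Sum>i\<in>UNIV. c i *\<^sub>R (X *v b i)) = X *v (\<Sum>i\<in>UNIV. c i *\<^sub>R b i)"
    by (simp add: matrix_vector_mult_scaleR linear_sum[OF matrix_vector_mul_linear])
  also have "\<dots> = X *v n" unfolding c_def frame_expand[symmetric] ..
  finally have 1: "(\<Sum>i\<in>UNIV. c i *\<^sub>R (X *v b i)) = X *v n" .
  have "sum c UNIV = (\<Sum>i\<in>UNIV. m i *\<^sub>R b i) \<bullet> n" by (simp add: c_def inner_sum_left)
  then have 2: "sum c UNIV = 0" by (simp add: sum_b)
  show ?thesis
    unfolding c_def[symmetric] dst_def weighted_square_sum[of c "\<lambda>i. X *v b i"] 1 2 by simp
qed

text \<open>For equal distances \<open>norm_mv_dst\<close> becomes d^2/2 times the sum of the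
  squared weights, which vanishes only for \<open>n = 0\<close>.\<close>

lemma regular_nondegenerate:
  assumes d: "d > 0" "\<And>i j. i \<noteq> j \<Longrightarrow> dst X i j = d" and n: "X *v n = 0"
  shows "n = 0"
proof -
  define c where "c i = m i * (b i \<bullet> n)" for i
  have "sum c UNIV = (\<Sum>i\<in>UNIV. m i *\<^sub>R b i) \<bullet> n" by (simp add: c_def inner_sum_left)
  then have 2: "sum c UNIV = 0" by (simp add: sum_b)
  have "0 = (\<Sum>i\<in>UNIV. \<Sum>j\<in>UNIV. c i * c j * (dst X i j)\<^sup>2)"
    using norm_mv_dst[of X n] n unfolding c_def by simp
  also have "\<dots> = (\<Sum>i\<in>UNIV. \<Sum>j\<in>UNIV. c i * c j * d\<^sup>2 - (if j = i then c i * c i * d\<^sup>2 else 0))"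
    using d by (intro sum.cong refl) auto
  also have "\<dots> = sum c UNIV * sum c UNIV * d\<^sup>2 - (\<Sum>i\<in>UNIV. c i * c i) * d\<^sup>2"
    by (simp add: sum_subtractf sum_distrib_right[symmetric] sum_product)
  finally have "(\<Sum>i\<in>UNIV. c i * c i) = 0" using d(1) by (simp add: 2)
  then have "c i = 0" for i by (simp add: sum_nonneg_eq_0_iff)
  then have "(\<Sum>i\<in>UNIV. c i *\<^sub>R b i) = 0" by simp
  then show ?thesis unfolding c_def frame_expand[symmetric] .
qed

end

section \<open>Central configurations\<close>

lemma trace_outer: "trace (outer n n) = (norm n)\<^sup>2"
  by (simp add: trace_def outer_def power2_norm_eq_inner inner_vec_def)

lemma cube_inverse_pos:
  fixes a b c :: real
  assumes "a < b"
  shows "c / \<bar>b - a\<bar> ^ 3 * (b - a) = c / (b - a)\<^sup>2" "c / \<bar>a - b\<bar> ^ 3 * (a - b) = - (c / (b - a)\<^sup>2)"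
proof -
  have *: "c / r ^ 3 * r = c / r\<^sup>2" if "r > 0" for r :: real
    using that by (simp add: power2_eq_square power3_eq_cube)
  show "c / \<bar>b - a\<bar> ^ 3 * (b - a) = c / (b - a)\<^sup>2" using *[of "b - a"] assms by simp
  have "\<bar>a - b\<bar> = b - a" "a - b = - (b - a)" using assms by auto
  then have "c / \<bar>a - b\<bar> ^ 3 * (a - b) = - (c / (b - a) ^ 3 * (b - a))"
    by (simp only: mult_minus_right)
  then show "c / \<bar>a - b\<bar> ^ 3 * (a - b) = - (c / (b - a)\<^sup>2)" using *[of "b - a"] assms by simp
qed

context mass_frame
begin

lemma force_b: "force X *v b i = - (\<Sum>j\<in>UNIV. (m j / dst X i j ^ 3) *\<^sub>R (X *v b i - X *v b j))"
proof -
  interpret bl: bounded_linear "\<lambda>A :: real^3^3. A *v b i"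
    by (rule bounded_bilinear.bounded_linear_left[OF bounded_bilinear_mv])
  define f where "f k l = (if k = i then (m l / dst X k l ^ 3) *\<^sub>R (X *v b k - X *v b l) else 0)" for k l
  have "force X *v b i = - (\<Sum>p\<in>pairs. (weight p / dst X (fst p) (snd p) ^ 3 * (edge p \<bullet> b i)) *\<^sub>R (X *v edge p))"
    by (simp add: force_def bl.neg bl.sum bl.scaleR outer_vec dst_def edge_def matrix_vector_mult_diff_distrib)
  also have "(\<Sum>p\<in>pairs. (weight p / dst X (fst p) (snd p) ^ 3 * (edge p \<bullet> b i)) *\<^sub>R (X *v edge p))
      = (\<Sum>p\<in>pairs. f (fst p) (snd p) + f (snd p) (fst p))"
  proof (rule sum.cong)
    fix p assume p: "p \<in> pairs"
    have m: "m i \<noteq> 0" using m_pos[of i] by simp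
    have "m i * (edge p \<bullet> b i) = (if i = fst p then 1 else 0) - (if i = snd p then 1 else 0)"
      using dual[of i "fst p" "snd p"] by (simp add: edge_def inner_commute)
    then have eb: "edge p \<bullet> b i = ((if i = fst p then 1 else 0) - (if i = snd p then 1 else 0)) / m i"
      using m by (simp add: field_simps)
    show "(weight p / dst X (fst p) (snd p) ^ 3 * (edge p \<bullet> b i)) *\<^sub>R (X *v edge p)
        = f (fst p) (snd p) + f (snd p) (fst p)"
      using p m unfolding eb
      by (auto simp: f_def weight_def pairs_def edge_def matrix_vector_mult_diff_distrib dst_sym
          scaleR_diff_right)
  qed simp
  also have "\<dots> = (\<Sum>k\<in>UNIV. \<Sum>l\<in>UNIV. f k l)" by (rule sum_pairs[symmetric]) (simp add: f_def)
  also have "\<dots> = (\<Sum>k\<in>UNIV. if k = i then \<Sum>l\<in>UNIV. f k l else 0)"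
    by (intro sum.cong refl) (simp add: f_def)
  also have "\<dots> = (\<Sum>l\<in>UNIV. f i l)" by simp
  finally show ?thesis by (simp add: f_def)
qed

text \<open>Central configurations, scaled so that (T - t)^(2/3) X solves Newton's equation: the
  second derivative contributes the factor 2/3 times -1/3.\<close>

definition "critical X \<longleftrightarrow> collisionless X \<and> force X = - (2/9) *\<^sub>R X"

lemma critical_mv: "critical X \<Longrightarrow> X *v (stiffness X *v v) = (2/9) *\<^sub>R (X *v v)"
proof -
  assume "critical X"
  then have "X ** stiffness X = (2/9) *\<^sub>R X" by (simp add: critical_def force_eq_stiffness)
  then have "(X ** stiffness X) *v v = ((2/9) *\<^sub>R X) *v v" by simp
  then show ?thesis by (simp add: matrix_vector_mul_assoc scaleR_matrix_vector_assoc)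
qed

lemma critical_dst_pos: "critical X \<Longrightarrow> i \<noteq> j \<Longrightarrow> dst X i j > 0"
  by (auto simp: critical_def collisionless_iff dst_def)

text \<open>An invertible \<open>X\<close> can be cancelled, so the stiffness is 2/9 times the
  identity. Testing it with \<open>m i *\<^sub>R b i\<close> and \<open>m j *\<^sub>R b j\<close>
  leaves the pair of \<open>i\<close> and \<open>j\<close> alone and compares its inverse cubed
  distance with 2 / (9 M).\<close>

lemma critical_regular:
  assumes X: "critical X" and D: "det X \<noteq> 0" and ij: "i \<noteq> j"
  shows "dst X i j ^ 3 = 9 * M / 2"
proof -
  have B: "stiffness X *v v = (2/9) *\<^sub>R v" for v
  proof -
    have "X *v (stiffness X *v v - (2/9) *\<^sub>R v) = 0"
      by (simp add: matrix_vector_mult_diff_distrib matrix_vector_mult_scaleR critical_mv[OF X])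
    then have "stiffness X *v v - (2/9) *\<^sub>R v = 0"
      by (rule nondegenerate_mv[rotated]) (use D nondegenerate_iff_det[of X] in blast)
    then show ?thesis by simp
  qed
  have *: "dst X i j ^ 3 = 9 * M / 2" if "i < j" for i j
  proof -
    let ?f = "\<lambda>p. weight p / dst X (fst p) (snd p) ^ 3 * (edge p \<bullet> (m i *\<^sub>R b i)) * (edge p \<bullet> (m j *\<^sub>R b j))"
    have e: "edge p \<bullet> (m k *\<^sub>R b k) = (if k = fst p then 1 else 0) - (if k = snd p then 1 else 0)" for p k
      using dual[of k "fst p" "snd p"] by (simp only: edge_def inner_commute)
    have "(m i *\<^sub>R b i) \<bullet> (stiffness X *v (m j *\<^sub>R b j)) = (\<Sum>p\<in>pairs. ?f p)" by (rule stiffness_form)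
    also have "\<dots> = (\<Sum>p\<in>{(i, j)}. ?f p)"
    proof (rule sum.mono_neutral_right)
      show "\<forall>p\<in>pairs - {(i, j)}. ?f p = 0"
        unfolding e using that by (auto simp: pairs_def)
    qed (use that in \<open>auto simp: pairs_def\<close>)
    also have "\<dots> = - (m i * m j / dst X i j ^ 3)"
      unfolding e using that by (simp add: weight_def)
    finally have "(2/9) * (m i * m j * (- 1 / M)) = - (m i * m j / dst X i j ^ 3)"
      unfolding B using less_imp_neq[OF that] by (simp add: gram mult_ac)
    then have "m i * m j * (2 / (9 * M)) = m i * m j * (1 / dst X i j ^ 3)" by (simp add: mult_ac)
    moreover have "m i * m j \<noteq> 0" using m_pos[of i] m_pos[of j] by simp
    ultimately have "2 / (9 * M) = 1 / dst X i j ^ 3" using mult_left_cancel by blast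
    moreover have "dst X i j > 0" using critical_dst_pos[OF X] that by auto
    ultimately show ?thesis using M_pos by (simp add: field_simps)
  qed
  from ij consider "i < j" | "j < i" by (meson neq_iff)
  then show ?thesis using *[of i j] *[of j i] by cases (auto simp: dst_sym)
qed

text \<open>Pair the critical equation with \<open>X\<close>: \<open>pot\<close> has degree -1, and
  \<open>inertia\<close> rewrites the squared norm.\<close>

lemma critical_virial: "critical X \<Longrightarrow> (\<Sum>p\<in>pairs. weight p / dst X (fst p) (snd p))
    = 2 / (9 * M) * (\<Sum>p\<in>pairs. weight p * (dst X (fst p) (snd p))\<^sup>2)"
  using force_inner_self[of X] inertia[of X] M_pos
  by (simp add: critical_def pot_dst power2_norm_eq_inner[symmetric] inertia[symmetric])

text \<open>With \<open>x = r / d\<close> for the side \<open>d\<close> of the critical regular tetrahedron, this is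
  \<open>(x\<^sup>2 - 1) (1 - x\<^sup>-\<^sup>3) \<ge> 0\<close>, summed using the virial identity.\<close>

lemma critical_weight_sum:
  assumes X: "critical X" and ne: "\<not> (\<forall>i j. i \<noteq> j \<longrightarrow> dst X i j ^ 3 = 9 * M / 2)"
  shows "2 / (9 * M) * (\<Sum>p\<in>pairs. weight p) < (\<Sum>p\<in>pairs. weight p / dst X (fst p) (snd p) ^ 3)"
proof -
  define d where "d = root 3 (9 * M / 2)"
  have d: "d > 0" "d ^ 3 = 9 * M / 2" using M_pos by (simp_all add: d_def real_root_pow_pos2)
  define r where "r p = dst X (fst p) (snd p)" for p
  have r: "r p > 0" if "p \<in> pairs" for p
    using critical_dst_pos[OF X, of "fst p" "snd p"] that by (auto simp: r_def pairs_def)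
  define g where "g p = weight p * (((r p / d)\<^sup>2 - 1) * (1 - d ^ 3 / r p ^ 3))" for p
  have g0: "g p \<ge> 0 \<and> (g p = 0 \<longrightarrow> r p = d)" if p: "p \<in> pairs" for p
  proof (cases "r p" d rule: linorder_cases)
    case less
    then have "(r p / d)\<^sup>2 < 1" "d ^ 3 / r p ^ 3 > 1"
      using r[OF p] d(1) by (auto simp: power_divide power_strict_mono)
    then have "((r p / d)\<^sup>2 - 1) * (1 - d ^ 3 / r p ^ 3) > 0" by (intro mult_neg_neg) auto
    then have "g p > 0" unfolding g_def by (rule mult_pos_pos[OF w_pos[OF p]])
    then show ?thesis by simp
  next
    case equal
    then show ?thesis using d by (simp add: g_def)
  next
    case greater
    then have "(r p / d)\<^sup>2 > 1" "d ^ 3 / r p ^ 3 < 1"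
      using r[OF p] d(1) by (auto simp: power_divide power_strict_mono)
    then have "((r p / d)\<^sup>2 - 1) * (1 - d ^ 3 / r p ^ 3) > 0" by (intro mult_pos_pos) auto
    then have "g p > 0" unfolding g_def by (rule mult_pos_pos[OF w_pos[OF p]])
    then show ?thesis by simp
  qed
  have "sum g pairs > 0"
  proof (rule ccontr)
    assume "\<not> sum g pairs > 0"
    moreover have "sum g pairs \<ge> 0" using g0 by (intro sum_nonneg) auto
    ultimately have "sum g pairs = 0" by simp
    then have "\<forall>p\<in>pairs. g p = 0"
      using sum_nonneg_eq_0_iff[of pairs g] g0 finite_P by auto
    then have "r p = d" if "p \<in> pairs" for p using g0 that by auto
    then have *: "dst X i j = d" if "i < j" for i j using that by (force simp: r_def pairs_def)
    have "dst X i j = d" if "i \<noteq> j" for i j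
      using *[of i j] *[of j i] that dst_sym[of X i j] by (cases "i < j") auto
    with ne d(2) show False by auto
  qed
  also have "sum g pairs = (\<Sum>p\<in>pairs. weight p * (r p)\<^sup>2 / d\<^sup>2 - d * (weight p / r p) + d ^ 3 * (weight p / r p ^ 3) - weight p)"
  proof (rule sum.cong)
    fix p assume "p \<in> pairs"
    then show "g p = weight p * (r p)\<^sup>2 / d\<^sup>2 - d * (weight p / r p) + d ^ 3 * (weight p / r p ^ 3) - weight p"
      using r[of p] d(1) by (simp add: g_def field_simps power2_eq_square power3_eq_cube)
  qed simp
  also have "\<dots> = (\<Sum>p\<in>pairs. weight p * (r p)\<^sup>2) / d\<^sup>2 - d * (\<Sum>p\<in>pairs. weight p / r p)
      + d ^ 3 * (\<Sum>p\<in>pairs. weight p / r p ^ 3) - (\<Sum>p\<in>pairs. weight p)"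
    by (simp add: sum.distrib sum_subtractf sum_distrib_left sum_divide_distrib)
  also have "d * (\<Sum>p\<in>pairs. weight p / r p) = (\<Sum>p\<in>pairs. weight p * (r p)\<^sup>2) / d\<^sup>2"
  proof -
    have "2 / (9 * M) = 1 / d ^ 3" unfolding d(2) by simp
    then have "(\<Sum>p\<in>pairs. weight p / r p) = 1 / d ^ 3 * (\<Sum>p\<in>pairs. weight p * (r p)\<^sup>2)"
      using critical_virial[OF X] by (simp add: r_def)
    then show ?thesis using d(1) by (simp add: power2_eq_square power3_eq_cube)
  qed
  finally have "(\<Sum>p\<in>pairs. weight p) < d ^ 3 * (\<Sum>p\<in>pairs. weight p / r p ^ 3)" by simp
  then show ?thesis using M_pos unfolding d(2) r_def by (simp add: field_simps)
qed

lemma sum_weights: "2 * (\<Sum>p\<in>pairs. weight p) = M * M - (\<Sum>i\<in>UNIV. m i * m i)"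
proof -
  define f where "f i j = m i * m j - (if j = i then m i * m i else 0)" for i j
  have "(\<Sum>i\<in>UNIV. \<Sum>j\<in>UNIV. f i j) = (\<Sum>p\<in>pairs. f (fst p) (snd p) + f (snd p) (fst p))"
    by (rule sum_pairs) (simp add: f_def)
  also have "\<dots> = (\<Sum>p\<in>pairs. 2 * weight p)"
    by (rule sum.cong) (auto simp: f_def pairs_def weight_def)
  also have "(\<Sum>i\<in>UNIV. \<Sum>j\<in>UNIV. f i j) = M * M - (\<Sum>i\<in>UNIV. m i * m i)"
    by (simp add: f_def sum_subtractf M_def sum_product)
  finally show ?thesis by (simp add: sum_distrib_left)
qed

text \<open>The defect \<open>C\<close> of the stiffness from 2/9 is symmetric with values in the
  kernel line, hence \<gamma> times \<open>outer n n\<close>, and the trace exceeds 2/3 by \<gamma>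
  times |n|^2. The sign of \<gamma> is found by summing the form of \<open>C\<close> over the
  vectors \<open>m i *\<^sub>R b i\<close>, which gives twice the gap in
  \<open>critical_weight_sum\<close>.\<close>

lemma planar_critical:
  assumes X: "critical X" and n: "n \<noteq> 0" "X *v n = 0" and ker: "\<And>v. X *v v = 0 \<Longrightarrow> \<exists>c. v = c *\<^sub>R n"
  shows "2/3 < trace (stiffness X)"
proof -
  define C where "C v = stiffness X *v v - (2/9) *\<^sub>R v" for v
  have XC: "X *v C v = 0" for v
    by (simp add: C_def matrix_vector_mult_diff_distrib matrix_vector_mult_scaleR critical_mv[OF X])
  have Csym: "u \<bullet> C v = v \<bullet> C u" for u v
    by (simp add: C_def inner_diff_right stiffness_sym[of u] inner_commute)
  obtain \<beta> where \<beta>: "C n = \<beta> *\<^sub>R n" using ker XC by blast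
  define \<gamma> where "\<gamma> = \<beta> / (n \<bullet> n)"
  have C: "C v = (\<gamma> * (n \<bullet> v)) *\<^sub>R n" for v
  proof -
    obtain \<alpha> where \<alpha>: "C v = \<alpha> *\<^sub>R n" using ker XC by blast
    have "\<alpha> * (n \<bullet> n) = v \<bullet> C n" using Csym[of n v] by (simp add: \<alpha>)
    then have "\<alpha> * (n \<bullet> n) = \<beta> * (n \<bullet> v)" by (simp add: \<beta> inner_commute)
    then have "\<alpha> = \<gamma> * (n \<bullet> v)" using n(1) by (simp add: \<gamma>_def field_simps)
    then show ?thesis by (simp add: \<alpha>)
  qed
  have "stiffness X *v v = ((2/9) *\<^sub>R mat 1 + \<gamma> *\<^sub>R outer n n) *v v" for v
  proof -
    have "stiffness X *v v = (2/9) *\<^sub>R v + C v" by (simp add: C_def)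
    then show ?thesis
      by (simp add: C matrix_vector_mult_add_rdistrib scaleR_matrix_vector_assoc[symmetric] outer_vec)
  qed
  then have "stiffness X = (2/9) *\<^sub>R mat 1 + \<gamma> *\<^sub>R outer n n" by (simp add: matrix_eq)
  then have tr: "trace (stiffness X) = 2/3 + \<gamma> * (norm n)\<^sup>2"
    by (simp add: trace_add trace_outer[symmetric]) (simp add: trace_def mat_def sum_distrib_left)
  have e: "edge p \<bullet> (m k *\<^sub>R b k) = (if k = fst p then 1 else 0) - (if k = snd p then 1 else 0)" for p k
    using dual[of k "fst p" "snd p"] by (simp only: edge_def inner_commute)
  have "(\<Sum>i\<in>UNIV. (m i *\<^sub>R b i) \<bullet> (stiffness X *v (m i *\<^sub>R b i)))
      = (\<Sum>p\<in>pairs. \<Sum>i\<in>UNIV. weight p / dst X (fst p) (snd p) ^ 3 * (edge p \<bullet> (m i *\<^sub>R b i)) * (edge p \<bullet> (m i *\<^sub>R b i)))"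
    unfolding stiffness_form by (rule sum.swap)
  also have "\<dots> = (\<Sum>p\<in>pairs. 2 * (weight p / dst X (fst p) (snd p) ^ 3))"
  proof (rule sum.cong)
    fix p assume p: "p \<in> pairs"
    have "(\<Sum>i\<in>UNIV. (edge p \<bullet> (m i *\<^sub>R b i)) * (edge p \<bullet> (m i *\<^sub>R b i)))
      = (\<Sum>i\<in>UNIV. (if i = fst p then 1 else 0) + (if i = snd p then 1 else 0))"
      unfolding e using p by (intro sum.cong) (auto simp: pairs_def)
    also have "\<dots> = 2" by (simp add: sum.distrib)
    finally show "(\<Sum>i\<in>UNIV. weight p / dst X (fst p) (snd p) ^ 3 * (edge p \<bullet> (m i *\<^sub>R b i)) * (edge p \<bullet> (m i *\<^sub>R b i)))
      = 2 * (weight p / dst X (fst p) (snd p) ^ 3)"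
      unfolding mult.assoc sum_distrib_left[symmetric] by simp
  qed simp
  finally have S: "(\<Sum>i\<in>UNIV. (m i *\<^sub>R b i) \<bullet> (stiffness X *v (m i *\<^sub>R b i)))
      = 2 * (\<Sum>p\<in>pairs. weight p / dst X (fst p) (snd p) ^ 3)"
    by (simp add: sum_distrib_left)
  have "(\<Sum>i\<in>UNIV. (m i *\<^sub>R b i) \<bullet> (m i *\<^sub>R b i)) = (\<Sum>i\<in>UNIV. m i - m i * m i / M)"
    using m_pos by (intro sum.cong) (auto simp: gram right_diff_distrib less_imp_neq[symmetric])
  also have "\<dots> = M - (\<Sum>i\<in>UNIV. m i * m i) / M"
    by (simp add: sum_subtractf sum_divide_distrib M_def)
  also have "\<dots> = 2 * (\<Sum>p\<in>pairs. weight p) / M"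
    unfolding sum_weights using M_pos by (simp add: field_simps)
  finally have T: "(\<Sum>i\<in>UNIV. (m i *\<^sub>R b i) \<bullet> (m i *\<^sub>R b i)) = 2 * (\<Sum>p\<in>pairs. weight p) / M" .
  \<comment> \<open>Equal sides would make \<open>X\<close> injective, but it annihilates
    \<open>n\<close>.\<close>
  have "\<not> (\<forall>i j. i \<noteq> j \<longrightarrow> dst X i j ^ 3 = 9 * M / 2)"
  proof
    assume a: "\<forall>i j. i \<noteq> j \<longrightarrow> dst X i j ^ 3 = 9 * M / 2"
    have "dst X i j = root 3 (9 * M / 2)" if "i \<noteq> j" for i j
    proof -
      have "dst X i j ^ 3 = 9 * M / 2" using a that by blast
      moreover have "root 3 (dst X i j ^ 3) = dst X i j"
        by (rule real_root_power_cancel) (simp_all add: dst_def)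
      ultimately show ?thesis by (simp only:)
    qed
    with regular_nondegenerate[of "root 3 (9 * M / 2)" X n] M_pos n show False by auto
  qed
  from critical_weight_sum[OF X this]
  have "0 < 2 * (\<Sum>p\<in>pairs. weight p / dst X (fst p) (snd p) ^ 3) - (2/9) * (2 * (\<Sum>p\<in>pairs. weight p) / M)"
    by simp
  also have "\<dots> = (\<Sum>i\<in>UNIV. (m i *\<^sub>R b i) \<bullet> C (m i *\<^sub>R b i))"
    unfolding S[symmetric] T[symmetric] C_def
    by (simp only: inner_diff_right inner_scaleR_right sum_subtractf sum_distrib_left)
  also have "\<dots> = \<gamma> * (\<Sum>i\<in>UNIV. (m i * (n \<bullet> b i))\<^sup>2)"
    by (simp add: C power2_eq_square sum_distrib_left inner_commute mult_ac)
  finally have "\<gamma> > 0"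
    using sum_nonneg[of UNIV "\<lambda>i. (m i * (n \<bullet> b i))\<^sup>2"] by (simp add: zero_less_mult_iff)
  then show ?thesis using tr n(1) by simp
qed

lemma collinear_critical:
  assumes X: "critical X" and x: "\<And>i. X *v b i = x i *\<^sub>R z" "norm z = 1"
  shows "2/3 < trace (stiffness X)"
proof -
  have dst: "dst X i j = \<bar>x i - x j\<bar>" for i j
    by (simp add: dst_def x scaleR_left_diff_distrib[symmetric])
  have "inj x"
    using critical_dst_pos[OF X] by (force simp: inj_def dst)
  then obtain i1 i2 i3 i4 where o: "x i1 < x i2" "x i2 < x i3" "x i3 < x i4" "UNIV = {i1, i2, i3, i4}"
    using sort_four by blast
  have o': "x i1 < x i3" "x i1 < x i4" "x i2 < x i4" using o by auto
  have ne: "i1 \<noteq> i2" "i1 \<noteq> i3" "i1 \<noteq> i4" "i2 \<noteq> i3" "i2 \<noteq> i4" "i3 \<noteq> i4" using o(1-3) o' by auto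
  have expand: "(\<Sum>j\<in>UNIV. f j) = f i1 + f i2 + f i3 + f i4" for f :: "4 \<Rightarrow> real"
    unfolding o(4) using ne by (simp add: add.assoc)
  have eq: "(2/9) * x i = (\<Sum>j\<in>UNIV. m j / \<bar>x i - x j\<bar> ^ 3 * (x i - x j))" for i
  proof -
    have "force X *v b i = (- (2/9) *\<^sub>R X) *v b i" using X by (simp add: critical_def)
    then have "(2/9) *\<^sub>R (X *v b i) = (\<Sum>j\<in>UNIV. (m j / dst X i j ^ 3) *\<^sub>R (X *v b i - X *v b j))"
      by (simp add: force_b scaleR_matrix_vector_assoc[symmetric]
          bounded_bilinear.minus_left[OF bounded_bilinear_mv])
    then have "((2/9) * x i) *\<^sub>R z = (\<Sum>j\<in>UNIV. m j / \<bar>x i - x j\<bar> ^ 3 * (x i - x j)) *\<^sub>R z"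
      by (simp add: x(1) dst scaleR_left_diff_distrib[symmetric] scaleR_sum_left)
    then show ?thesis using x(2) by auto
  qed
  note c = cube_inverse_pos[OF o(1)] cube_inverse_pos[OF o(2)] cube_inverse_pos[OF o(3)]
    cube_inverse_pos[OF o'(1)] cube_inverse_pos[OF o'(2)] cube_inverse_pos[OF o'(3)]
  have "3 * (2/9) < (m i1 + m i2) / (x i2 - x i1) ^ 3 + (m i1 + m i3) / (x i3 - x i1) ^ 3 + (m i1 + m i4) / (x i4 - x i1) ^ 3
    + (m i2 + m i3) / (x i3 - x i2) ^ 3 + (m i2 + m i4) / (x i4 - x i2) ^ 3 + (m i3 + m i4) / (x i4 - x i3) ^ 3"
    by (rule collinear_sum[OF o(1-3) m_pos m_pos m_pos m_pos]) (simp_all only: eq expand c, simp_all)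
  also have "\<dots> = (\<Sum>i\<in>UNIV. \<Sum>j\<in>UNIV. m i / dst X i j ^ 3)"
    using o(1-3) o' unfolding expand dst by (simp add: add_divide_distrib abs_if)
  also have "\<dots> = (\<Sum>p\<in>pairs. m (fst p) / dst X (fst p) (snd p) ^ 3 + m (snd p) / dst X (snd p) (fst p) ^ 3)"
    by (rule sum_pairs) simp
  also have "\<dots> = trace (stiffness X)"
    unfolding trace_stiffness_dst by (intro sum.cong) (auto simp: dst_sym add_divide_distrib)
  finally show ?thesis by simp
qed

text \<open>A kernel of dimension one is the planar case. A larger kernel leaves rank one, the
  collinear case, since rank zero would be a collision.\<close>

lemma degenerate_critical:
  assumes X: "critical X" and D: "det X = 0"
  shows "2/3 < trace (stiffness X)"
proof -
  obtain n where n: "n \<noteq> 0" "X *v n = 0"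
  proof -
    have "\<not> (\<exists>B. B ** X = mat 1)" using D by (metis invertible_det_nz invertible_left_inverse)
    then show ?thesis using that unfolding matrix_left_invertible_ker by blast
  qed
  show ?thesis
  proof (cases "\<forall>v. X *v v = 0 \<longrightarrow> (\<exists>c. v = c *\<^sub>R n)")
    case True
    then show ?thesis using planar_critical[OF X n] by blast
  next
    case False
    then obtain n' where n': "X *v n' = 0" "\<And>c. n' \<noteq> c *\<^sub>R n" by blast
    \<comment> \<open>Bodies 1 and 2 do not collide, so \<open>v\<close> completes two kernel
      vectors to a basis and \<open>X *v v\<close> spans the range.\<close>
    define v where "v = b 1 - b 2"
    have "(1 :: 4) \<noteq> 2" by simp
    then have Xv: "X *v v \<noteq> 0"
      using X collisionless_iff[of X] by (auto simp: critical_def v_def matrix_vector_mult_diff_distrib)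
    have n'n: "n' \<notin> span {n}" using n'(2) by (auto simp: span_singleton)
    have ker: "X *v y = 0" if y: "y \<in> span {n', n}" for y
    proof -
      obtain c where "y - c *\<^sub>R n' \<in> span {n}" using y unfolding span_insert[of n'] by blast
      then obtain k where "y - c *\<^sub>R n' = k *\<^sub>R n" unfolding span_singleton by blast
      then have "y = c *\<^sub>R n' + k *\<^sub>R n" by (simp add: algebra_simps)
      then show ?thesis using n(2) n'(1) by (simp add: matrix_vector_right_distrib matrix_vector_mult_scaleR)
    qed
    then have vn: "v \<notin> span {n', n}" using Xv by auto
    have "independent {v, n', n}"
      using n(1) n'n vn by (simp add: independent_insert)
    moreover have "card {v, n', n} = 3"
    proof -
      have "v \<noteq> n'" "v \<noteq> n" "n' \<noteq> n" using n'n vn by (auto intro: span_base)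
      then show ?thesis by simp
    qed
    ultimately have "UNIV \<subseteq> span {v, n', n}"
      by (intro card_ge_dim_independent) auto
    then have ex: "\<exists>c. X *v u = c *\<^sub>R (X *v v)" for u
    proof -
      have "u \<in> span (insert v {n', n})" using \<open>UNIV \<subseteq> _\<close> by auto
      then obtain c where "u - c *\<^sub>R v \<in> span {n', n}" by (auto simp: span_insert)
      then have "X *v (u - c *\<^sub>R v) = 0" by (rule ker)
      then show ?thesis by (auto simp: matrix_vector_mult_diff_distrib matrix_vector_mult_scaleR)
    qed
    then have "\<forall>i. \<exists>c. X *v b i = c *\<^sub>R (X *v v)" by blast
    from choice[OF this] obtain c where c: "\<forall>i. X *v b i = c i *\<^sub>R (X *v v)" ..
    define z where "z = (1 / norm (X *v v)) *\<^sub>R (X *v v)"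
    have "norm z = 1" using Xv by (simp add: z_def)
    moreover have "X *v b i = (c i * norm (X *v v)) *\<^sub>R z" for i
      using Xv c by (simp add: z_def)
    ultimately show ?thesis
      using collinear_critical[OF X, of "\<lambda>i. c i * norm (X *v v)" z] by simp
  qed
qed

end

section \<open>Total collision\<close>

text \<open>Take an orthonormal basis of the complement of the vector with entries
  \<open>sqrt (m i)\<close> and divide the entries with index \<open>a\<close> by
  \<open>sqrt (m a)\<close>. Orthonormality gives \<open>frame\<close>; completeness, that is the
  formula for the projection onto the complement, gives \<open>gram\<close>.\<close>

lemma mass_frame_exists:
  assumes m: "\<And>i. m i > 0"
  obtains b where "mass_frame m b (sum m UNIV)"
proof -
  define M where "M = sum m UNIV"
  have M: "M > 0" unfolding M_def by (rule sum_pos) (auto simp: m)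
  define s :: "real ^ 4" where "s = (\<chi> i. sqrt (m i))"
  have ss: "s \<bullet> s = M" using m by (simp add: s_def inner_vec_def M_def less_imp_le)
  then have s0: "s \<noteq> 0" using M by auto
  define S where "S = {x. s \<bullet> x = 0}"
  have dimS: "dim S = 3" unfolding S_def using dim_hyperplane[OF s0] by simp
  obtain B where B: "B \<subseteq> S" "pairwise orthogonal B" "\<And>x. x \<in> B \<Longrightarrow> norm x = 1"
    "independent B" "card B = dim S" "span B = S"
    using orthonormal_basis_subspace[of S] subspace_hyperplane unfolding S_def by blast
  have finB: "finite B" using B(4) by (rule independent_imp_finite)
  have "card (UNIV :: 3 set) = card B" using B(5) dimS by simp
  then obtain f :: "3 \<Rightarrow> real ^ 4" where f: "bij_betw f UNIV B"
    using finite_same_card_bij[of "UNIV :: 3 set" B] finB by auto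
  have fB: "f i \<in> B" for i using f by (auto simp: bij_betw_def)
  have finj: "inj f" using f by (auto simp: bij_betw_def)
  have orth: "f i \<bullet> f j = (if i = j then 1 else 0)" for i j
  proof (cases "i = j")
    case True
    then show ?thesis using B(3)[OF fB[of j]] by (simp add: norm_eq_1)
  next
    case False
    then have "f i \<noteq> f j" using finj by (simp add: inj_eq)
    with B(2) fB have "orthogonal (f i) (f j)" by (auto simp: pairwise_def)
    then show ?thesis using False by (simp add: orthogonal_def)
  qed
  have sf: "s \<bullet> f i = 0" for i using fB[of i] B(1) by (auto simp: S_def)
  have complete: "(\<Sum>k\<in>UNIV. f k $ i * f k $ j) = (if i = j then 1 else 0) - s $ i * s $ j / M" for i j
  proof -
    define x where "x = axis i 1 - (s $ i / M) *\<^sub>R s"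
    have "s \<bullet> x = 0" using M by (simp add: x_def inner_diff_right inner_axis ss)
    then have "x \<in> span B" by (simp add: B(6) S_def)
    have xv: "x \<bullet> f k = f k $ i" for k
      by (simp add: x_def inner_diff_left sf inner_axis')
    have "x = (\<Sum>v\<in>B. (x \<bullet> v) *\<^sub>R v)"
      by (rule orthonormal_basis_expand[symmetric]) (use B \<open>x \<in> span B\<close> finB in auto)
    also have "\<dots> = (\<Sum>k\<in>UNIV. (x \<bullet> f k) *\<^sub>R f k)" by (rule sum.reindex_bij_betw[OF f, symmetric])
    finally have "x $ j = (\<Sum>k\<in>UNIV. (x \<bullet> f k) *\<^sub>R f k) $ j" by simp
    then have "(\<Sum>k\<in>UNIV. f k $ i * f k $ j) = x $ j" by (simp add: xv)
    also have "\<dots> = (if i = j then 1 else 0) - s $ i * s $ j / M"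
      by (simp add: x_def axis_def)
    finally show ?thesis .
  qed
  define b :: "4 \<Rightarrow> real ^ 3" where "b a = (\<chi> k. f k $ a / sqrt (m a))" for a
  have "mass_frame m b M"
  proof
    show "m i > 0" for i by (rule m)
    show "M = sum m UNIV" by (rule M_def)
    show "b i \<bullet> b j = (if i = j then 1 / m i else 0) - 1 / M" for i j
    proof -
      have "b i \<bullet> b j = (\<Sum>k\<in>UNIV. f k $ i * f k $ j) / (sqrt (m i) * sqrt (m j))"
        by (simp add: b_def inner_vec_def sum_divide_distrib)
      also have "\<dots> = ((if i = j then 1 else 0) - sqrt (m i) * sqrt (m j) / M) / (sqrt (m i) * sqrt (m j))"
        unfolding complete by (simp add: s_def)
      also have "\<dots> = (if i = j then 1 / m i else 0) - 1 / M"
        using m[of i] m[of j] by (simp add: diff_divide_distrib)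
      finally show ?thesis .
    qed
    show "(\<Sum>i\<in>UNIV. m i * (b i \<bullet> u) * (b i \<bullet> v)) = u \<bullet> v" for u v
    proof -
      have bu: "sqrt (m i) * (b i \<bullet> u) = (\<Sum>k\<in>UNIV. f k $ i * u $ k)" for i u
        using m[of i] by (simp add: b_def inner_vec_def sum_distrib_left)
      have "(\<Sum>i\<in>UNIV. m i * (b i \<bullet> u) * (b i \<bullet> v))
          = (\<Sum>i\<in>UNIV. (sqrt (m i) * (b i \<bullet> u)) * (sqrt (m i) * (b i \<bullet> v)))"
      proof (rule sum.cong)
        fix i show "m i * (b i \<bullet> u) * (b i \<bullet> v) = (sqrt (m i) * (b i \<bullet> u)) * (sqrt (m i) * (b i \<bullet> v))"
          using real_sqrt_mult_self[of "m i"] m[of i] by (simp add: algebra_simps)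
      qed simp
      also have "\<dots> = (\<Sum>i\<in>UNIV. \<Sum>k\<in>UNIV. \<Sum>l\<in>UNIV. u $ k * v $ l * (f k $ i * f l $ i))"
        unfolding bu sum_product by (simp add: mult_ac)
      also have "\<dots> = (\<Sum>k\<in>UNIV. \<Sum>i\<in>UNIV. \<Sum>l\<in>UNIV. u $ k * v $ l * (f k $ i * f l $ i))"
        by (rule sum.swap)
      also have "\<dots> = (\<Sum>k\<in>UNIV. \<Sum>l\<in>UNIV. \<Sum>i\<in>UNIV. u $ k * v $ l * (f k $ i * f l $ i))"
        by (intro sum.cong refl sum.swap)
      also have "\<dots> = (\<Sum>k\<in>UNIV. \<Sum>l\<in>UNIV. u $ k * v $ l * (f k \<bullet> f l))"
        by (simp add: sum_distrib_left inner_vec_def)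
      also have "\<dots> = u \<bullet> v"
        unfolding orth by (simp add: inner_vec_def if_distrib sum.delta cong: if_cong)
      finally show ?thesis .
    qed
  qed
  then show ?thesis using that unfolding M_def by blast
qed

section \<open>Translation between matrices and configurations\<close>

context mass_frame
begin

definition conf :: "real ^ 3 ^ 3 \<Rightarrow> config" where
  "conf X = (\<chi> i. X *v b i)"

lemma bounded_linear_conf: "bounded_linear conf"
  unfolding conf_def[abs_def] linear_conv_bounded_linear[symmetric]
  by (rule linearI) (simp_all add: vec_eq_iff matrix_vector_mult_add_rdistrib scaleR_matrix_vector_assoc[symmetric])

lemma conf_nth [simp]: "conf X $ i = X *v b i"
  by (simp add: conf_def)

lemma conf_centered: "conf X \<in> centered m"
  using sum_mv_b[of X] by (simp add: centered_def)

lemma centered_conf: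
  assumes "q \<in> centered m" obtains X where "conf X = q"
proof -
  interpret bl: bounded_linear "\<lambda>A :: real^3^3. A *v b j" for j
    by (rule bounded_bilinear.bounded_linear_left[OF bounded_bilinear_mv])
  \<comment> \<open>The adjoint of the isometry \<open>conf\<close> for the mass inner product,
    applied to \<open>q\<close>.\<close>
  define X where "X = (\<Sum>i\<in>UNIV. m i *\<^sub>R outer (q $ i) (b i))"
  have "X *v b j = q $ j" for j
  proof -
    have "X *v b j = (\<Sum>i\<in>UNIV. (m i * (b i \<bullet> b j)) *\<^sub>R (q $ i))"
      by (simp add: X_def bl.sum bl.scaleR outer_vec)
    also have "\<dots> = (\<Sum>i\<in>UNIV. (if i = j then q $ i else 0) - (1 / M) *\<^sub>R (m i *\<^sub>R (q $ i)))"
      using m_pos by (intro sum.cong) (auto simp: gram right_diff_distrib scaleR_diff_left less_imp_neq[symmetric])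
    also have "\<dots> = q $ j - (1 / M) *\<^sub>R (\<Sum>i\<in>UNIV. m i *\<^sub>R (q $ i))"
      by (simp add: sum_subtractf scaleR_sum_right)
    finally show ?thesis using assms by (simp add: centered_def)
  qed
  then show ?thesis using that[of X] by (simp add: vec_eq_iff)
qed

lemma mass_norm_conf: "mass_norm m (conf X) = norm X"
  using norm_frame[of X] by (simp add: mass_norm_def mass_inner_def power2_norm_eq_inner[symmetric])
    (metis norm_ge_zero real_sqrt_unique)

lemma collision_free_conf: "collision_free (conf X) \<longleftrightarrow> collisionless X"
  by (simp add: collision_free_def collisionless_iff)

lemma potential_gradient:
  assumes "collisionless X"
  shows "has_mass_gradient m (potential m) (conf (force X)) (conf X)"
proof -
  define q where "q = conf X"
  define g where "g h = - (\<Sum>p\<in>pairs. weight p / dst X (fst p) (snd p) ^ 3 *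
     ((X *v b (fst p) - X *v b (snd p)) \<bullet> (h $ fst p - h $ snd p)))" for h :: config
  have pot: "potential m q = (\<Sum>p\<in>pairs. weight p / norm (q $ fst p - q $ snd p))" for q
    by (simp add: potential_def pairs_def weight_def case_prod_beta)
  have "(potential m has_derivative g) (at q)"
    unfolding pot[abs_def] g_def[abs_def] sum_negf[symmetric]
  proof (rule has_derivative_sum)
    fix p assume p: "p \<in> pairs"
    let ?z = "X *v b (fst p) - X *v b (snd p)"
    have nz: "q $ fst p - q $ snd p \<noteq> 0"
      using assms collisionless_iff[of X] p by (auto simp: q_def pairs_def)
    have z: "q $ fst p - q $ snd p = ?z" by (simp add: q_def)
    have d: "((\<lambda>q :: config. q $ fst p - q $ snd p) has_derivative (\<lambda>h. h $ fst p - h $ snd p)) (at q)"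
      by (intro bounded_linear_imp_has_derivative bounded_linear_sub bounded_linear_vec_nth)
    have n: "((\<lambda>q :: config. norm (q $ fst p - q $ snd p)) has_derivative (\<lambda>h. sgn ?z \<bullet> (h $ fst p - h $ snd p))) (at q)"
      using has_derivative_compose[OF d has_derivative_norm[OF nz]] by (simp add: inner_commute z)
    show "((\<lambda>q. weight p / norm (q $ fst p - q $ snd p)) has_derivative
       (\<lambda>h. - (weight p / dst X (fst p) (snd p) ^ 3 * (?z \<bullet> (h $ fst p - h $ snd p))))) (at q)"
      by (rule has_derivative_eq_rhs[OF has_derivative_divide'[OF has_derivative_const n]])
        (use nz in \<open>auto simp: z dst_def sgn_div_norm power3_eq_cube fun_eq_iff divide_simps\<close>)
  qed
  moreover have "g h = mass_inner m (conf (force X)) h" for h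
  proof -
    define f where "f i j = m i * m j / dst X i j ^ 3 * ((X *v b i - X *v b j) \<bullet> h $ i)" for i j
    have "mass_inner m (conf (force X)) h = - (\<Sum>i\<in>UNIV. \<Sum>j\<in>UNIV. f i j)"
      by (simp add: mass_inner_def force_b f_def inner_sum_left sum_distrib_left sum_negf mult_ac)
    also have "(\<Sum>i\<in>UNIV. \<Sum>j\<in>UNIV. f i j) = (\<Sum>p\<in>pairs. f (fst p) (snd p) + f (snd p) (fst p))"
      by (rule sum_pairs) (simp add: f_def)
    also have "\<dots> = - g h"
      unfolding g_def minus_minus
      by (intro sum.cong refl)
        (simp add: f_def weight_def dst_sym inner_diff_left inner_diff_right mult.commute[of "m (snd _)"] right_diff_distrib)
    finally show ?thesis by simp
  qed
  then have "g = (\<lambda>h. mass_inner m (conf (force X)) h)" by (rule ext)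
  ultimately show ?thesis unfolding has_mass_gradient_def q_def by simp
qed

lemma spatial_conf: "spatial (conf X) \<longleftrightarrow> det X \<noteq> 0"
proof
  assume sp: "spatial (conf X)"
  show "det X \<noteq> 0"
  proof
    assume "det X = 0"
    then obtain u where u: "u \<noteq> 0" "u v* X = 0" using nondegenerate_iff_det[of X] by blast
    have "span (range (\<lambda>a. conf X $ a)) \<subseteq> {x. u \<bullet> x = 0}"
      by (rule span_minimal) (auto simp: subspace_hyperplane dot_lmul_matrix[symmetric] u)
    then have "dim (span (range (\<lambda>a. conf X $ a))) \<le> dim {x. u \<bullet> x = 0}" by (rule dim_subset)
    with sp dim_hyperplane[OF u(1)] show False by (simp add: spatial_def)
  qed
next
  assume D: "det X \<noteq> 0"
  have "x \<in> span (range (\<lambda>a. conf X $ a))" for x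
  proof -
    have "X ** matrix_inv X = mat 1"
      using D unfolding invertible_det_nz[symmetric] invertible_def matrix_inv_def
      by (metis (mono_tags, lifting) someI_ex)
    define n where "n = matrix_inv X *v x"
    have "x = X *v n" by (simp add: n_def matrix_vector_mul_assoc \<open>X ** matrix_inv X = mat 1\<close>)
    also have "n = (\<Sum>i\<in>UNIV. (m i * (b i \<bullet> n)) *\<^sub>R b i)" by (rule frame_expand)
    also have "X *v \<dots> = (\<Sum>i\<in>UNIV. (m i * (b i \<bullet> n)) *\<^sub>R (conf X $ i))"
      by (simp add: matrix_vector_mult_scaleR linear_sum[OF matrix_vector_mul_linear])
    finally show ?thesis by (metis (no_types, lifting) range_eqI span_base span_scale span_sum)
  qed
  then have "span (range (\<lambda>a. conf X $ a)) = UNIV" by auto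
  then show "spatial (conf X)" by (simp add: spatial_def)
qed

text \<open>The edge matrix of \<open>conf X\<close> is a fixed matrix times the transpose of
  \<open>X\<close>, so the choice of the frame contributes only a constant factor.\<close>

lemma orientation_conf: "orientation (conf X) = sgn (det X) * orientation (conf (mat 1))"
proof -
  have "(vector [conf X $ 2 - conf X $ 1, conf X $ 3 - conf X $ 1, conf X $ 4 - conf X $ 1] :: real ^ 3 ^ 3)
     = vector [b 2 - b 1, b 3 - b 1, b 4 - b 1] ** transpose X"
    by (simp add: vec_eq_iff forall_3 vector_3 matrix_matrix_mult_def transpose_def matrix_vector_mult_def
        sum_3 algebra_simps)
  then show ?thesis
    by (simp add: orientation_def det_mul det_transpose sgn_mult)
qed

text \<open>The change of variables \<open>\<xi> = (T - t)\<^sup>-\<^sup>2\<^sup>/\<^sup>3 x\<close>, \<open>T - t = e\<^sup>-\<^sup>\<tau>\<close>.\<close>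

lemma rescaled_orbit:
  assumes T: "T > 0"
    and dx: "\<And>t. t \<in> {0..<T} \<Longrightarrow> (x has_vector_derivative v t) (at t within {0..<T})"
    and dv: "\<And>t. t \<in> {0..<T} \<Longrightarrow> (v has_vector_derivative force (x t)) (at t within {0..<T})"
    and R: "\<And>t. t \<in> {0..<T} \<Longrightarrow> (norm (x t))\<^sup>2 \<le> R * (T - t)"
    and nondeg: "\<And>t u. t \<in> {0..<T} \<Longrightarrow> u v* x t = 0 \<Longrightarrow> u = 0"
    and sym: "\<And>t u z. t \<in> {0..<T} \<Longrightarrow> (u v* v t) \<bullet> (z v* x t) = (z v* v t) \<bullet> (u v* x t)"
    and lower: "\<And>t u. t \<in> {0..<T} \<Longrightarrow> - (1 / (T - t)) * (norm (u v* x t))\<^sup>2 \<le> (u v* v t) \<bullet> (u v* x t)"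
    and a: "exp (- a) < T"
  shows "collision_orbit pairs edge weight (\<lambda>s. exp (2 * s / 3) *\<^sub>R x (T - exp (- s)))
    (\<lambda>s. (2/3) *\<^sub>R (exp (2 * s / 3) *\<^sub>R x (T - exp (- s))) + exp (- s / 3) *\<^sub>R v (T - exp (- s))) a R"
proof -
  define \<theta> where "\<theta> s = T - exp (- s)" for s
  define \<xi> where "\<xi> s = exp (2 * s / 3) *\<^sub>R x (\<theta> s)" for s
  define \<eta> where "\<eta> s = (2/3) *\<^sub>R \<xi> s + exp (- s / 3) *\<^sub>R v (\<theta> s)" for s
  have \<theta>: "0 < \<theta> s" "\<theta> s < T" if "s \<ge> a" for s
  proof -
    have "exp (- s) \<le> exp (- a)" using that by simp
    with a have "exp (- s) < T" by linarith
    then show "0 < \<theta> s" by (simp add: \<theta>_def)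
  qed (simp add: \<theta>_def)
  then have in\<theta>: "\<theta> s \<in> {0..<T}" if "s \<ge> a" for s using that less_imp_le by auto
  have at: "at (\<theta> s) within {0..<T} = at (\<theta> s)" if "s \<ge> a" for s
    by (rule at_within_interior) (use \<theta>[OF that] in simp)
  have d\<theta>: "(\<theta> has_vector_derivative exp (- s)) (at s)" for s
    unfolding \<theta>_def[abs_def] has_real_derivative_iff_has_vector_derivative[symmetric]
    by (rule derivative_eq_intros refl)+ simp
  have dx\<theta>: "((\<lambda>s. x (\<theta> s)) has_vector_derivative exp (- s) *\<^sub>R v (\<theta> s)) (at s)"
    and dv\<theta>: "((\<lambda>s. v (\<theta> s)) has_vector_derivative exp (- s) *\<^sub>R force (x (\<theta> s))) (at s)" if s: "s \<ge> a" for s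
    using vector_diff_chain_at[OF d\<theta> dx[OF in\<theta>[OF s], unfolded at[OF s]]]
      vector_diff_chain_at[OF d\<theta> dv[OF in\<theta>[OF s], unfolded at[OF s]]]
    by (simp_all add: o_def)
  have e: "exp (2 * s / 3) * exp (- s) = exp (- s / 3)" "exp (4 * s / 3) * exp (- s) = exp (s / 3)"
    "exp (- s / 3) * exp (2 * s / 3) = exp (s / 3)" "(exp (2 * s / 3))\<^sup>2 = exp (4 * s / 3)"
    "exp (- s / 3) * exp (- s) = 1 / exp (4 * s / 3)" "exp (s / 3) * exp s = exp (4 * s / 3)" for s :: real
  proof -
    have E: "exp p * exp q = exp r" if "p + q = r" for p q r :: real
      using that exp_add[of p q] by simp
    show "exp (2 * s / 3) * exp (- s) = exp (- s / 3)" "exp (4 * s / 3) * exp (- s) = exp (s / 3)"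
      "exp (- s / 3) * exp (2 * s / 3) = exp (s / 3)" "(exp (2 * s / 3))\<^sup>2 = exp (4 * s / 3)"
      "exp (s / 3) * exp s = exp (4 * s / 3)"
      unfolding power2_eq_square by (rule E, simp)+
    have "exp (- s / 3) * exp (- s) = exp (- (4 * s / 3))" by (rule E) simp
    then show "exp (- s / 3) * exp (- s) = 1 / exp (4 * s / 3)" by (simp add: exp_minus inverse_eq_divide)
  qed
  have "collision_orbit pairs edge weight \<xi> \<eta> a R"
  proof (rule collision_orbit.intro[OF pair_potential_axioms], rule collision_orbit_axioms.intro)
    fix s assume s: "s \<ge> a"
    show "(\<xi> has_vector_derivative \<eta> s) (at s)"
    proof -
      have "((\<lambda>s. exp (2 * s / 3)) has_real_derivative (2/3) * exp (2 * s / 3)) (at s)"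
        by (auto intro!: derivative_eq_intros)
      from has_vector_derivative_scaleR[OF this dx\<theta>[OF s]]
      show ?thesis
        unfolding \<xi>_def[abs_def] \<eta>_def by (rule has_vector_derivative_eq_rhs) (simp add: e(1) add.commute)
    qed
    then have "((\<lambda>s. (2/3) *\<^sub>R \<xi> s) has_vector_derivative (2/3) *\<^sub>R \<eta> s) (at s)"
      by (rule bounded_linear.has_vector_derivative[OF bounded_linear_scaleR_right])
    moreover have "((\<lambda>s. exp (- s / 3)) has_real_derivative (- 1/3) * exp (- s / 3)) (at s)"
      by (auto intro!: derivative_eq_intros)
    note has_vector_derivative_scaleR[OF this dv\<theta>[OF s]]
    ultimately have d: "(\<eta> has_vector_derivative (2/3) *\<^sub>R \<eta> s
        + (exp (- s / 3) *\<^sub>R (exp (- s) *\<^sub>R force (x (\<theta> s))) + ((- 1/3) * exp (- s / 3)) *\<^sub>R v (\<theta> s))) (at s)"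
      unfolding \<eta>_def[abs_def] by (rule has_vector_derivative_add)
    have "exp (- s / 3) *\<^sub>R (exp (- s) *\<^sub>R force (x (\<theta> s))) = force (\<xi> s)"
      unfolding \<xi>_def by (simp only: force_scaleR[OF exp_gt_zero] scaleR_scaleR e(4,5))
    moreover have "((- 1/3) * exp (- s / 3)) *\<^sub>R v (\<theta> s) = (- 1/3) *\<^sub>R (\<eta> s - (2/3) *\<^sub>R \<xi> s)"
      by (simp add: \<eta>_def)
    ultimately have "(2/3) *\<^sub>R \<eta> s
        + (exp (- s / 3) *\<^sub>R (exp (- s) *\<^sub>R force (x (\<theta> s))) + ((- 1/3) * exp (- s / 3)) *\<^sub>R v (\<theta> s))
      = (2/3) *\<^sub>R \<eta> s + (force (\<xi> s) + (- 1/3) *\<^sub>R (\<eta> s - (2/3) *\<^sub>R \<xi> s))"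
      by (simp only:)
    also have "\<dots> = (1/3) *\<^sub>R \<eta> s + (2/9) *\<^sub>R \<xi> s + force (\<xi> s)"
      by (simp add: vec_eq_iff field_simps)
    finally show "(\<eta> has_vector_derivative (1/3) *\<^sub>R \<eta> s + (2/9) *\<^sub>R \<xi> s + force (\<xi> s)) (at s)"
      using d by simp
    have vm\<xi>: "u v* \<xi> s = exp (2 * s / 3) *\<^sub>R (u v* x (\<theta> s))" for u
      by (simp add: \<xi>_def vector_scaleR_matrix_ac)
    have vm\<eta>: "u v* \<eta> s = (2/3) *\<^sub>R (u v* \<xi> s) + exp (- s / 3) *\<^sub>R (u v* v (\<theta> s))" for u
      by (simp add: \<eta>_def vector_scaleR_matrix_ac vector_matrix_mult_add_rdistrib)
    have "u = 0" if "u v* \<xi> s = 0" for u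
      using nondeg[OF in\<theta>[OF s]] that unfolding vm\<xi> by simp
    then show "det (\<xi> s) \<noteq> 0" using nondegenerate_iff_det by blast
    show "(u v* \<eta> s) \<bullet> (z v* \<xi> s) = (z v* \<eta> s) \<bullet> (u v* \<xi> s)" for u z
      unfolding vm\<eta> vm\<xi> using sym[OF in\<theta>[OF s], of u z]
      by (simp add: inner_add_left inner_add_right inner_commute)
    show "- (1/3) * (norm (u v* \<xi> s))\<^sup>2 \<le> (u v* \<eta> s) \<bullet> (u v* \<xi> s)" for u
    proof -
      define N where "N = (norm (u v* x (\<theta> s)))\<^sup>2"
      have "- exp s * N \<le> (u v* v (\<theta> s)) \<bullet> (u v* x (\<theta> s))"
      proof -
        have *: "1 / (T - \<theta> s) = exp s" unfolding \<theta>_def by (simp add: exp_minus divide_inverse)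
        show ?thesis using lower[OF in\<theta>[OF s], of u] unfolding N_def * .
      qed
      then have "exp (s / 3) * (- exp s * N) \<le> exp (s / 3) * ((u v* v (\<theta> s)) \<bullet> (u v* x (\<theta> s)))"
        by (intro mult_left_mono) auto
      moreover have "exp (s / 3) * (- exp s * N) = - (exp (4 * s / 3) * N)"
        by (simp add: e(6)[of s, symmetric] mult.assoc)
      moreover have "(norm (u v* \<xi> s))\<^sup>2 = exp (4 * s / 3) * N"
        unfolding vm\<xi> by (simp add: N_def power_mult_distrib e(4))
      moreover have "(u v* \<eta> s) \<bullet> (u v* \<xi> s)
          = (2/3) * (norm (u v* \<xi> s))\<^sup>2 + exp (s / 3) * ((u v* v (\<theta> s)) \<bullet> (u v* x (\<theta> s)))"
        unfolding vm\<eta> inner_add_left inner_scaleR_left power2_norm_eq_inner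
        unfolding vm\<xi> inner_scaleR_right by (simp add: e(3)[of s, symmetric] mult.assoc)
      ultimately show ?thesis by linarith
    qed
    show "(norm (\<xi> s))\<^sup>2 \<le> R * exp (s / 3)"
    proof -
      have "(norm (x (\<theta> s)))\<^sup>2 \<le> R * exp (- s)" using R[OF in\<theta>[OF s]] by (simp add: \<theta>_def)
      then have "exp (4 * s / 3) * (norm (x (\<theta> s)))\<^sup>2 \<le> exp (4 * s / 3) * (R * exp (- s))"
        by (intro mult_left_mono) auto
      moreover have "exp (4 * s / 3) * (R * exp (- s)) = R * exp (s / 3)"
        by (simp add: e(2)[of s, symmetric] mult_ac)
      ultimately show ?thesis by (simp add: \<xi>_def power_mult_distrib e(4))
    qed
  next
    fix Y assume "collisionless Y" "force Y = - (2/9) *\<^sub>R Y" "det Y = 0"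
    then show "2/3 < trace (stiffness Y)" using degenerate_critical[of Y] by (simp add: critical_def)
  qed
  then show ?thesis unfolding \<xi>_def[abs_def] \<eta>_def[abs_def] \<theta>_def .
qed

text \<open>The point \<open>y\<close> witnesses that the infimum is taken over a nonempty
  set.\<close>

lemma mass_dist_nonneg: "y \<in> S \<Longrightarrow> 0 \<le> mass_dist_to m x S"
  unfolding mass_dist_to_def
  by (rule cINF_greatest) (auto simp: mass_norm_def mass_inner_def intro!: sum_nonneg mult_nonneg_nonneg less_imp_le[OF m_pos])

lemma mass_dist_le: "y \<in> S \<Longrightarrow> mass_dist_to m x S \<le> mass_norm m (x - y)"
  unfolding mass_dist_to_def
  by (rule cINF_lower)
    (auto intro!: bdd_belowI[of _ 0] sum_nonneg mult_nonneg_nonneg less_imp_le[OF m_pos] simp: mass_norm_def mass_inner_def)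

lemma critical_norm: "critical X \<Longrightarrow> det X \<noteq> 0 \<Longrightarrow> M * (norm X)\<^sup>2 = (root 3 (9 * M / 2))\<^sup>2 * (\<Sum>p\<in>pairs. weight p)"
  and critical_side: "critical X \<Longrightarrow> det X \<noteq> 0 \<Longrightarrow> i \<noteq> j \<Longrightarrow> dst X i j = root 3 (9 * M / 2)"
proof -
  show side: "dst X i j = root 3 (9 * M / 2)" if "critical X" "det X \<noteq> 0" "i \<noteq> j" for i j
  proof -
    have "root 3 (dst X i j ^ 3) = dst X i j" by (rule real_root_power_cancel) (simp_all add: dst_def)
    then show ?thesis unfolding critical_regular[OF that] by simp
  qed
  assume X: "critical X" "det X \<noteq> 0"
  have "M * (norm X)\<^sup>2 = (\<Sum>p\<in>pairs. weight p * (root 3 (9 * M / 2))\<^sup>2)"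
    unfolding inertia by (intro sum.cong refl) (use side[OF X] in \<open>auto simp: pairs_def\<close>)
  then show "M * (norm X)\<^sup>2 = (root 3 (9 * M / 2))\<^sup>2 * (\<Sum>p\<in>pairs. weight p)"
    by (simp add: sum_distrib_right[symmetric] mult.commute)
qed

text \<open>Both matrices have the same mutual distances, hence the same Gram matrix, so they differ
  by an orthogonal factor on the left; equal signs of the determinants make it a rotation.\<close>

lemma critical_congruent:
  assumes X: "critical X" "det X \<noteq> 0" and Y: "critical Y" "det Y \<noteq> 0" and s: "sgn (det X) = sgn (det Y)"
  shows "norm X = norm Y" "conf ((1 / norm Y) *\<^sub>R Y) \<in> rotation_orbit (conf ((1 / norm X) *\<^sub>R X))"
proof -
  show n: "norm X = norm Y"
  proof -
    have "M * (norm X)\<^sup>2 = M * (norm Y)\<^sup>2" using critical_norm[OF X] critical_norm[OF Y] by simp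
    then have "(norm X)\<^sup>2 = (norm Y)\<^sup>2" using M_pos by simp
    then show ?thesis by (rule power2_eq_imp_eq) auto
  qed
  define g where "g = Y ** matrix_inv X"
  have inv: "X ** matrix_inv X = mat 1" "matrix_inv X ** X = mat 1"
    using X(2) unfolding invertible_det_nz[symmetric] invertible_def matrix_inv_def
    by (metis (mono_tags, lifting) someI_ex)+
  have gX: "g *v (X *v z) = Y *v z" for z
    by (simp add: g_def matrix_vector_mul_assoc matrix_mul_assoc[symmetric] inv)
  have "dst X i j = dst Y i j" for i j
    using critical_side[OF X, of i j] critical_side[OF Y, of i j] by (cases "i = j") auto
  then have eqn: "norm (X *v z) = norm (Y *v z)" for z
  proof -
    have "(norm (X *v z))\<^sup>2 = (norm (Y *v z))\<^sup>2"
      unfolding norm_mv_dst \<open>\<And>i j. dst X i j = dst Y i j\<close> ..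
    then show ?thesis by (rule power2_eq_imp_eq) auto
  qed
  have "norm (g *v z) = norm z" for z
  proof -
    have z: "X *v (matrix_inv X *v z) = z" by (simp add: matrix_vector_mul_assoc inv)
    have "norm (g *v z) = norm (Y *v (matrix_inv X *v z))" using gX[of "matrix_inv X *v z"] z by simp
    also have "\<dots> = norm z" using eqn[of "matrix_inv X *v z"] z by simp
    finally show ?thesis .
  qed
  then have "orthogonal_transformation ((*v) g)" by (simp add: orthogonal_transformation)
  then have og: "orthogonal_matrix g" by (simp add: orthogonal_transformation_matrix)
  have "det (g ** X) = det Y" by (simp add: g_def matrix_mul_assoc[symmetric] inv)
  then have "sgn (det g) * sgn (det X) = sgn (det Y)" unfolding det_mul by (simp only: sgn_mult[symmetric])
  then have "sgn (det g) = 1" using s X(2) Y(2) by (simp add: sgn_0_0)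
  moreover have "det g = 1 \<or> det g = -1" using det_orthogonal_matrix[OF og] .
  ultimately have "rotation_matrix g" using og by (auto simp: rotation_matrix_def)
  moreover have "conf ((1 / norm Y) *\<^sub>R Y) = (\<chi> i. g *v (conf ((1 / norm X) *\<^sub>R X) $ i))"
    by (simp add: vec_eq_iff n scaleR_matrix_vector_assoc[symmetric] matrix_vector_mult_scaleR gX)
  ultimately show "conf ((1 / norm Y) *\<^sub>R Y) \<in> rotation_orbit (conf ((1 / norm X) *\<^sub>R X))"
    unfolding rotation_orbit_def by blast
qed

end

theorem theorem1p3:
  fixes m :: "4 \<Rightarrow> real" and T :: real and q\<^sub>0 :: config
  assumes "\<And>a. m a > 0"
    and "T > 0"
    and "q\<^sub>0 \<in> centered m"
    and "spatial q\<^sub>0"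
  shows "\<exists>q. total_collision_solution m T q \<and> q 0 = q\<^sub>0 \<and>
           (\<forall>t\<in>{0<..<T}. spatial (q t) \<and> orientation (q t) = orientation q\<^sub>0) \<and>
           (\<exists>s\<^sub>0. limiting_tetrahedron m T q s\<^sub>0 \<and> orientation s\<^sub>0 = orientation q\<^sub>0)"
proof -
  obtain b where "mass_frame m b (sum m UNIV)" using mass_frame_exists assms(1) by blast
  then interpret mass_frame m b "sum m UNIV" .
  define M where "M = sum m UNIV"
  have M: "M > 0" using M_pos by (simp add: M_def)
  obtain X where X: "conf X = q\<^sub>0" using centered_conf assms(3) by blast
  have "det X \<noteq> 0" using assms(4) spatial_conf X by blast
  then have X0: "u = 0" if "u v* X = 0" for u using nondegenerate_iff_det[of X] that by blast
  obtain x v R where x: "x 0 = X"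
    "\<And>t. t \<in> {0..<T} \<Longrightarrow> (x has_vector_derivative v t) (at t within {0..<T})"
    "\<And>t. t \<in> {0..<T} \<Longrightarrow> (v has_vector_derivative force (x t)) (at t within {0..<T})"
    "\<And>t. t \<in> {0..<T} \<Longrightarrow> (norm (x t))\<^sup>2 \<le> R * (T - t)"
    "\<And>t u. t \<in> {0..<T} \<Longrightarrow> u v* x t = 0 \<Longrightarrow> u = 0"
    "\<And>t u z. t \<in> {0..<T} \<Longrightarrow> (u v* v t) \<bullet> (z v* x t) = (z v* v t) \<bullet> (u v* x t)"
    "\<And>t u. t \<in> {0..<T} \<Longrightarrow> - (1 / (T - t)) * (norm (u v* x t))\<^sup>2 \<le> (u v* v t) \<bullet> (u v* x t)"
    using collision_path_exists[OF assms(2) X0] by blast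
  define q where "q t = conf (x t)" for t
  have cl: "collisionless (x t)" if "t \<in> {0..<T}" for t
    using nondegenerate_collisionless x(5)[OF that] by blast
  have nz: "det (x t) \<noteq> 0" if "t \<in> {0..<T}" for t
    using nondegenerate_iff_det[of "x t"] x(5)[OF that] by blast
  have cont: "continuous_on {0..<T} x"
    using x(2) by (meson continuous_on_eq_continuous_within has_vector_derivative_continuous)
  have sgn_x: "sgn (det (x t)) = sgn (det X)" if t: "t \<in> {0..<T}" for t
  proof -
    have sub: "{0..t} \<subseteq> {0..<T}" using t by auto
    show ?thesis
      using det_sign_constant[OF continuous_on_subset[OF cont sub] nz] sub t x(1) by auto
  qed
  have "newton_solution m T q"
    unfolding newton_solution_def
  proof (intro conjI exI ballI)
    fix t assume t: "t \<in> {0..<T}"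
    show "q t \<in> centered m" by (simp add: q_def conf_centered)
    show "collision_free (q t)" using cl[OF t] by (simp add: q_def collision_free_conf)
    show "(q has_vector_derivative conf (v t)) (at t within {0..<T})"
      unfolding q_def[abs_def] by (rule bounded_linear.has_vector_derivative[OF bounded_linear_conf x(2)[OF t]])
    show "((\<lambda>t. conf (v t)) has_vector_derivative conf (force (x t))) (at t within {0..<T})"
      by (rule bounded_linear.has_vector_derivative[OF bounded_linear_conf x(3)[OF t]])
    show "has_mass_gradient m (potential m) (conf (force (x t))) (q t)"
      unfolding q_def by (rule potential_gradient[OF cl[OF t]])
  qed
  moreover have "(q \<longlongrightarrow> 0) (at_left T)"
  proof -
    have "((\<lambda>t. sqrt (R * (T - t))) \<longlongrightarrow> sqrt (R * (T - T))) (at_left T)" by (intro tendsto_intros)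
    then have "((\<lambda>t. sqrt (R * (T - t))) \<longlongrightarrow> 0) (at_left T)" by simp
    moreover have "\<forall>\<^sub>F t in at_left T. norm (x t) \<le> sqrt (R * (T - t))"
      unfolding eventually_at_left_field
      using assms(2) x(4) by (intro exI[of _ 0]) (auto intro: real_le_rsqrt)
    ultimately have "(x \<longlongrightarrow> 0) (at_left T)" by (rule Lim_null_comparison[rotated])
    then have "((\<lambda>t. conf (x t)) \<longlongrightarrow> conf 0) (at_left T)"
      by (rule bounded_linear.tendsto[OF bounded_linear_conf])
    then show ?thesis using linear_0[OF bounded_linear.linear[OF bounded_linear_conf]] by (simp add: q_def[abs_def])
  qed
  ultimately have "total_collision_solution m T q" by (simp add: total_collision_solution_def)
  moreover have "q 0 = q\<^sub>0" by (simp add: q_def x(1) X)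
  moreover have "spatial (q t) \<and> orientation (q t) = orientation q\<^sub>0" if "t \<in> {0<..<T}" for t
    using nz[of t] sgn_x[of t] that
    by (simp add: q_def spatial_conf orientation_conf[of "x t"] orientation_conf[of X] X[symmetric])
  moreover have "\<exists>s\<^sub>0. limiting_tetrahedron m T q s\<^sub>0 \<and> orientation s\<^sub>0 = orientation q\<^sub>0"
  proof -
    \<comment> \<open>This makes \<open>exp (- a) = T / e\<close>, so the rescaled orbit starts at a
      time strictly inside \<open>(0, T)\<close>.\<close>
    define a where "a = 1 - ln T"
    have "exp (- a) = T * exp (- 1)"
      using assms(2) by (simp add: a_def exp_diff exp_minus field_simps)
    then have a: "exp (- a) < T" using assms(2) by simp
    define \<xi> where "\<xi> s = exp (2 * s / 3) *\<^sub>R x (T - exp (- s))" for s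
    define \<eta> where "\<eta> s = (2/3) *\<^sub>R (exp (2 * s / 3) *\<^sub>R x (T - exp (- s))) + exp (- s / 3) *\<^sub>R v (T - exp (- s))" for s
    interpret orbit: collision_orbit pairs edge weight \<xi> \<eta> a R
      unfolding \<xi>_def[abs_def] \<eta>_def[abs_def]
      by (rule rescaled_orbit[OF assms(2) x(2-7) a])
    have in\<theta>: "T - exp (- s) \<in> {0..<T}" if "s \<ge> a" for s
    proof -
      have "exp (- s) \<le> exp (- a)" using that by simp
      with a have "exp (- s) < T" by linarith
      then show ?thesis by simp
    qed
    have "det (exp (2 * a / 3) *\<^sub>R x (T - exp (- a))) = exp (2 * a / 3) ^ 3 * det (x (T - exp (- a)))"
      by (simp add: det_3 power3_eq_cube algebra_simps)
    then have sgn\<xi>: "sgn (det (\<xi> a)) = sgn (det X)"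
      using sgn_x[OF in\<theta>[OF order_refl]] by (simp add: \<xi>_def sgn_mult)
    have lim: "\<exists>r Y. strict_mono r \<and> (\<lambda>n. \<xi> (s (r n))) \<longlonglongrightarrow> Y \<and> critical Y \<and> det Y \<noteq> 0 \<and> sgn (det Y) = sgn (det X)"
      if s: "\<And>n. s n \<ge> a" "filterlim s at_top sequentially" for s :: "nat \<Rightarrow> real"
    proof -
      obtain r Y where "strict_mono r" "(\<lambda>n. \<xi> (s (r n))) \<longlonglongrightarrow> Y" "collisionless Y"
        "force Y = - (2/9) *\<^sub>R Y" "det Y \<noteq> 0" "sgn (det Y) = sgn (det (\<xi> a))"
        by (rule orbit.limit_points[OF s])
      then show ?thesis unfolding critical_def sgn\<xi> by blast
    qed
    \<comment> \<open>A limit point along any one sequence serves as the model tetrahedron; every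
      other limit point is a rotated copy of it.\<close>
    have "filterlim (\<lambda>n. a + real n) at_top sequentially"
      by (rule filterlim_tendsto_add_at_top[OF tendsto_const filterlim_real_sequentially])
    with lim[of "\<lambda>n. a + real n"] obtain Z where Z: "critical Z" "det Z \<noteq> 0" "sgn (det Z) = sgn (det X)" by auto
    have Znz: "norm Z > 0"
    proof -
      have "Z \<noteq> 0" using Z(2) by (auto simp: det_3)
      then show ?thesis by simp
    qed
    define s\<^sub>0 where "s\<^sub>0 = conf ((1 / norm Z) *\<^sub>R Z)"
    have "regular_tetrahedron s\<^sub>0"
      unfolding regular_tetrahedron_def
    proof (intro exI conjI allI impI)
      show "root 3 (9 * M / 2) / norm Z > 0" using M Znz by simp
      fix i j :: 4 assume "i \<noteq> j"
      then have "norm (Z *v b i - Z *v b j) = root 3 (9 * M / 2)"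
        using critical_side[OF Z(1,2)] by (simp add: dst_def M_def)
      then show "dist (s\<^sub>0 $ i) (s\<^sub>0 $ j) = root 3 (9 * M / 2) / norm Z"
        using Znz by (simp add: s\<^sub>0_def dist_norm scaleR_matrix_vector_assoc[symmetric]
            scaleR_diff_right[symmetric])
    qed
    moreover have "mass_norm m s\<^sub>0 = 1" using Znz by (simp add: s\<^sub>0_def mass_norm_conf)
    moreover have "s\<^sub>0 \<in> centered m" by (simp add: s\<^sub>0_def conf_centered)
    \<comment> \<open>Limit points may differ by rotations, so only the distance to the orbit is
      shown to converge: times at which it stays above \<epsilon> would have a further limit point
      \<open>Y\<close>, which lies on the same orbit after normalization.\<close>
    moreover have "((\<lambda>t. mass_dist_to m ((1 / mass_norm m (q t)) *\<^sub>R q t) (rotation_orbit s\<^sub>0)) \<longlongrightarrow> 0) (at_left T)"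
    proof (rule ccontr)
      define f where "f t = mass_dist_to m ((1 / mass_norm m (q t)) *\<^sub>R q t) (rotation_orbit s\<^sub>0)" for t
      assume "\<not> ?thesis"
      then obtain \<epsilon> where \<epsilon>: "\<epsilon> > 0" "\<not> (\<forall>\<^sub>F t in at_left T. dist (f t) 0 < \<epsilon>)"
        unfolding tendsto_iff f_def by blast
      have "s\<^sub>0 \<in> rotation_orbit s\<^sub>0"
        unfolding s\<^sub>0_def by (rule critical_congruent(2)[OF Z(1,2) Z(1,2) refl])
      then have f0: "f t \<ge> 0" for t unfolding f_def by (rule mass_dist_nonneg)
      have "\<exists>t. T - exp (- (a + real n)) < t \<and> t < T \<and> \<epsilon> \<le> f t" for n
      proof (rule ccontr)
        assume "\<not> ?thesis"
        then have "\<forall>t>T - exp (- (a + real n)). t < T \<longrightarrow> dist (f t) 0 < \<epsilon>"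
          using f0 by (auto simp: not_le)
        then have "\<forall>\<^sub>F t in at_left T. dist (f t) 0 < \<epsilon>"
          unfolding eventually_at_left_field by (intro exI[of _ "T - exp (- (a + real n))"]) auto
        with \<epsilon>(2) show False by simp
      qed
      then obtain t where t: "\<And>n. T - exp (- (a + real n)) < t n" "\<And>n. t n < T" "\<And>n. \<epsilon> \<le> f (t n)" by metis
      define s where "s n = - ln (T - t n)" for n
      have ts: "t n = T - exp (- s n)" for n using t(2)[of n] by (simp add: s_def)
      have sn: "s n \<ge> a + real n" for n
      proof -
        have "exp (- s n) \<le> exp (- (a + real n))" using t(1)[of n] unfolding ts by linarith
        then show ?thesis unfolding exp_le_cancel_iff by linarith
      qed
      have sa: "s n \<ge> a" for n using sn[of n] by simp
      have "filterlim s at_top sequentially"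
        by (rule filterlim_at_top_mono[OF \<open>filterlim (\<lambda>n. a + real n) at_top sequentially\<close>])
          (use sn in auto)
      from lim[OF sa this] obtain r Y where Y: "(\<lambda>n. \<xi> (s (r n))) \<longlonglongrightarrow> Y" "critical Y" "det Y \<noteq> 0" "sgn (det Y) = sgn (det X)"
        by blast
      have Ynz: "Y \<noteq> 0" using Y(3) by (auto simp: det_3)
      have orb: "conf ((1 / norm Y) *\<^sub>R Y) \<in> rotation_orbit s\<^sub>0"
        unfolding s\<^sub>0_def by (rule critical_congruent(2)[OF Z(1,2) Y(2,3)]) (use Z Y in simp)
      have fle: "f (t n) \<le> norm ((1 / norm (\<xi> (s n))) *\<^sub>R \<xi> (s n) - (1 / norm Y) *\<^sub>R Y)" for n
      proof -
        have "(1 / norm (\<xi> (s n))) *\<^sub>R \<xi> (s n) = (1 / norm (x (t n))) *\<^sub>R x (t n)"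
          by (simp add: \<xi>_def ts[symmetric])
        then have "(1 / mass_norm m (q (t n))) *\<^sub>R q (t n) = conf ((1 / norm (\<xi> (s n))) *\<^sub>R \<xi> (s n))"
          by (simp add: q_def mass_norm_conf linear_scale[OF bounded_linear.linear[OF bounded_linear_conf]])
        then have "f (t n) \<le> mass_norm m (conf ((1 / norm (\<xi> (s n))) *\<^sub>R \<xi> (s n)) - conf ((1 / norm Y) *\<^sub>R Y))"
          unfolding f_def using mass_dist_le[OF orb] by simp
        then show ?thesis
          by (simp only: linear_diff[OF bounded_linear.linear[OF bounded_linear_conf], symmetric] mass_norm_conf)
      qed
      have "(\<lambda>n. norm ((1 / norm (\<xi> (s (r n)))) *\<^sub>R \<xi> (s (r n)) - (1 / norm Y) *\<^sub>R Y))
        \<longlonglongrightarrow> norm ((1 / norm Y) *\<^sub>R Y - (1 / norm Y) *\<^sub>R Y)"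
        using Ynz by (intro tendsto_intros Y(1)) auto
      then have "\<epsilon> \<le> norm ((1 / norm Y) *\<^sub>R Y - (1 / norm Y) *\<^sub>R Y)"
        by (rule tendsto_lowerbound) (auto intro!: always_eventually order_trans[OF t(3) fle])
      with \<epsilon>(1) show False by simp
    qed
    moreover have "orientation s\<^sub>0 = orientation q\<^sub>0"
    proof -
      have "det ((1 / norm Z) *\<^sub>R Z) = (1 / norm Z) ^ 3 * det Z"
        by (simp add: det_3 power3_eq_cube algebra_simps)
      then have "sgn (det ((1 / norm Z) *\<^sub>R Z)) = sgn (det X)"
        using Znz Z(3) by (simp add: sgn_mult)
      then show ?thesis
        unfolding s\<^sub>0_def X[symmetric] orientation_conf[of "(1 / norm Z) *\<^sub>R Z"] orientation_conf[of X] by simp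
    qed
    ultimately show ?thesis unfolding limiting_tetrahedron_def by blast
  qed
  ultimately show ?thesis by blast
qed

end
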